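(* Let $j\ge0$ and let $\mathcal J^{(j)}=(x_1^{a_1},\dots,x_j^{a_j})$ be a marked centre at $p$ that is $j$-semi-associated to $\mathcal I$ and not $\mathcal I$-admissible. Let $\mathbf x=(x_1,\dots,x_n)$ be a system of parameters at $p$ completing $x_1,\dots,x_j$, and put $$S=\Big\{\beta\in\mathbb Z_{\ge0}^n:\ \sum_{i=1}^j\frac{\beta_i}{a_i}<1\text{ and }\partial_{\mathbf x}^\beta\mathcal I=(1)\Big\},\qquad \Xi(\beta)=\frac{\sum_{i=j+1}^n\beta_i}{1-\sum_{i=1}^j\frac{\beta_i}{a_i}},\qquad a_{j+1}=\min_{\beta\in S}\Xi(\beta)$$ (this minimum exists). Let $\beta\in S$ be a minimiser of $\Xi$ on $S$, let $l>j$ be an index with $\beta_l>0$, let $\bar\beta=\beta-e_l$ (where $e_l$ is the $l$-th standard basis vector), let $f\in\mathcal I$ be such that $\partial_{\mathbf x}^\beta f$ does not vanish at $p$, and let $\bar x_{j+1}=\partial_{\mathbf x}^{\bar\beta}f$. Then the marked centre $$\mathcal J^{(j+1)}:=(x_1^{a_1},\dots,x_j^{a_j},\bar x_{j+1}^{a_{j+1}})$$ is $(j+1)$-semi-associated.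
   Context: $\Bbbk$ is a field of characteristic zero, $Y$ a smooth variety (separated, reduced, finite type over $\Bbbk$) of dimension $n$, $\mathcal I\subset\mathcal O_Y$ a coherent ideal such that $X=V(\mathcal I)$ has pure and positive codimension, and $p\in X$ a closed point. Everything is considered in the local ring $\mathcal O_{Y,p}$. Parameters at $p$ are functions $x_1,\dots,x_k$ near $p$, vanishing at $p$, with $dx_1\wedge\dots\wedge dx_k$ nowhere vanishing near $p$; a system of parameters has $k=n$. $\partial_{\mathbf x}^\beta=\partial_{x_1}^{\beta_1}\cdots\partial_{x_n}^{\beta_n}$ are the partial derivatives in the system $\mathbf x$, and $\partial_{\mathbf x}^\beta\mathcal I$ is the ideal of $\mathcal O_{Y,p}$ generated by $\partial_{\mathbf x}^\beta f$, $f\in\mathcal I$. A weighting at $p$ with weights $w_1\ge\dots\ge w_k>0$ (integers, $0\le k\le n$) is a filtration $\mathcal F_\bullet$ of $\mathcal O_{Y,p}$ for which there are parameters $x_1,\dots,x_k$ at $p$ with $\mathcal F_i$ generated by the monomials $x_1^{\beta_1}\cdots x_k^{\beta_k}$ with $\sum_l\beta_lw_l\ge i$; such parameters (in this order), or any system of parameters at $p$ extending them, are called compatible. It is a smooth centre if $\gcd(w_1,\dots,w_k)=1$. A marked centre at $p$ is a pair $\mathcal J=(\mathcal F_\bullet,d)$ of a smooth centre and an integer $d>0$; its invariant is $\mathrm{inv}(\mathcal J)=(d/w_1,\dots,d/w_k)$, a non-decreasing sequence; its compatible parameters are those of $\mathcal F_\bullet$. For parameters $x_1,\dots,x_k$ and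 rationals $0<a_1\le\dots\le a_k$, $(x_1^{a_1},\dots,x_k^{a_k})$ denotes the marked centre with compatible parameters $x_1,\dots,x_k$, weights $w_i=d/a_i$, and $d$ the unique positive integer making the $w_i$ coprime integers. For $k=0$, $()$ is the zero marked centre: $\mathcal F_i=0$ for $i\geq1$, $d=1$. A pre-invariant is a non-decreasing sequence of positive rationals of length at most $n$ (the empty sequence is allowed when a length $0$ sequence is considered). Pre-invariants are ordered lexicographically with truncated sequences considered larger (i.e. pad with $\infty$ to length $n$). $\mathcal J=(\mathcal F_\bullet,d)$ is $\mathcal I$-admissible if $\mathcal I\subset\mathcal F_d$; a pre-invariant is admissible if it is the invariant of an $\mathcal I$-admissible marked centre at $p$. A pre-invariant of length $l\ge j$ dominates one of length $j$ if their first $j$ entries agree. $\mathcal J'$ dominates $\mathcal J$ if $\mathrm{inv}(\mathcal J')$ dominates $\mathrm{inv}(\mathcal J)$ and they have a common compatible system of parameters. A pre-invariant of length $j$ is $j$-semi-admissible if it is dominated by an admissible pre-invariant. $\mathcal J$ is $j$-semi-associated if (1) the maximal $j$-semi-admissible pre-invariant exists and equals $\mathrm{inv}(\mathcal J)$, and (2) every $\mathcal I$-admissible $\mathcal J'$ whose invariant dominates $\mathrm{inv}(\mathcal J)$ dominates $\mathcal J$. *)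

theory Defs
  imports
    Complex_Main
    "HOL-Library.Poly_Mapping"
    "HOL-Library.Extended"
    "HOL-Library.Extended_Nat"
    "HOL-Library.List_Lexorder"
    "HOL-Library.Sublist"
begin

section \<open>Ideals of a commutative ring\<close>

text \<open>
  A commutative ring is a module over itself; its ideals are the submodules, and
  \<open>ideal.span S\<close> is the ideal generated by \<open>S\<close>.
\<close>

global_interpretation ideal: module "(*) :: 'a::comm_ring_1 \<Rightarrow> 'a \<Rightarrow> 'a"
  by unfold_locales (simp_all add: distrib_left distrib_right mult.assoc)

text \<open>As a simplification rule this would loop with associativity.\<close>

declare ideal.scale_scale [simp del]

definition prime_ideal :: "'a::comm_ring_1 set \<Rightarrow> bool" where
  "prime_ideal P \<longleftrightarrow> ideal.subspace P \<and> P \<noteq> UNIV \<and> (\<forall>a b. a * b \<in> P \<longrightarrow> a \<in> P \<or> b \<in> P)"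

text \<open>The supremum of the lengths \<open>r\<close> of chains \<open>P\<^sub>0 \<subset> \<dots> \<subset> P\<^sub>r = P\<close> of prime ideals.\<close>

definition height :: "'a::comm_ring_1 set \<Rightarrow> enat" where
  "height P = (SUP Ps \<in> {Ps. Ps \<noteq> [] \<and> (\<forall>Q\<in>set Ps. prime_ideal Q) \<and> sorted_wrt (\<subset>) Ps \<and> last Ps = P}.
                 enat (length Ps - 1))"

definition minimal_prime_over :: "'a::comm_ring_1 set \<Rightarrow> 'a set \<Rightarrow> bool" where
  "minimal_prime_over I P \<longleftrightarrow>
     prime_ideal P \<and> I \<subseteq> P \<and> (\<forall>Q. prime_ideal Q \<and> I \<subseteq> Q \<and> Q \<subseteq> P \<longrightarrow> Q = P)"

definition pure_positive_codim :: "'a::comm_ring_1 set \<Rightarrow> bool" where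
  "pure_positive_codim I \<longleftrightarrow> (\<exists>c>0. \<forall>P. minimal_prime_over I P \<longrightarrow> height P = c)"

definition noetherian :: "'a::comm_ring_1 itself \<Rightarrow> bool" where
  "noetherian _ \<longleftrightarrow> (\<forall>I::'a set. ideal.subspace I \<longrightarrow> (\<exists>S. finite S \<and> I = ideal.span S))"

text \<open>The set of non-units: the maximal ideal when the ring is local.\<close>

definition max_ideal :: "'a::comm_ring_1 set" where
  "max_ideal = {r. \<not> r dvd 1}"


section \<open>Kaehler differentials\<close>

text \<open>
  The \<open>k\<close>-algebra structure on the ring \<open>'a\<close> is a ring homomorphism \<open>\<phi>\<close> from \<open>k = 'k\<close>.
\<close>

definition algebra_map :: "('k::field_char_0 \<Rightarrow> 'a::comm_ring_1) \<Rightarrow> bool" where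
  "algebra_map \<phi> \<longleftrightarrow> \<phi> 1 = 1 \<and> (\<forall>a b. \<phi> (a + b) = \<phi> a + \<phi> b) \<and> (\<forall>a b. \<phi> (a * b) = \<phi> a * \<phi> b)"

text \<open>
  \<open>'a \<Rightarrow>\<^sub>0 'a\<close> is the free module on the symbols \<open>d r\<close>, where \<open>r\<close> ranges over the ring.
  The module of Kaehler differentials is its quotient by the submodule \<open>kaehler_relations \<phi>\<close>.
  No quotient type is formed: equality in the quotient is membership of the difference.
\<close>

definition free_scale :: "'a::comm_ring_1 \<Rightarrow> ('a \<Rightarrow>\<^sub>0 'a) \<Rightarrow> ('a \<Rightarrow>\<^sub>0 'a)" where
  "free_scale c w = Poly_Mapping.map ((*) c) w"

lemma lookup_free_scale: "Poly_Mapping.lookup (free_scale c w) r = c * Poly_Mapping.lookup w r"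
  by (simp add: free_scale_def Poly_Mapping.map.rep_eq when_def)

global_interpretation free_mod: module "free_scale :: 'a::comm_ring_1 \<Rightarrow> ('a \<Rightarrow>\<^sub>0 'a) \<Rightarrow> ('a \<Rightarrow>\<^sub>0 'a)"
proof
  fix a b :: 'a and v w :: "'a \<Rightarrow>\<^sub>0 'a"
  show "free_scale a (v + w) = free_scale a v + free_scale a w"
    by (rule poly_mapping_eqI) (simp add: lookup_free_scale lookup_add distrib_left)
  show "free_scale (a + b) v = free_scale a v + free_scale b v"
    by (rule poly_mapping_eqI) (simp add: lookup_free_scale lookup_add distrib_right)
  show "free_scale a (free_scale b v) = free_scale (a * b) v"
    by (rule poly_mapping_eqI) (simp add: lookup_free_scale mult.assoc)
  show "free_scale 1 v = v"
    by (rule poly_mapping_eqI) (simp add: lookup_free_scale)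
qed

definition diff :: "'a::comm_ring_1 \<Rightarrow> ('a \<Rightarrow>\<^sub>0 'a)" where
  "diff r = Poly_Mapping.single r 1"

definition kaehler_relations :: "('k::field_char_0 \<Rightarrow> 'a::comm_ring_1) \<Rightarrow> ('a \<Rightarrow>\<^sub>0 'a) set" where
  "kaehler_relations \<phi> = free_mod.span
     ({diff (a + b) - (diff a + diff b) | a b. True}
      \<union> {diff (a * b) - (free_scale a (diff b) + free_scale b (diff a)) | a b. True}
      \<union> {diff (\<phi> c) | c. True})"

text \<open>The kernel of the map from the free module to the fibre of the Kaehler module at the
  closed point, a vector space over the residue field.\<close>

definition kaehler_fibre_relations :: "('k::field_char_0 \<Rightarrow> 'a::comm_ring_1) \<Rightarrow> ('a \<Rightarrow>\<^sub>0 'a) set" where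
  "kaehler_fibre_relations \<phi> = free_mod.span (kaehler_relations \<phi> \<union> {free_scale c w | c w. c \<in> max_ideal})"

definition kaehler_free_of_rank :: "('k::field_char_0 \<Rightarrow> 'a::comm_ring_1) \<Rightarrow> nat \<Rightarrow> bool" where
  "kaehler_free_of_rank \<phi> n \<longleftrightarrow>
     (\<exists>e :: nat \<Rightarrow> ('a \<Rightarrow>\<^sub>0 'a).
        (\<forall>w. \<exists>c. w - (\<Sum>i<n. free_scale (c i) (e i)) \<in> kaehler_relations \<phi>) \<and>
        (\<forall>c. (\<Sum>i<n. free_scale (c i) (e i)) \<in> kaehler_relations \<phi> \<longrightarrow> (\<forall>i<n. c i = 0)))"


section \<open>Local rings of smooth varieties at closed points\<close>

inductive_set subalgebra :: "('k::field_char_0 \<Rightarrow> 'a::comm_ring_1) \<Rightarrow> 'a set \<Rightarrow> 'a set"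
  for \<phi> G where
  scalar: "\<phi> c \<in> subalgebra \<phi> G"
| generator: "g \<in> G \<Longrightarrow> g \<in> subalgebra \<phi> G"
| add: "a \<in> subalgebra \<phi> G \<Longrightarrow> b \<in> subalgebra \<phi> G \<Longrightarrow> a + b \<in> subalgebra \<phi> G"
| mult: "a \<in> subalgebra \<phi> G \<Longrightarrow> b \<in> subalgebra \<phi> G \<Longrightarrow> a * b \<in> subalgebra \<phi> G"

text \<open>
  With \<open>A = subalgebra \<phi> G\<close> and \<open>q = A \<inter> max_ideal\<close>, the first condition says that the ring
  is the localization of the finitely generated algebra \<open>A\<close> at the prime \<open>q\<close>, and the second
  that \<open>q\<close> is maximal in \<open>A\<close>, i.e. a closed point of \<open>Spec A\<close>.
\<close>

definition stalk_at_closed_point :: "('k::field_char_0 \<Rightarrow> 'a::comm_ring_1) \<Rightarrow> bool" where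
  "stalk_at_closed_point \<phi> \<longleftrightarrow>
     (\<exists>G. finite G \<and>
        (\<forall>r. \<exists>a\<in>subalgebra \<phi> G. \<exists>b\<in>subalgebra \<phi> G. b dvd 1 \<and> r * b = a) \<and>
        (\<forall>a\<in>subalgebra \<phi> G. a \<notin> max_ideal \<longrightarrow> (\<exists>b\<in>subalgebra \<phi> G. a * b - 1 \<in> max_ideal)))"

text \<open>
  The local ring of a smooth \<open>n\<close>-dimensional variety over \<open>k\<close> at a closed point. Smoothness is
  the requirement that the Kaehler module is free of rank equal to the dimension. That the ring
  is Noetherian and reduced follows from the other conditions.
\<close>

definition smooth_local_ring :: "('k::field_char_0 \<Rightarrow> 'a::comm_ring_1) \<Rightarrow> nat \<Rightarrow> bool" where
  "smooth_local_ring \<phi> n \<longleftrightarrow>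
     algebra_map \<phi> \<and>
     ideal.subspace (max_ideal :: 'a set) \<and>
     noetherian TYPE('a) \<and>
     (\<forall>r::'a. r\<^sup>2 = 0 \<longrightarrow> r = 0) \<and>
     stalk_at_closed_point \<phi> \<and>
     height (max_ideal :: 'a set) = enat n \<and>
     kaehler_free_of_rank \<phi> n"


section \<open>Parameters and partial derivatives\<close>

text \<open>
  \<open>dx\<^sub>1 \<and> \<dots> \<and> dx\<^sub>k\<close> is nowhere vanishing near \<open>p\<close> iff it does not vanish at \<open>p\<close>, i.e. iff the
  \<open>dx\<^sub>i\<close> are linearly independent in the fibre at \<open>p\<close> of the Kaehler module.
\<close>

definition parameters :: "('k::field_char_0 \<Rightarrow> 'a::comm_ring_1) \<Rightarrow> 'a list \<Rightarrow> bool" where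
  "parameters \<phi> xs \<longleftrightarrow>
     set xs \<subseteq> max_ideal \<and>
     (\<forall>c. (\<Sum>i<length xs. free_scale (c i) (diff (xs ! i))) \<in> kaehler_fibre_relations \<phi>
          \<longrightarrow> (\<forall>i<length xs. c i \<in> max_ideal))"

definition system_of_parameters :: "('k::field_char_0 \<Rightarrow> 'a::comm_ring_1) \<Rightarrow> nat \<Rightarrow> 'a list \<Rightarrow> bool" where
  "system_of_parameters \<phi> n xs \<longleftrightarrow> parameters \<phi> xs \<and> length xs = n"

definition derivation :: "('k::field_char_0 \<Rightarrow> 'a::comm_ring_1) \<Rightarrow> ('a \<Rightarrow> 'a) \<Rightarrow> bool" where
  "derivation \<phi> D \<longleftrightarrow>
     (\<forall>a b. D (a + b) = D a + D b) \<and> (\<forall>a b. D (a * b) = a * D b + b * D a) \<and> (\<forall>c. D (\<phi> c) = 0)"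

text \<open>List positions, hence variables, are numbered from \<open>0\<close>.\<close>

definition partial_deriv :: "('k::field_char_0 \<Rightarrow> 'a::comm_ring_1) \<Rightarrow> 'a list \<Rightarrow> nat \<Rightarrow> 'a \<Rightarrow> 'a" where
  "partial_deriv \<phi> xs i =
     (THE D. derivation \<phi> D \<and> (\<forall>j<length xs. D (xs ! j) = (if j = i then 1 else 0)))"

definition multi_deriv :: "('k::field_char_0 \<Rightarrow> 'a::comm_ring_1) \<Rightarrow> 'a list \<Rightarrow> (nat \<Rightarrow> nat) \<Rightarrow> 'a \<Rightarrow> 'a" where
  "multi_deriv \<phi> xs \<beta> = foldr (\<lambda>i g. (partial_deriv \<phi> xs i ^^ \<beta> i) \<circ> g) [0..<length xs] id"

definition deriv_ideal :: "('k::field_char_0 \<Rightarrow> 'a::comm_ring_1) \<Rightarrow> 'a list \<Rightarrow> (nat \<Rightarrow> nat) \<Rightarrow> 'a set \<Rightarrow> 'a set" where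
  "deriv_ideal \<phi> xs \<beta> I = ideal.span (multi_deriv \<phi> xs \<beta> ` I)"


section \<open>Weightings and marked centres\<close>

definition weight_filtration :: "'a::comm_ring_1 list \<Rightarrow> nat list \<Rightarrow> nat \<Rightarrow> 'a set" where
  "weight_filtration xs ws i =
     ideal.span {\<Prod>l<length xs. (xs ! l) ^ \<beta> l | \<beta>. i \<le> (\<Sum>l<length xs. \<beta> l * ws ! l)}"

definition weighting :: "('k::field_char_0 \<Rightarrow> 'a::comm_ring_1) \<Rightarrow> nat \<Rightarrow> (nat \<Rightarrow> 'a set) \<Rightarrow> nat list \<Rightarrow> bool" where
  "weighting \<phi> n F ws \<longleftrightarrow>
     length ws \<le> n \<and> sorted_wrt (\<ge>) ws \<and> (\<forall>w\<in>set ws. 0 < w) \<and>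
     (\<exists>xs. parameters \<phi> xs \<and> length xs = length ws \<and> F = weight_filtration xs ws)"

definition weights :: "('k::field_char_0 \<Rightarrow> 'a::comm_ring_1) \<Rightarrow> nat \<Rightarrow> (nat \<Rightarrow> 'a set) \<Rightarrow> nat list" where
  "weights \<phi> n F = (THE ws. weighting \<phi> n F ws)"

text \<open>The empty list of weights counts as coprime: it belongs to the zero centre.\<close>

definition coprime_weights :: "nat list \<Rightarrow> bool" where
  "coprime_weights ws \<longleftrightarrow> ws = [] \<or> Gcd (set ws) = 1"

type_synonym 'a centre = "(nat \<Rightarrow> 'a set) \<times> nat"

definition marked_centre :: "('k::field_char_0 \<Rightarrow> 'a::comm_ring_1) \<Rightarrow> nat \<Rightarrow> 'a centre \<Rightarrow> bool" where
  "marked_centre \<phi> n J \<longleftrightarrow>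
     (\<exists>ws. weighting \<phi> n (fst J) ws \<and> coprime_weights ws) \<and> 0 < snd J"

definition invariant :: "('k::field_char_0 \<Rightarrow> 'a::comm_ring_1) \<Rightarrow> nat \<Rightarrow> 'a centre \<Rightarrow> rat list" where
  "invariant \<phi> n J = map (\<lambda>w. of_nat (snd J) / of_nat w) (weights \<phi> n (fst J))"

definition compatible_system :: "('k::field_char_0 \<Rightarrow> 'a::comm_ring_1) \<Rightarrow> nat \<Rightarrow> 'a centre \<Rightarrow> 'a list \<Rightarrow> bool" where
  "compatible_system \<phi> n J ys \<longleftrightarrow>
     system_of_parameters \<phi> n ys \<and>
     (let ws = weights \<phi> n (fst J) in fst J = weight_filtration (take (length ws) ys) ws)"

text \<open>
  \<open>centre_of \<phi> xs as J\<close> says that \<open>J\<close> is the marked centre \<open>(x\<^sub>1^a\<^sub>1, \<dots>, x\<^sub>k^a\<^sub>k)\<close>. This is a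
  relation rather than a function because a degree \<open>m\<close> for which all \<open>m / a\<^sub>i\<close> are coprime
  integers need not exist, for instance when \<open>as = [3/2]\<close>; if it exists, then \<open>J\<close> is unique.
\<close>

definition centre_of :: "('k::field_char_0 \<Rightarrow> 'a::comm_ring_1) \<Rightarrow> 'a list \<Rightarrow> rat list \<Rightarrow> 'a centre \<Rightarrow> bool" where
  "centre_of \<phi> xs as J \<longleftrightarrow>
     parameters \<phi> xs \<and> length as = length xs \<and> sorted as \<and> (\<forall>a\<in>set as. 0 < a) \<and>
     (\<exists>ws m. J = (weight_filtration xs ws, m) \<and> 0 < m \<and> (as = [] \<longrightarrow> m = 1) \<and>
        coprime_weights ws \<and> map of_nat ws = map (\<lambda>a. of_nat m / a) as)"


section \<open>Admissibility and semi-associated centres\<close>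

definition pre_invariant :: "nat \<Rightarrow> rat list \<Rightarrow> bool" where
  "pre_invariant n as \<longleftrightarrow> length as \<le> n \<and> sorted as \<and> (\<forall>a\<in>set as. 0 < a)"

text \<open>
  Pre-invariants are compared in the lexicographic order of lists after padding with infinity.
  Domination of pre-invariants is the library's \<open>prefix\<close>.
\<close>

definition pad :: "nat \<Rightarrow> rat list \<Rightarrow> rat extended list" where
  "pad n as = map Fin as @ replicate (n - length as) Pinf"

definition pre_invariant_le :: "nat \<Rightarrow> rat list \<Rightarrow> rat list \<Rightarrow> bool" where
  "pre_invariant_le n as bs \<longleftrightarrow> pad n as \<le> pad n bs"

definition admissible :: "'a set \<Rightarrow> 'a centre \<Rightarrow> bool" where
  "admissible I J \<longleftrightarrow> I \<subseteq> fst J (snd J)"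

definition admissible_invariant ::
    "('k::field_char_0 \<Rightarrow> 'a::comm_ring_1) \<Rightarrow> nat \<Rightarrow> 'a set \<Rightarrow> rat list \<Rightarrow> bool" where
  "admissible_invariant \<phi> n I as \<longleftrightarrow>
     (\<exists>J. marked_centre \<phi> n J \<and> admissible I J \<and> invariant \<phi> n J = as)"

definition semi_admissible ::
    "('k::field_char_0 \<Rightarrow> 'a::comm_ring_1) \<Rightarrow> nat \<Rightarrow> 'a set \<Rightarrow> nat \<Rightarrow> rat list \<Rightarrow> bool" where
  "semi_admissible \<phi> n I j as \<longleftrightarrow>
     pre_invariant n as \<and> length as = j \<and> (\<exists>bs. admissible_invariant \<phi> n I bs \<and> prefix as bs)"

definition centre_dominates ::
    "('k::field_char_0 \<Rightarrow> 'a::comm_ring_1) \<Rightarrow> nat \<Rightarrow> 'a centre \<Rightarrow> 'a centre \<Rightarrow> bool" where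
  "centre_dominates \<phi> n J' J \<longleftrightarrow>
     prefix (invariant \<phi> n J) (invariant \<phi> n J') \<and>
     (\<exists>ys. compatible_system \<phi> n J ys \<and> compatible_system \<phi> n J' ys)"

definition semi_associated ::
    "('k::field_char_0 \<Rightarrow> 'a::comm_ring_1) \<Rightarrow> nat \<Rightarrow> 'a set \<Rightarrow> nat \<Rightarrow> 'a centre \<Rightarrow> bool" where
  "semi_associated \<phi> n I j J \<longleftrightarrow>
     marked_centre \<phi> n J \<and>
     semi_admissible \<phi> n I j (invariant \<phi> n J) \<and>
     (\<forall>as. semi_admissible \<phi> n I j as \<longrightarrow> pre_invariant_le n as (invariant \<phi> n J)) \<and>
     (\<forall>J'. marked_centre \<phi> n J' \<and> admissible I J' \<and> prefix (invariant \<phi> n J) (invariant \<phi> n J')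
           \<longrightarrow> centre_dominates \<phi> n J' J)"


section \<open>The next exponent\<close>

definition weighted_degree :: "rat list \<Rightarrow> (nat \<Rightarrow> nat) \<Rightarrow> rat" where
  "weighted_degree as \<beta> = (\<Sum>i<length as. of_nat (\<beta> i) / as ! i)"

text \<open>Multi-indices in \<open>n\<close> variables are functions on \<open>nat\<close> that vanish from \<open>n\<close> on.\<close>

definition S_set ::
    "('k::field_char_0 \<Rightarrow> 'a::comm_ring_1) \<Rightarrow> 'a list \<Rightarrow> 'a set \<Rightarrow> rat list \<Rightarrow> (nat \<Rightarrow> nat) set" where
  "S_set \<phi> xs I as =
     {\<beta>. (\<forall>i\<ge>length xs. \<beta> i = 0) \<and> weighted_degree as \<beta> < 1 \<and> deriv_ideal \<phi> xs \<beta> I = UNIV}"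

definition \<Xi> :: "nat \<Rightarrow> rat list \<Rightarrow> (nat \<Rightarrow> nat) \<Rightarrow> rat" where
  "\<Xi> n as \<beta> = of_nat (\<Sum>i=length as..<n. \<beta> i) / (1 - weighted_degree as \<beta>)"

end

theory Submission
  imports
    Defs
    "HOL-Computational_Algebra.Polynomial"
    "HOL-Combinatorics.Transposition"
begin

text \<open>
  All filtrations are written with rational weights \<open>1 / a\<^sub>i\<close>, so that a centre with invariant
  \<open>as\<close> is admissible iff the ideal has weighted order at least \<open>1\<close>. Two facts carry the proof.
  First, a derivation that lowers the weight of each parameter by at most \<open>c\<close> lowers every weight
  by at most \<open>c\<close>. Second, \<open>f\<close> has weighted order at least \<open>t\<close> as soon as all its derivatives of
  weight less than \<open>t\<close> vanish at the closed point; this needs that parameters generate the maximal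
  ideal (a coefficient field modulo its square gives enough derivations) and Krull's intersection
  theorem.

  If \<open>J'\<close> is admissible and dominates \<open>J\<close>, with next exponent \<open>b\<close>, then with respect to \<open>J'\<close> the
  derivative \<open>\<partial>\<^sub>x\<^sub>i\<close> lowers weights by at most \<open>1 / a\<^sub>i\<close> for \<open>i \<le> j\<close> and by at most \<open>1 / b\<close>
  for \<open>i > j\<close>. A derivative of some element of the ideal that is a unit has used up weight \<open>1\<close>,
  whence \<open>b \<le> \<Xi> \<beta>\<close> for all \<open>\<beta>\<close> in the set \<open>S\<close>. Conversely, for \<open>a = min \<Xi>\<close> the centre
  \<open>(x\<^sub>1^a\<^sub>1, \<dots>, x\<^sub>j^a\<^sub>j, x\<^sub>j\<^sub>+\<^sub>1^a, \<dots>, x\<^sub>n^a)\<close> is admissible by the second fact. When \<open>b = a\<close>,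
  the element \<open>\<partial>\<^sub>x^(\<beta> - e\<^sub>l) f\<close> has weight at least \<open>1 / a\<close> with respect to \<open>J'\<close> and nonzero linear
  part transversal to \<open>x\<^sub>1, \<dots>, x\<^sub>j\<close>, so it can replace a parameter of weight \<open>1 / a\<close> of \<open>J'\<close>.
\<close>

section \<open>Noetherian local rings\<close>

text \<open>Two coordinate systems are in play throughout: the derivatives belong to
  \<open>X\<close>, whereas an admissible \<open>J'\<close> is only known to be compatible with some
  system \<open>Y\<close>. What links the two is that they define the same filtration with the
  weights \<open>1 / a\<^sub>i\<close>, so the effect of the derivatives along \<open>X\<close> on
  the parameters of \<open>Y\<close> has to be read off from this common filtration. Two existence
  questions are arithmetical. The set S may be infinite, but the values of \<Xi> on it are
  non-negative with bounded denominators. And a marked centre with prescribed exponents exists only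
  if some degree turns all its weights into coprime integers. Here the minimiser \<beta> helps: by
  the choice of a it has weight exactly one, which forces the gcd of integral weights to divide the
  degree. The same equation shows that weight 1/a is left after one derivative is omitted. That a is
  not smaller than the earlier exponents follows from comparison with an admissible centre
  dominating J, which semi-association provides.\<close>

lemma max_ideal_iff: "r \<notin> max_ideal \<longleftrightarrow> r dvd 1" for r :: "'a::comm_ring_1"
  by (simp add: max_ideal_def)

text \<open>The union of a chain of ideals is generated by finitely many elements, and these already
  lie in one member of the chain; so Zorn's lemma applies.\<close>

lemma noetherian_maximal:
  assumes noeth: "noetherian TYPE('a::comm_ring_1)"
    and ne: "\<A> \<noteq> {}" and sub: "\<And>A. A \<in> \<A> \<Longrightarrow> ideal.subspace (A :: 'a set)"
  obtains M where "M \<in> \<A>" "\<And>A. A \<in> \<A> \<Longrightarrow> M \<subseteq> A \<Longrightarrow> A = M"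
proof -
  have "\<exists>M\<in>\<A>. \<forall>X\<in>\<A>. M \<subseteq> X \<longrightarrow> X = M"
  proof (rule subset_Zorn_nonempty[OF ne])
    fix C assume C: "C \<noteq> {}" "subset.chain \<A> C"
    have sC: "\<And>A. A \<in> C \<Longrightarrow> ideal.subspace A"
      using C sub by (auto simp: subset.chain_def)
    have "ideal.subspace (\<Union>C)"
    proof (rule ideal.subspaceI)
      show "0 \<in> \<Union>C" using C(1) sC ideal.subspace_0 by blast
    next
      fix x y assume "x \<in> \<Union>C" "y \<in> \<Union>C"
      then obtain A B where AB: "A \<in> C" "x \<in> A" "B \<in> C" "y \<in> B" by auto
      have "A \<subseteq> B \<or> B \<subseteq> A" using C(2) AB by (auto simp: subset.chain_def)
      then show "x + y \<in> \<Union>C" using AB sC ideal.subspace_add by blast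
    next
      fix c x assume "x \<in> \<Union>C"
      then show "c * x \<in> \<Union>C" using sC ideal.subspace_scale by blast
    qed
    then obtain S where S: "finite S" "\<Union>C = ideal.span S"
      using noeth unfolding noetherian_def by blast
    have "S \<subseteq> \<Union>C" using S ideal.span_superset by auto
    then obtain A where A: "A \<in> C" "S \<subseteq> A"
      using finite_subset_Union_chain[OF S(1) _ C] by blast
    have "\<Union>C \<subseteq> A" unfolding S(2) using A sC ideal.span_minimal by blast
    then have "\<Union>C = A" using A by auto
    then show "\<Union>C \<in> \<A>" using A C(2) by (auto simp: subset.chain_def)
  qed
  then show ?thesis using that by blast
qed

lemma span_insert_iff:
  fixes A :: "'a::comm_ring_1 set"
  assumes "ideal.subspace A"
  shows "x \<in> ideal.span (insert b A) \<longleftrightarrow> (\<exists>k. x - k * b \<in> A)"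
  using ideal.span_breakdown_eq[of x b A] ideal.span_eq_iff[THEN iffD2, OF assms] by simp

context
  assumes loc: "ideal.subspace (max_ideal :: 'a::comm_ring_1 set)"
begin

lemma max_ideal_simps:
  shows max_ideal_0: "(0::'a) \<in> max_ideal"
    and max_ideal_1: "(1::'a) \<notin> max_ideal"
    and max_ideal_add: "(a::'a) \<in> max_ideal \<Longrightarrow> b \<in> max_ideal \<Longrightarrow> a + b \<in> max_ideal"
    and max_ideal_diff: "(a::'a) \<in> max_ideal \<Longrightarrow> b \<in> max_ideal \<Longrightarrow> a - b \<in> max_ideal"
    and max_ideal_mult1: "(a::'a) \<in> max_ideal \<Longrightarrow> a * b \<in> max_ideal"
    and max_ideal_mult2: "(a::'a) \<in> max_ideal \<Longrightarrow> b * a \<in> max_ideal"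
  using ideal.subspace_0[OF loc] ideal.subspace_add[OF loc] ideal.subspace_diff[OF loc]
    ideal.subspace_scale[OF loc]
  by (auto simp: mult.commute max_ideal_iff)

lemma max_ideal_prime:
  assumes "(a::'a) * b \<in> max_ideal" shows "a \<in> max_ideal \<or> b \<in> max_ideal"
  using assms by (auto simp: max_ideal_def) (metis mult_dvd_mono mult_1)

lemma subspace_unit_cancel:
  assumes A: "ideal.subspace (A :: 'a set)" and "u \<notin> max_ideal" "u * b \<in> A"
  shows "b \<in> A"
proof -
  obtain v where v: "1 = u * v" using assms(2) by (auto simp: max_ideal_iff dvd_def)
  have "v * (u * b) \<in> A" using ideal.subspace_scale[OF A assms(3)] .
  moreover have "v * (u * b) = b" using v by (metis mult.commute mult.assoc mult_1)
  ultimately show ?thesis by simp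
qed

text \<open>Take \<open>E\<close> maximal among the ideals that contain \<open>A\<close> but not
  \<open>B\<close>. For \<open>b\<close> in \<open>B\<close> outside \<open>E\<close>, the ideal
  generated by \<open>E\<close> and \<open>b\<close> contains \<open>B\<close>. The hypothesis then
  gives \<open>b - x * b \<in> E\<close> with \<open>x\<close> in the maximal ideal, and
  \<open>1 - x\<close> is a unit.\<close>

lemma nakayama:
  assumes noeth: "noetherian TYPE('a)"
    and A: "ideal.subspace (A :: 'a set)" and B: "ideal.subspace B"
    and le: "B \<subseteq> ideal.span (A \<union> {x * b | x b. x \<in> max_ideal \<and> b \<in> B})"
  shows "B \<subseteq> A"
proof (rule ccontr)
  assume nle: "\<not> B \<subseteq> A"
  define \<A> where "\<A> = {E. ideal.subspace E \<and> A \<subseteq> E \<and> \<not> B \<subseteq> E}"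
  have s\<A>: "\<And>X. X \<in> \<A> \<Longrightarrow> ideal.subspace X" by (simp add: \<A>_def)
  have "\<A> \<noteq> {}" using A nle by (auto simp: \<A>_def)
  then obtain E where E: "E \<in> \<A>" "\<And>F. F \<in> \<A> \<Longrightarrow> E \<subseteq> F \<Longrightarrow> F = E"
    using noetherian_maximal[OF noeth _ s\<A>] by metis
  then have sE: "ideal.subspace E" and AE: "A \<subseteq> E" and "\<not> B \<subseteq> E" by (auto simp: \<A>_def)
  then obtain b where b: "b \<in> B" "b \<notin> E" by auto
  define F where "F = ideal.span (insert b E)"
  have EF: "E \<subseteq> F" "b \<in> F" "ideal.subspace F"
    unfolding F_def using ideal.span_superset[of "insert b E"] by auto
  then have "F \<notin> \<A>" using E(2)[of F] b by auto
  then have BF: "B \<subseteq> F" using EF AE by (auto simp: \<A>_def)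
  \<comment> \<open>This is the ideal \<open>E + \<mm> b\<close>. It contains \<open>A\<close> and
    all products of the maximal ideal with \<open>B\<close>.\<close>
  define G where "G = {y. \<exists>x\<in>max_ideal. y - x * b \<in> E}"
  have sG: "ideal.subspace G"
  proof (rule ideal.subspaceI)
    show "0 \<in> G" unfolding G_def using max_ideal_0 ideal.subspace_0[OF sE] by force
  next
    fix y z assume "y \<in> G" "z \<in> G"
    then obtain u v where uv: "u \<in> max_ideal" "v \<in> max_ideal" "y - u * b \<in> E" "z - v * b \<in> E"
      by (auto simp: G_def)
    have "(y + z) - (u + v) * b = (y - u * b) + (z - v * b)" by (simp add: algebra_simps)
    then have "(y + z) - (u + v) * b \<in> E" using ideal.subspace_add[OF sE] uv by presburger
    then show "y + z \<in> G" unfolding G_def using max_ideal_add[OF uv(1,2)] by blast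
  next
    fix c y assume "y \<in> G"
    then obtain u where uv: "u \<in> max_ideal" "y - u * b \<in> E" by (auto simp: G_def)
    have "c * y - (c * u) * b = c * (y - u * b)" by (simp add: algebra_simps)
    then have "c * y - (c * u) * b \<in> E" using ideal.subspace_scale[OF sE] uv by presburger
    then show "c * y \<in> G" unfolding G_def using max_ideal_mult2[OF uv(1)] by blast
  qed
  have "A \<union> {x * b | x b. x \<in> max_ideal \<and> b \<in> B} \<subseteq> G"
  proof
    fix y assume "y \<in> A \<union> {x * b | x b. x \<in> max_ideal \<and> b \<in> B}"
    then consider "y \<in> A" | x b' where "y = x * b'" "x \<in> max_ideal" "b' \<in> B" by auto
    then show "y \<in> G"
    proof cases
      case 1
      then show ?thesis unfolding G_def using AE max_ideal_0 by force
    next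
      case 2
      then obtain k where k: "b' - k * b \<in> E"
        using BF span_insert_iff[OF sE] unfolding F_def by blast
      have "y - (x * k) * b = x * (b' - k * b)" by (simp add: 2 algebra_simps)
      then have "y - (x * k) * b \<in> E" using ideal.subspace_scale[OF sE] k by presburger
      then show ?thesis unfolding G_def using max_ideal_mult1[OF 2(2)] by blast
    qed
  qed
  then have "b \<in> G" using le b ideal.span_minimal[OF _ sG] by blast
  then obtain x where x: "x \<in> max_ideal" "b - x * b \<in> E" by (auto simp: G_def)
  have "1 - x \<notin> max_ideal" using x max_ideal_1 max_ideal_add[of "1-x" x] by auto
  moreover have "(1 - x) * b \<in> E" using x by (simp add: algebra_simps)
  ultimately show False using subspace_unit_cancel[OF sE] b by blast
qed

text \<open>A variant of the usual proof through primary decomposition; it avoids Artin-Rees.\<close>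

lemma krull_intersection:
  assumes noeth: "noetherian TYPE('a)"
    and A: "ideal.subspace (A :: 'a set)"
    and X: "finite L" "\<And>l. l \<in> L \<Longrightarrow> y l \<in> max_ideal"
    and M: "\<And>N. M N = ideal.span {\<Prod>l\<in>L. y l ^ \<gamma> l | \<gamma>. N \<le> (\<Sum>l\<in>L. \<gamma> l)}"
    and f: "\<And>N::nat. f \<in> ideal.span (A \<union> M N)"
  shows "f \<in> A"
proof -
  define B where "B = (\<Inter>N. ideal.span (A \<union> M N))"
  have sB: "ideal.subspace B" unfolding B_def by (auto intro: ideal.subspace_Inter)
  have AB: "A \<subseteq> B" unfolding B_def using ideal.span_superset by fastforce
  \<comment> \<open>Modulo \<open>D\<close> the maximal ideal kills \<open>B\<close>. By
    \<open>nakayama\<close> it is enough to prove \<open>B \<subseteq> D\<close>.\<close>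
  define D where "D = ideal.span (A \<union> {x * b | x b. x \<in> max_ideal \<and> b \<in> B})"
  have DB: "D \<subseteq> B" unfolding D_def
    by (rule ideal.span_minimal) (use AB sB ideal.subspace_scale in auto)
  have sD: "ideal.subspace D" by (simp add: D_def)
  \<comment> \<open>A maximal \<open>E\<close> of this kind contains some \<open>M N\<close>, as
    will be shown. Then it contains \<open>B\<close>, so that
    \<open>B = E \<inter> B \<subseteq> D\<close>.\<close>
  define \<A> where "\<A> = {E. ideal.subspace E \<and> D \<subseteq> E \<and> E \<inter> B \<subseteq> D}"
  have s\<A>: "\<And>X. X \<in> \<A> \<Longrightarrow> ideal.subspace X" by (simp add: \<A>_def)
  have "\<A> \<noteq> {}" using sD by (auto simp: \<A>_def)
  then obtain E where E: "E \<in> \<A>" "\<And>F. F \<in> \<A> \<Longrightarrow> E \<subseteq> F \<Longrightarrow> F = E"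
    using noetherian_maximal[OF noeth _ s\<A>] by metis
  then have sE: "ideal.subspace E" and DE: "D \<subseteq> E" and EB: "E \<inter> B \<subseteq> D" by (auto simp: \<A>_def)
  have pow: "\<exists>k. x ^ k \<in> E" if x: "x \<in> max_ideal" for x
  proof -
    \<comment> \<open>The ascending colon ideals of \<open>E\<close> by the powers of
      \<open>x\<close> become stationary. At such a \<open>k\<close> the power \<open>x ^ k\<close>
      can be adjoined to \<open>E\<close> without meeting \<open>B\<close> outside \<open>D\<close>,
      so maximality puts it into \<open>E\<close>.\<close>
    define Q where "Q k = {r. r * x ^ k \<in> E}" for k
    have sQ: "ideal.subspace (Q k)" for k
      unfolding Q_def ideal.subspace_def
      using ideal.subspace_0[OF sE] ideal.subspace_add[OF sE] ideal.subspace_scale[OF sE]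
      by (simp add: distrib_right mult.assoc)
    have "range Q \<noteq> {}" by simp
    then obtain M where "M \<in> range Q" "\<And>A. A \<in> range Q \<Longrightarrow> M \<subseteq> A \<Longrightarrow> A = M"
      using noetherian_maximal[OF noeth, of "range Q"] sQ by blast
    then obtain k where k: "\<And>k'. Q k \<subseteq> Q k' \<Longrightarrow> Q k' = Q k" by (metis rangeE rangeI)
    have "Q k \<subseteq> Q (Suc k)" unfolding Q_def
    proof
      fix r assume "r \<in> {r. r * x ^ k \<in> E}"
      then have "x * (r * x ^ k) \<in> E" using ideal.subspace_scale[OF sE] by blast
      then show "r \<in> {r. r * x ^ Suc k \<in> E}" by (simp add: algebra_simps)
    qed
    then have Qk: "Q (Suc k) = Q k" by (rule k)
    define F where "F = ideal.span (insert (x ^ k) E)"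
    have EF: "E \<subseteq> F" "x ^ k \<in> F" "ideal.subspace F"
      unfolding F_def using ideal.span_superset[of "insert (x ^ k) E"] by auto
    have "F \<inter> B \<subseteq> D"
    proof
      fix z assume z: "z \<in> F \<inter> B"
      then obtain r where r: "z - r * x ^ k \<in> E"
        using span_insert_iff[OF sE] by (auto simp: F_def)
      \<comment> \<open>Multiplication by \<open>x\<close> sends \<open>B\<close> into
        \<open>D \<subseteq> E\<close>, hence \<open>r * x ^ Suc k\<close> lies in \<open>E\<close>,
        and stationarity removes one factor \<open>x\<close>.\<close>
      have "x * z \<in> D" unfolding D_def
        by (rule ideal.span_base) (use z x in auto)
      then have "x * z \<in> E" using DE by auto
      then have "x * z - x * (z - r * x ^ k) \<in> E"
        using ideal.subspace_diff[OF sE _ ideal.subspace_scale[OF sE r]] by blast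
      then have "r \<in> Q (Suc k)" by (simp add: Q_def algebra_simps)
      then have "r * x ^ k \<in> E" using Qk by (auto simp: Q_def)
      then have "z \<in> E" using ideal.subspace_add[OF sE r, of "r * x ^ k"] by simp
      then show "z \<in> D" using z EB by auto
    qed
    then have "F \<in> \<A>" using EF DE by (auto simp: \<A>_def)
    then have "F = E" using E(2) EF by auto
    then show ?thesis using EF by auto
  qed
  have "\<forall>l\<in>L. \<exists>k. y l ^ k \<in> E" using pow X by auto
  then obtain k where k: "\<And>l. l \<in> L \<Longrightarrow> y l ^ k l \<in> E" by metis
  \<comment> \<open>Pigeonhole: a monomial of degree greater than the sum of all \<open>k l\<close>
    has exponent at least \<open>k l\<close> at some \<open>l\<close>.\<close>
  define N where "N = Suc (\<Sum>l\<in>L. k l)"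
  have "M N \<subseteq> E" unfolding M
  proof (rule ideal.span_minimal[OF _ sE], safe)
    fix \<gamma> :: "'b \<Rightarrow> nat" assume "N \<le> (\<Sum>l\<in>L. \<gamma> l)"
    then have "\<not> (\<Sum>l\<in>L. \<gamma> l) \<le> (\<Sum>l\<in>L. k l)" by (simp add: N_def)
    then obtain l where l: "l \<in> L" "k l \<le> \<gamma> l"
      using sum_mono[of L \<gamma> k] by (meson nat_le_linear)
    have split: "y l ^ \<gamma> l = y l ^ k l * y l ^ (\<gamma> l - k l)"
      using l by (simp add: power_add[symmetric])
    have "(\<Prod>l\<in>L. y l ^ \<gamma> l) = y l ^ \<gamma> l * (\<Prod>l\<in>L-{l}. y l ^ \<gamma> l)"
      using l X by (simp add: prod.remove)
    also have "\<dots> = (y l ^ (\<gamma> l - k l) * (\<Prod>l\<in>L-{l}. y l ^ \<gamma> l)) * y l ^ k l"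
      by (simp only: split ac_simps)
    finally show "(\<Prod>l\<in>L. y l ^ \<gamma> l) \<in> E"
      using ideal.subspace_scale[OF sE k[OF l(1)]] by metis
  qed
  moreover have "A \<subseteq> E" using DE ideal.span_superset unfolding D_def by blast
  ultimately have "ideal.span (A \<union> M N) \<subseteq> E" by (intro ideal.span_minimal[OF _ sE]) auto
  then have "B \<subseteq> E" by (auto simp: B_def)
  then have "B \<subseteq> D" using EB by auto
  then have "B \<subseteq> A" unfolding D_def by (rule nakayama[OF noeth A sB])
  then show ?thesis using f by (auto simp: B_def)
qed

end

section \<open>Coefficient rings modulo the square of the maximal ideal\<close>

definition max_ideal_sq :: "'a::comm_ring_1 set" where
  "max_ideal_sq = ideal.span {a * b | a b. a \<in> max_ideal \<and> b \<in> max_ideal}"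

lemma subspace_max_ideal_sq [simp]: "ideal.subspace max_ideal_sq"
  by (simp add: max_ideal_sq_def)

lemma max_ideal_sq_mult: "a \<in> max_ideal \<Longrightarrow> b \<in> max_ideal \<Longrightarrow> a * b \<in> max_ideal_sq"
  unfolding max_ideal_sq_def by (rule ideal.span_base) auto

text \<open>Modulo the square of the maximal ideal, such a subring embeds into the residue field.\<close>

definition coefficient_ring :: "('k::field_char_0 \<Rightarrow> 'a::comm_ring_1) \<Rightarrow> 'a set \<Rightarrow> bool" where
  "coefficient_ring \<phi> C \<longleftrightarrow>
     range \<phi> \<subseteq> C \<and> (\<forall>a\<in>C. \<forall>b\<in>C. a + b \<in> C \<and> a * b \<in> C) \<and> C \<inter> max_ideal \<subseteq> max_ideal_sq"

definition adjoin :: "'a::comm_ring_1 set \<Rightarrow> 'a \<Rightarrow> 'a set" where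
  "adjoin C s = {poly p s | p. \<forall>i. coeff p i \<in> C}"

text \<open>The sum is the formal derivative of \<open>p\<close>, written out by coefficients, and
  \<open>h * h * k\<close> is the second-order remainder. This is what a Newton step needs.\<close>

lemma poly_taylor1:
  fixes p :: "'a::comm_ring_1 poly"
  assumes d: "degree p = d"
  shows "\<exists>k. poly p (r + h) = poly p r
      + h * poly (\<Sum>i<d. monom (of_nat (Suc i) * coeff p (Suc i)) i) r + h * h * k"
proof -
  have pow: "\<exists>k. (r + h) ^ i = r ^ i + h * (of_nat i * r ^ (i - 1)) + h * h * k" for i
  proof (induction i)
    case (Suc i)
    then obtain k where k: "(r + h) ^ i = r ^ i + h * (of_nat i * r ^ (i - 1)) + h * h * k" by blast
    have "(r + h) ^ Suc i = (r + h) * (r ^ i + h * (of_nat i * r ^ (i - 1)) + h * h * k)"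
      using k by simp
    also have "\<dots> = r ^ Suc i + h * (of_nat (Suc i) * r ^ (Suc i - 1))
        + h * h * (of_nat i * r ^ (i - 1) + (r + h) * k)"
      by (cases i) (simp_all add: algebra_simps)
    finally show ?case by blast
  qed (auto intro: exI[of _ 0])
  then obtain k where k: "\<And>i. (r + h) ^ i = r ^ i + h * (of_nat i * r ^ (i - 1)) + h * h * k i"
    by metis
  have "(\<Sum>i\<le>d. h * (of_nat i * (coeff p i * r ^ (i - Suc 0))))
      = (\<Sum>i<d. h * (of_nat (Suc i) * (r ^ i * coeff p (Suc i))))"
    by (cases d) (simp_all add: sum.atMost_Suc_shift lessThan_Suc_atMost ac_simps del: of_nat_Suc sum.atMost_Suc)
  then have "poly p (r + h) = poly p r
      + h * poly (\<Sum>i<d. monom (of_nat (Suc i) * coeff p (Suc i)) i) r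
      + h * h * (\<Sum>i\<le>d. coeff p i * k i)"
    unfolding poly_altdef[of p] d poly_sum poly_monom k
    by (simp add: sum.distrib sum_distrib_left algebra_simps del: of_nat_Suc)
  then show ?thesis by blast
qed

locale local_algebra =
  fixes \<phi> :: "'k::field_char_0 \<Rightarrow> 'a::comm_ring_1"
  assumes alg: "algebra_map \<phi>"
    and loc: "ideal.subspace (max_ideal :: 'a set)"
begin

lemmas max_simps = max_ideal_simps[OF loc]

lemma \<phi>_simps: "\<phi> 1 = 1" "\<phi> (a + b) = \<phi> a + \<phi> b" "\<phi> (a * b) = \<phi> a * \<phi> b"
  using alg by (auto simp: algebra_map_def)

lemma \<phi>_0: "\<phi> 0 = 0"
  using \<phi>_simps(2)[of 0 0] by simp

lemma \<phi>_of_nat: "\<phi> (of_nat k) = of_nat k"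
  by (induction k) (simp_all add: \<phi>_0 \<phi>_simps)

lemma \<phi>_unit: "c \<noteq> 0 \<Longrightarrow> \<phi> c \<notin> max_ideal"
  using \<phi>_simps(3)[of c "1/c"] by (simp add: \<phi>_simps(1) max_ideal_iff dvd_def) metis

text \<open>Characteristic zero enters here. It keeps the leading coefficient of a derived
  polynomial a unit, and it allows the exponents produced by differentiating monomials to be
  cancelled.\<close>

lemma of_nat_unit: "0 < k \<Longrightarrow> (of_nat k :: 'a) \<notin> max_ideal"
  using \<phi>_unit[of "of_nat k"] by (simp add: \<phi>_of_nat)

lemma coefficient_ring_simps:
  assumes "coefficient_ring \<phi> C"
  shows "0 \<in> C" "1 \<in> C" "\<And>a b. a \<in> C \<Longrightarrow> b \<in> C \<Longrightarrow> a + b \<in> C" "\<And>a b. a \<in> C \<Longrightarrow> b \<in> C \<Longrightarrow> a * b \<in> C"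
    "\<And>a. a \<in> C \<Longrightarrow> - a \<in> C" "\<And>a b. a \<in> C \<Longrightarrow> b \<in> C \<Longrightarrow> a - b \<in> C" "\<And>k. of_nat k \<in> C"
    "\<And>a. a \<in> C \<Longrightarrow> a \<in> max_ideal \<Longrightarrow> a \<in> max_ideal_sq" "\<And>c. \<phi> c \<in> C"
proof -
  show *: "\<And>c. \<phi> c \<in> C" "\<And>a b. a \<in> C \<Longrightarrow> b \<in> C \<Longrightarrow> a + b \<in> C" "\<And>a b. a \<in> C \<Longrightarrow> b \<in> C \<Longrightarrow> a * b \<in> C"
    "\<And>a. a \<in> C \<Longrightarrow> a \<in> max_ideal \<Longrightarrow> a \<in> max_ideal_sq"
    using assms by (auto simp: coefficient_ring_def)
  show "0 \<in> C" "1 \<in> C" using *(1)[of 0] *(1)[of 1] by (simp_all add: \<phi>_0 \<phi>_simps)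
  show "of_nat k \<in> C" for k using *(1)[of "of_nat k"] by (simp add: \<phi>_of_nat)
  have "\<phi> (-1) = -1" using \<phi>_simps(2)[of 1 "-1"] by (simp add: \<phi>_simps(1) \<phi>_0 eq_neg_iff_add_eq_0 add.commute)
  then have "-1 \<in> C" using *(1)[of "-1"] by simp
  then show neg: "- a \<in> C" if "a \<in> C" for a using *(3)[OF _ that, of "-1"] by simp
  show "a - b \<in> C" if "a \<in> C" "b \<in> C" for a b using *(2)[OF that(1) neg[OF that(2)]] by simp
qed

lemma coefficient_ring_sum:
  assumes "coefficient_ring \<phi> C" "\<And>i. i \<in> A \<Longrightarrow> f i \<in> C"
  shows "sum f A \<in> C"
  using assms(2) by (induction A rule: infinite_finite_induct)
    (auto simp: coefficient_ring_simps[OF assms(1)])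

text \<open>Values of polynomials are closed under sums and products, so only the condition on
  non-units has to be tested when \<open>s\<close> is adjoined.\<close>

lemma adjoin_good:
  assumes C: "coefficient_ring \<phi> C"
    and good: "\<And>p. (\<And>i. coeff p i \<in> C) \<Longrightarrow> poly p s \<in> max_ideal \<Longrightarrow> poly p s \<in> max_ideal_sq"
  shows "coefficient_ring \<phi> (adjoin C s) \<and> C \<subseteq> adjoin C s \<and> s \<in> adjoin C s"
proof -
  note Cs = coefficient_ring_simps[OF C]
  have sub: "C \<subseteq> adjoin C s"
  proof
    fix c assume "c \<in> C"
    then have "\<forall>i. coeff [:c:] i \<in> C" using Cs(1) by (simp add: coeff_pCons split: nat.split)
    moreover have "c = poly [:c:] s" by simp
    ultimately show "c \<in> adjoin C s" unfolding adjoin_def by blast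
  qed
  have "\<forall>i. coeff [:0, 1:] i \<in> C" using Cs(1,2) by (simp add: coeff_pCons split: nat.split)
  moreover have "s = poly [:0, 1:] s" by simp
  ultimately have "s \<in> adjoin C s" unfolding adjoin_def by blast
  moreover have "a + b \<in> adjoin C s \<and> a * b \<in> adjoin C s" if "a \<in> adjoin C s" "b \<in> adjoin C s" for a b
  proof -
    obtain p q where pq: "a = poly p s" "b = poly q s" "\<And>i. coeff p i \<in> C" "\<And>i. coeff q i \<in> C"
      using \<open>a \<in> adjoin C s\<close> \<open>b \<in> adjoin C s\<close> by (auto simp: adjoin_def)
    have "\<forall>i. coeff (p + q) i \<in> C" "\<forall>i. coeff (p * q) i \<in> C"
      using pq Cs(3,4) by (auto simp: coeff_mult intro!: coefficient_ring_sum[OF C])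
    moreover have "a + b = poly (p + q) s" "a * b = poly (p * q) s" using pq by simp_all
    ultimately show ?thesis unfolding adjoin_def by blast
  qed
  moreover have "adjoin C s \<inter> max_ideal \<subseteq> max_ideal_sq"
    using good by (auto simp: adjoin_def)
  ultimately show ?thesis using sub Cs(9) unfolding coefficient_ring_def by blast
qed

text \<open>
  A maximal coefficient ring maps onto the residue field: a residue class that is transcendental
  over it may be adjoined as it stands, an algebraic one after one Newton step.
\<close>

lemma exists_coefficient_ring:
  "\<exists>C. coefficient_ring \<phi> C \<and> (\<forall>r. \<exists>s\<in>C. r - s \<in> max_ideal)"
proof -
  have base: "coefficient_ring \<phi> (range \<phi>)"
    unfolding coefficient_ring_def
  proof (intro conjI ballI)
    fix a b assume "a \<in> range \<phi>" "b \<in> range \<phi>"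
    then obtain c d where "a = \<phi> c" "b = \<phi> d" by auto
    then have "a + b = \<phi> (c + d)" "a * b = \<phi> (c * d)" by (simp_all add: \<phi>_simps)
    then show "a + b \<in> range \<phi>" "a * b \<in> range \<phi>" by simp_all
  next
    show "range \<phi> \<inter> max_ideal \<subseteq> max_ideal_sq"
    proof
      fix x assume "x \<in> range \<phi> \<inter> max_ideal"
      then obtain c where "x = \<phi> c" "\<phi> c \<in> max_ideal" by auto
      then have "x = 0" using \<phi>_unit[of c] \<phi>_0 by auto
      then show "x \<in> max_ideal_sq" using ideal.subspace_0[OF subspace_max_ideal_sq] by simp
    qed
  qed simp
  have "\<exists>M\<in>Collect (coefficient_ring \<phi>). \<forall>X\<in>Collect (coefficient_ring \<phi>). M \<subseteq> X \<longrightarrow> X = M"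
  proof (rule subset_Zorn_nonempty)
    show "Collect (coefficient_ring \<phi>) \<noteq> {}" using base by auto
  next
    fix CC assume CC: "CC \<noteq> {}" "subset.chain (Collect (coefficient_ring \<phi>)) CC"
    then have g: "\<And>C. C \<in> CC \<Longrightarrow> coefficient_ring \<phi> C" by (auto simp: subset.chain_def)
    have "coefficient_ring \<phi> (\<Union>CC)"
      unfolding coefficient_ring_def
    proof (intro conjI ballI)
      show "range \<phi> \<subseteq> \<Union>CC" using CC(1) g by (fastforce simp: coefficient_ring_def)
      show "\<Union>CC \<inter> max_ideal \<subseteq> max_ideal_sq" using g by (fastforce simp: coefficient_ring_def)
    next
      fix a b assume "a \<in> \<Union>CC" "b \<in> \<Union>CC"
      then obtain A B where AB: "A \<in> CC" "a \<in> A" "B \<in> CC" "b \<in> B" by auto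
      have "A \<subseteq> B \<or> B \<subseteq> A" using CC(2) AB by (auto simp: subset.chain_def)
      then obtain D where D: "D \<in> CC" "a \<in> D" "b \<in> D" using AB by blast
      show "a + b \<in> \<Union>CC" "a * b \<in> \<Union>CC"
        using coefficient_ring_simps(3,4)[OF g[OF D(1)] D(2,3)] D(1) by blast+
    qed
    then show "\<Union>CC \<in> Collect (coefficient_ring \<phi>)" by simp
  qed
  then obtain C where C: "coefficient_ring \<phi> C"
    and max: "\<And>X. coefficient_ring \<phi> X \<Longrightarrow> C \<subseteq> X \<Longrightarrow> X = C" by blast
  note Cs = coefficient_ring_simps[OF C]
  \<comment> \<open>The fractions \<open>a * b'\<close> form a coefficient ring as well: if one is a
    non-unit, so is its numerator, which then lies in the square. Maximality of \<open>C\<close>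
    makes them elements of \<open>C\<close>.\<close>
  have inv: "c' \<in> C" if c: "c \<in> C" "c * c' = 1" for c c'
  proof -
    define D where "D = {a * b' | a b b'. a \<in> C \<and> b \<in> C \<and> b * b' = 1}"
    have CD: "C \<subseteq> D"
    proof
      fix a assume "a \<in> C"
      then have "a = a * 1 \<and> a \<in> C \<and> 1 \<in> C \<and> 1 * 1 = (1::'a)" using Cs(2) by simp
      then show "a \<in> D" unfolding D_def by blast
    qed
    have clos: "x + y \<in> D \<and> x * y \<in> D" if xy: "x \<in> D" "y \<in> D" for x y
    proof -
      obtain a b b' where x: "x = a * b'" "a \<in> C" "b \<in> C" "b * b' = 1" using xy(1) unfolding D_def by blast
      obtain e d d' where y: "y = e * d'" "e \<in> C" "d \<in> C" "d * d' = 1" using xy(2) unfolding D_def by blast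
      have u: "(b * d) * (b' * d') = 1" using x(4) y(4) by (metis mult.assoc mult.left_commute mult_1)
      have "(a * d + e * b) * (b' * d') = a * b' * (d * d') + e * d' * (b * b')" by (simp add: algebra_simps)
      then have s: "x + y = (a * d + e * b) * (b' * d')" using x y by simp
      have p: "x * y = (a * e) * (b' * d')" using x y by (simp add: ac_simps)
      have "a * d + e * b \<in> C" "a * e \<in> C" "b * d \<in> C" using x y Cs(3,4) by auto
      then show ?thesis unfolding D_def using s p u by blast
    qed
    have "D \<inter> max_ideal \<subseteq> max_ideal_sq"
    proof
      fix x assume "x \<in> D \<inter> max_ideal"
      then obtain a b b' where x: "x = a * b'" "a \<in> C" "b \<in> C" "b * b' = 1" "x \<in> max_ideal"
        unfolding D_def by blast
      have "a = x * b" using x by (metis mult.assoc mult.commute mult_1)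
      then have "a \<in> max_ideal" using x(5) max_simps(5) by simp
      then have "a \<in> max_ideal_sq" using Cs(8) x(2) by blast
      then show "x \<in> max_ideal_sq"
        using ideal.subspace_scale[OF subspace_max_ideal_sq, of a b'] x(1) by (simp add: mult.commute)
    qed
    then have "coefficient_ring \<phi> D"
      using clos CD Cs(9) unfolding coefficient_ring_def by blast
    then have "D = C" using max CD by blast
    moreover have "1 * c' \<in> D" unfolding D_def using c Cs(2) by blast
    ultimately show ?thesis by simp
  qed
  have adj: "s \<in> C" if "\<And>p. (\<And>i. coeff p i \<in> C) \<Longrightarrow> poly p s \<in> max_ideal \<Longrightarrow> poly p s \<in> max_ideal_sq" for s
    using adjoin_good[OF C that] max by blast
  have msq0: "0 \<in> max_ideal_sq" using ideal.subspace_0[OF subspace_max_ideal_sq] .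
  have small: "poly p s \<in> max_ideal_sq" if "\<And>i. coeff p i \<in> C" "\<And>i. coeff p i \<in> max_ideal" for p s
    unfolding poly_altdef
    by (rule ideal.subspace_sum[OF subspace_max_ideal_sq])
      (metis ideal.subspace_scale[OF subspace_max_ideal_sq] mult.commute Cs(8) that)
  have "\<exists>s\<in>C. r - s \<in> max_ideal" for r
  proof -
    \<comment> \<open>For \<open>p\<close> over \<open>C\<close>, the reduction of \<open>p\<close>
      to the residue field is a nonzero polynomial that vanishes at the class of \<open>r\<close>.
      The case split is thus between transcendental and algebraic classes.\<close>
    define P where "P p \<longleftrightarrow> (\<forall>i. coeff p i \<in> C) \<and> poly p r \<in> max_ideal \<and> (\<exists>i. coeff p i \<notin> max_ideal)" for p
    show ?thesis
    proof (cases "\<exists>p. P p")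
      case False
      have "r \<in> C"
      proof (rule adj)
        fix p assume p: "\<And>i. coeff p i \<in> C" "poly p r \<in> max_ideal"
        then have "\<And>i. coeff p i \<in> max_ideal" using False unfolding P_def by blast
        then show "poly p r \<in> max_ideal_sq" using small p(1) by blast
      qed
      moreover have "r - r \<in> max_ideal" using max_simps(1) by simp
      ultimately show ?thesis by blast
    next
      case True
      then obtain p where p: "P p" and least: "\<And>q. P q \<Longrightarrow> degree p \<le> degree q"
        using ex_has_least_nat[of P _ degree] by blast
      have pC: "\<And>i. coeff p i \<in> C" and pr: "poly p r \<in> max_ideal" using p by (auto simp: P_def)
      define d where "d = degree p"
      \<comment> \<open>Otherwise the leading term could be dropped, which leaves a polynomial of
        smaller degree with the same property.\<close>
      have lead: "coeff p d \<notin> max_ideal"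
      proof
        assume lm: "coeff p d \<in> max_ideal"
        define q where "q = p - monom (coeff p d) d"
        have "P q" unfolding P_def
        proof (intro conjI allI)
          show "coeff q i \<in> C" for i using pC Cs(1,6) by (simp add: q_def)
          show "poly q r \<in> max_ideal"
            using pr lm max_simps(4,5) by (simp add: q_def poly_monom)
          obtain i where i: "coeff p i \<notin> max_ideal" using p by (auto simp: P_def)
          then have "coeff q i = coeff p i" using lm by (auto simp: q_def)
          then show "\<exists>i. coeff q i \<notin> max_ideal" using i by metis
        qed
        then have "d \<le> degree q" and "q \<noteq> 0" using least[of q] max_simps(1) by (auto simp: d_def P_def)
        moreover have "degree q \<le> d"
          unfolding q_def by (rule degree_diff_le) (auto simp: d_def degree_monom_le)
        moreover have "coeff q d = 0" by (simp add: q_def)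
        ultimately show False using leading_coeff_0_iff[of q] by simp
      qed
      have dpos: "0 < d"
      proof (rule ccontr)
        assume "\<not> 0 < d"
        then have "poly p r = coeff p d" by (simp add: d_def poly_altdef)
        then show False using pr lead by simp
      qed
      define q where "q = (\<Sum>i<d. monom (of_nat (Suc i) * coeff p (Suc i)) i)"
      have cq: "coeff q k = (if k < d then of_nat (Suc k) * coeff p (Suc k) else 0)" for k
        by (simp add: q_def coeff_sum coeff_monom del: of_nat_Suc)
      \<comment> \<open>Separability: \<open>q\<close> is the derivative of \<open>p\<close>, with
        leading coefficient a unit and smaller degree, so by minimality it does not vanish at the
        class of \<open>r\<close>.\<close>
      have "poly q r \<notin> max_ideal"
      proof
        assume qr: "poly q r \<in> max_ideal"
        have "coeff q (d - 1) = of_nat d * coeff p d" using dpos by (simp add: cq del: of_nat_Suc)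
        then have "coeff q (d - 1) \<notin> max_ideal"
          using lead of_nat_unit[OF dpos] max_ideal_prime[OF loc] by metis
        moreover have "coeff q i \<in> C" for i
          unfolding cq using pC[of "Suc i"] Cs(1) Cs(4)[OF Cs(7)] by (simp del: of_nat_Suc)
        ultimately have "P q" unfolding P_def using qr by blast
        then have "d \<le> degree q" using least by (simp add: d_def)
        moreover have "degree q \<le> d - 1"
          by (rule degree_le) (use dpos in \<open>auto simp: cq\<close>)
        ultimately show False using dpos by simp
      qed
      then obtain v where v: "poly q r * v = 1" by (metis max_ideal_iff dvd_def)
      \<comment> \<open>The Newton step \<open>- p(r) / p'(r)\<close>. It cancels the constant and
        the linear term, so that \<open>p\<close> takes a value in the square at
        \<open>r + h\<close>, in the same residue class.\<close>
      define h where "h = - (poly p r * v)"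
      have hm: "h \<in> max_ideal" unfolding h_def
        using pr max_simps(5) max_ideal_diff[OF loc max_simps(1)] by fastforce
      define s where "s = r + h"
      obtain k where k: "poly p s = poly p r + h * poly q r + h * h * k"
        using poly_taylor1[of p d r h] by (auto simp: d_def s_def q_def)
      have "h * poly q r = - (poly p r * (poly q r * v))" by (simp add: h_def ac_simps)
      then have "h * poly q r = - (poly p r)" by (simp add: v)
      then have ps: "poly p s \<in> max_ideal_sq"
        using k max_ideal_sq_mult[OF hm hm] ideal.subspace_scale[OF subspace_max_ideal_sq, of "h * h" k]
        by (simp add: mult.commute)
      obtain l where l: "coeff p d * l = 1" using lead by (metis max_ideal_iff dvd_def)
      have lC: "l \<in> C" using inv[OF pC l] .
      have sr: "poly f s - poly f r \<in> max_ideal" for f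
      proof -
        obtain k where "poly f s = poly f r + h * poly (\<Sum>i<degree f. monom (of_nat (Suc i) * coeff f (Suc i)) i) r + h * h * k"
          using poly_taylor1[of f _ r h] s_def by blast
        then have "poly f s - poly f r = h * (poly (\<Sum>i<degree f. monom (of_nat (Suc i) * coeff f (Suc i)) i) r + h * k)"
          by (simp add: algebra_simps)
        then show ?thesis using max_simps(5)[OF hm] by metis
      qed
      \<comment> \<open>Division by \<open>p\<close>, whose leading coefficient is invertible in
        \<open>C\<close>, changes the value at \<open>s\<close> only by an element of the square. A
        remainder of degree below \<open>d\<close> has only non-unit coefficients, by minimality of
        \<open>p\<close>.\<close>
      have "poly f s \<in> max_ideal_sq" if "\<And>i. coeff f i \<in> C" "poly f s \<in> max_ideal" for f
        using that
      proof (induction "degree f" arbitrary: f rule: less_induct)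
        case less
        show ?case
        proof (cases "degree f < d")
          case True
          then have "\<not> P f" using least[of f] by (auto simp: d_def)
          moreover have "poly f r \<in> max_ideal"
            using max_simps(4)[OF less.prems(2) sr[of f]] by simp
          ultimately have "\<And>i. coeff f i \<in> max_ideal" using less.prems(1) by (auto simp: P_def)
          then show ?thesis using small less.prems(1) by blast
        next
          case False
          define e where "e = degree f"
          define g where "g = f - monom (coeff f e * l) (e - d) * p"
          have gC: "coeff g i \<in> C" for i
            using less.prems(1) pC lC Cs(1,4,6) by (auto simp: g_def coeff_monom_mult)
          have gs: "poly f s = poly g s + coeff f e * l * s ^ (e - d) * poly p s"
            by (simp add: g_def poly_monom)
          have psm: "coeff f e * l * s ^ (e - d) * poly p s \<in> max_ideal_sq"
            using ideal.subspace_scale[OF subspace_max_ideal_sq ps] .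
          have "poly p s \<in> max_ideal" using max_simps(3)[OF pr sr[of p]] by simp
          then have "poly g s \<in> max_ideal"
            using max_simps(4)[OF less.prems(2) max_simps(6)] gs by (metis add_diff_cancel_right')
          moreover have "degree g < degree f \<or> g = 0"
          proof -
            have "degree (monom (coeff f e * l) (e - d) * p) \<le> (e - d) + d"
              by (rule order.trans[OF degree_mult_le]) (use degree_monom_le in \<open>auto simp: d_def\<close>)
            then have "degree g \<le> e" unfolding g_def
              by (intro degree_diff_le) (use False in \<open>auto simp: e_def\<close>)
            moreover have "coeff g e = 0"
              using l False by (simp add: g_def coeff_monom_mult e_def mult.assoc mult.commute[of l])
            ultimately show ?thesis
              by (metis e_def leading_coeff_0_iff nat_less_le)
          qed
          ultimately have "poly g s \<in> max_ideal_sq"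
            using less.hyps[of g] gC msq0 by auto
          then show ?thesis using gs psm ideal.subspace_add[OF subspace_max_ideal_sq] by metis
        qed
      qed
      then have "s \<in> C" by (rule adj)
      moreover have "r - s \<in> max_ideal"
        using max_ideal_diff[OF loc max_simps(1) hm] by (simp add: s_def)
      ultimately show ?thesis by blast
    qed
  qed
  then show ?thesis using C by blast
qed

end

section \<open>Differentials and partial derivatives\<close>

text \<open>The linear form on the free module that extends an arbitrary function \<delta> on the
  symbols \<open>diff r\<close>.\<close>

definition pairing :: "('a::comm_ring_1 \<Rightarrow> 'a) \<Rightarrow> ('a \<Rightarrow>\<^sub>0 'a) \<Rightarrow> 'a" where
  "pairing \<delta> w = (\<Sum>r\<in>Poly_Mapping.keys w. Poly_Mapping.lookup w r * \<delta> r)"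

lemma pairing_superset:
  assumes "finite A" "Poly_Mapping.keys w \<subseteq> A"
  shows "pairing \<delta> w = (\<Sum>r\<in>A. Poly_Mapping.lookup w r * \<delta> r)"
  unfolding pairing_def
  by (rule sum.mono_neutral_left) (use assms in \<open>auto simp: in_keys_iff\<close>)

lemma pairing_add: "pairing \<delta> (v + w) = pairing \<delta> v + pairing \<delta> w"
proof -
  let ?A = "Poly_Mapping.keys v \<union> Poly_Mapping.keys w"
  have "pairing \<delta> u = (\<Sum>r\<in>?A. Poly_Mapping.lookup u r * \<delta> r)" if "u \<in> {v, w, v + w}" for u
    using that Poly_Mapping.keys_add[of v w] by (intro pairing_superset) auto
  then show ?thesis by (simp add: lookup_add distrib_right sum.distrib)
qed

lemma pairing_scale: "pairing \<delta> (free_scale c w) = c * pairing \<delta> w"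
proof -
  have "Poly_Mapping.keys (free_scale c w) \<subseteq> Poly_Mapping.keys w"
    by (auto simp: in_keys_iff lookup_free_scale)
  then have "pairing \<delta> (free_scale c w)
      = (\<Sum>r\<in>Poly_Mapping.keys w. Poly_Mapping.lookup (free_scale c w) r * \<delta> r)"
    by (intro pairing_superset) auto
  then show ?thesis by (simp add: pairing_def lookup_free_scale sum_distrib_left mult.assoc)
qed

lemma pairing_zero: "pairing \<delta> 0 = 0"
  by (simp add: pairing_def)

lemma pairing_diff_gen: "pairing \<delta> (diff r) = \<delta> r"
  by (simp add: pairing_def diff_def)

lemma pairing_minus: "pairing \<delta> (v - w) = pairing \<delta> v - pairing \<delta> w"
  using pairing_add[of \<delta> "v - w" w] by simp

lemma pairing_sum: "pairing \<delta> (\<Sum>i\<in>A. f i) = (\<Sum>i\<in>A. pairing \<delta> (f i))"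
  by (induction A rule: infinite_finite_induct) (simp_all add: pairing_zero pairing_add)

lemmas pairing_simps = pairing_add pairing_scale pairing_zero pairing_diff_gen pairing_minus pairing_sum

lemma pairing_subspace:
  assumes "ideal.subspace A"
  shows "free_mod.subspace {w. pairing \<delta> w \<in> A}"
  unfolding free_mod.subspace_def
  using ideal.subspace_0[OF assms] ideal.subspace_add[OF assms] ideal.subspace_scale[OF assms]
  by (simp add: pairing_simps)

text \<open>Stated modulo an ideal \<open>A\<close> so that it also covers maps that are derivations
  only modulo the square of the maximal ideal.\<close>

lemma pairing_kaehler_relations:
  assumes A: "ideal.subspace A"
    and "\<And>a b. \<delta> (a + b) - (\<delta> a + \<delta> b) \<in> A"
    and "\<And>a b. \<delta> (a * b) - (a * \<delta> b + b * \<delta> a) \<in> A"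
    and "\<And>c. \<delta> (\<phi> c) \<in> A"
    and w: "w \<in> kaehler_relations \<phi>"
  shows "pairing \<delta> w \<in> A"
proof -
  have "kaehler_relations \<phi> \<subseteq> {w. pairing \<delta> w \<in> A}"
    unfolding kaehler_relations_def
    by (rule free_mod.span_minimal[OF _ pairing_subspace[OF A]])
      (use assms in \<open>auto simp: pairing_simps\<close>)
  then show ?thesis using w by auto
qed

lemma pairing_derivation:
  assumes "derivation \<phi> D" "w \<in> kaehler_relations \<phi>"
  shows "pairing D w = 0"
proof -
  have "ideal.subspace {0::'b}" by (simp add: ideal.subspace_def)
  from pairing_kaehler_relations[OF this _ _ _ assms(2), of D] show ?thesis
    using assms(1) by (auto simp: derivation_def)
qed

section \<open>Bases of a quotient module, exchange, and linear algebra over a local ring\<close>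

definition basis_mod :: "('a::comm_ring_1 \<Rightarrow>\<^sub>0 'a) set \<Rightarrow> nat \<Rightarrow> (nat \<Rightarrow> ('a \<Rightarrow>\<^sub>0 'a)) \<Rightarrow> bool" where
  "basis_mod N n e \<longleftrightarrow>
     (\<forall>w. \<exists>c. w - (\<Sum>i<n. free_scale (c i) (e i)) \<in> N) \<and>
     (\<forall>c. (\<Sum>i<n. free_scale (c i) (e i)) \<in> N \<longrightarrow> (\<forall>i<n. c i = 0))"

lemma basis_mod_span: "basis_mod N n e \<Longrightarrow> \<exists>c. w - (\<Sum>i<n. free_scale (c i) (e i)) \<in> N"
  unfolding basis_mod_def by blast

lemma basis_mod_cong: "(\<And>i. i < n \<Longrightarrow> e i = e' i) \<Longrightarrow> basis_mod N n e \<longleftrightarrow> basis_mod N n e'"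
  by (simp add: basis_mod_def)

lemma basis_mod_unique:
  assumes N: "free_mod.subspace N" and e: "basis_mod N n e"
    and "w - (\<Sum>i<n. free_scale (a i) (e i)) \<in> N" "w - (\<Sum>i<n. free_scale (b i) (e i)) \<in> N"
    and "i < n"
  shows "a i = b i"
proof -
  have "(w - (\<Sum>i<n. free_scale (b i) (e i))) - (w - (\<Sum>i<n. free_scale (a i) (e i)))
      = (\<Sum>i<n. free_scale (a i - b i) (e i))"
    by (simp add: free_mod.scale_left_diff_distrib sum_subtractf)
  then have "(\<Sum>i<n. free_scale (a i - b i) (e i)) \<in> N"
    using free_mod.subspace_diff[OF N assms(4,3)] by simp
  then show ?thesis using e assms(5) by (auto simp: basis_mod_def)
qed

lemma basis_mod_swap:
  assumes e: "basis_mod N n e" and kq: "k < n" "q < n"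
  shows "basis_mod N n (e \<circ> Transposition.transpose k q)"
proof -
  let ?t = "Transposition.transpose k q"
  have t: "?t i < n" if "i < n" for i using that kq by (auto simp: Transposition.transpose_def)
  have eq: "(\<Sum>i<n. free_scale (c i) ((e \<circ> ?t) i)) = (\<Sum>i<n. free_scale (c (?t i)) (e i))" for c
    by (rule sum.reindex_bij_witness[where i = ?t and j = ?t]) (auto simp: t)
  have eq': "(\<Sum>i<n. free_scale (c (?t i)) ((e \<circ> ?t) i)) = (\<Sum>i<n. free_scale (c i) (e i))" for c
    by (subst eq) simp
  show ?thesis unfolding basis_mod_def
  proof (intro conjI allI impI)
    fix w
    obtain c where "w - (\<Sum>i<n. free_scale (c i) (e i)) \<in> N" using basis_mod_span[OF e] by blast
    then have "w - (\<Sum>i<n. free_scale ((c \<circ> ?t) i) ((e \<circ> ?t) i)) \<in> N" using eq'[of c] by simp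
    then show "\<exists>c. w - (\<Sum>i<n. free_scale (c i) ((e \<circ> ?t) i)) \<in> N" by blast
  next
    fix c i assume "(\<Sum>i<n. free_scale (c i) ((e \<circ> ?t) i)) \<in> N" "i < n"
    then have "\<forall>i<n. c (?t i) = 0"
      using e[unfolded basis_mod_def, THEN conjunct2, THEN spec, of "c \<circ> ?t"] unfolding eq by simp
    then show "c i = 0" using t[OF \<open>i < n\<close>] by (metis Transposition.transpose_involutory)
  qed
qed

text \<open>The unit coefficient \<open>c q\<close> with inverse \<open>u\<close> allows
  \<open>e q\<close> to be expressed by \<open>v\<close> and the other \<open>e i\<close>. In both
  halves \<open>b'\<close> holds the coordinates after this substitution, first from the old family
  to the new one and then back.\<close>

lemma basis_mod_replace:
  assumes N: "free_mod.subspace N" and e: "basis_mod N n e"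
    and v: "v - (\<Sum>i<n. free_scale (c i) (e i)) \<in> N" and q: "q < n" and u: "u * c q = 1"
  shows "basis_mod N n (e(q := v))"
proof -
  have split: "(\<Sum>i<n. f i) = f q + (\<Sum>i\<in>{..<n}-{q}. f i)" for f :: "nat \<Rightarrow> 'a \<Rightarrow>\<^sub>0 'a"
    using q by (simp add: sum.remove)
  show ?thesis unfolding basis_mod_def
  proof (intro conjI allI impI)
    fix w
    obtain b where b: "w - (\<Sum>i<n. free_scale (b i) (e i)) \<in> N" using basis_mod_span[OF e] by blast
    define b' where "b' i = (if i = q then b q * u else b i - b q * u * c i)" for i
    have "(\<Sum>i<n. free_scale (b' i) ((e(q := v)) i))
        = free_scale (b q * u) v + (\<Sum>i\<in>{..<n}-{q}. free_scale (b i - b q * u * c i) (e i))"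
      unfolding split by (simp add: b'_def)
    also have "(\<Sum>i\<in>{..<n}-{q}. free_scale (b i - b q * u * c i) (e i))
        = (\<Sum>i<n. free_scale (b i - b q * u * c i) (e i))"
      unfolding split using u by (simp add: mult.assoc)
    also have "\<dots> = (\<Sum>i<n. free_scale (b i) (e i)) - free_scale (b q * u) (\<Sum>i<n. free_scale (c i) (e i))"
      by (simp add: free_mod.scale_left_diff_distrib sum_subtractf free_mod.scale_sum_right)
    finally have "w - (\<Sum>i<n. free_scale (b' i) ((e(q := v)) i))
        = (w - (\<Sum>i<n. free_scale (b i) (e i))) - free_scale (b q * u) (v - (\<Sum>i<n. free_scale (c i) (e i)))"
      by (simp add: free_mod.scale_right_diff_distrib)
    then have "w - (\<Sum>i<n. free_scale (b' i) ((e(q := v)) i)) \<in> N"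
      by (simp only: free_mod.subspace_diff[OF N b free_mod.subspace_scale[OF N v]])
    then show "\<exists>c. w - (\<Sum>i<n. free_scale (c i) ((e(q := v)) i)) \<in> N" by blast
  next
    fix b i assume b: "(\<Sum>i<n. free_scale (b i) ((e(q := v)) i)) \<in> N" and i: "i < n"
    define b' where "b' i = (if i = q then 0 else b i) + b q * c i" for i
    have "(\<Sum>i<n. free_scale (b' i) (e i))
        = (\<Sum>i<n. free_scale (if i = q then 0 else b i) (e i)) + free_scale (b q) (\<Sum>i<n. free_scale (c i) (e i))"
      by (simp add: b'_def free_mod.scale_left_distrib sum.distrib free_mod.scale_sum_right)
    also have "(\<Sum>i<n. free_scale (if i = q then 0 else b i) (e i))
        = (\<Sum>i<n. free_scale (b i) ((e(q := v)) i)) - free_scale (b q) v"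
      unfolding split by simp
    finally have "(\<Sum>i<n. free_scale (b' i) (e i))
        = (\<Sum>i<n. free_scale (b i) ((e(q := v)) i)) - free_scale (b q) (v - (\<Sum>i<n. free_scale (c i) (e i)))"
      by (simp add: free_mod.scale_right_diff_distrib)
    then have "(\<Sum>i<n. free_scale (b' i) (e i)) \<in> N"
      by (simp only: free_mod.subspace_diff[OF N b free_mod.subspace_scale[OF N v]])
    then have b0: "\<And>i. i < n \<Longrightarrow> b' i = 0" using e by (auto simp: basis_mod_def)
    have "b q = b q * (u * c q)" using u by simp
    also have "\<dots> = b' q * u" by (simp add: b'_def ac_simps)
    finally have "b q = 0" using b0[OF q] by simp
    then show "b i = 0" using b0[OF i] by (auto simp: b'_def split: if_splits)
  qed
qed

text \<open>Steinitz exchange: if all coefficients of \<open>u k\<close> at positions from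
  \<open>k\<close> on were non-units, then \<open>u k\<close> would depend on the earlier
  \<open>u i\<close> in the fibre. So one of them is a unit; \<open>u k\<close> takes that place and
  is moved to position \<open>k\<close>.\<close>

lemma basis_mod_exchange:
  assumes loc: "ideal.subspace (max_ideal :: 'a::comm_ring_1 set)"
    and N: "free_mod.subspace (N :: ('a \<Rightarrow>\<^sub>0 'a) set)" and e: "basis_mod N n e"
    and ind: "\<And>c. (\<Sum>i<k. free_scale (c i) (u i))
        \<in> free_mod.span (N \<union> {free_scale c w | c w. c \<in> max_ideal}) \<Longrightarrow> \<forall>i<k. c i \<in> max_ideal"
  shows "k \<le> n \<and> (\<exists>e'. basis_mod N n e' \<and> (\<forall>i<k. e' i = u i))"
  using ind
proof (induction k)
  case 0
  then show ?case using e by auto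
next
  case (Suc k)
  let ?F = "free_mod.span (N \<union> {free_scale c w | c w. c \<in> max_ideal})"
  note ms = max_ideal_simps[OF loc]
  have "\<forall>i<k. c i \<in> max_ideal" if "(\<Sum>i<k. free_scale (c i) (u i)) \<in> ?F" for c
  proof -
    have "(\<Sum>i<Suc k. free_scale ((c(k := 0)) i) (u i)) \<in> ?F" using that by simp
    from Suc.prems[OF this] show ?thesis by (metis fun_upd_apply less_Suc_eq nat_neq_iff)
  qed
  from Suc.IH[OF this] obtain e' where kn: "k \<le> n" and e': "basis_mod N n e'" "\<And>i. i < k \<Longrightarrow> e' i = u i"
    by auto
  obtain c where c: "u k - (\<Sum>i<n. free_scale (c i) (e' i)) \<in> N" using basis_mod_span[OF e'(1)] by blast
  have "\<exists>q. k \<le> q \<and> q < n \<and> c q \<notin> max_ideal"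
  proof (rule ccontr)
    assume "\<not> ?thesis"
    then have cq: "\<And>q. k \<le> q \<Longrightarrow> q < n \<Longrightarrow> c q \<in> max_ideal" by auto
    have "(\<Sum>i<n. free_scale (c i) (e' i)) = (\<Sum>i<k. free_scale (c i) (u i)) + (\<Sum>i=k..<n. free_scale (c i) (e' i))"
    proof -
      have "{..<n} = {..<k} \<union> {k..<n}" using kn by auto
      then have "(\<Sum>i<n. free_scale (c i) (e' i)) = (\<Sum>i<k. free_scale (c i) (e' i)) + (\<Sum>i=k..<n. free_scale (c i) (e' i))"
        by (simp add: sum.union_disjoint ivl_disj_int)
      then show ?thesis using e'(2) by simp
    qed
    then have "(\<Sum>i<Suc k. free_scale (if i = k then 1 else - c i) (u i))
      = (u k - (\<Sum>i<n. free_scale (c i) (e' i))) + (\<Sum>i=k..<n. free_scale (c i) (e' i))"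
      by (simp add: sum_negf)
    moreover have 1: "u k - (\<Sum>i<n. free_scale (c i) (e' i)) \<in> ?F"
      by (rule free_mod.span_base) (use c in auto)
    moreover have 2: "(\<Sum>i=k..<n. free_scale (c i) (e' i)) \<in> ?F"
      by (rule free_mod.span_sum, rule free_mod.span_base) (use cq in auto)
    ultimately have "(\<Sum>i<Suc k. free_scale (if i = k then 1 else - c i) (u i)) \<in> ?F"
      by (simp only: free_mod.span_add[OF 1 2])
    from Suc.prems[OF this] show False using ms(2) by auto
  qed
  then obtain q where q: "k \<le> q" "q < n" "c q \<notin> max_ideal" by blast
  obtain v where v: "v * c q = 1" using q(3) by (metis max_ideal_iff dvd_def mult.commute)
  have "basis_mod N n (e'(q := u k))" by (rule basis_mod_replace[OF N e'(1) c q(2) v])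
  then have "basis_mod N n (e'(q := u k) \<circ> Transposition.transpose k q)"
    by (rule basis_mod_swap) (use q in auto)
  moreover have "(e'(q := u k) \<circ> Transposition.transpose k q) i = u i" if "i < Suc k" for i
    using that q e'(2) by (auto simp: Transposition.transpose_def less_Suc_eq)
  ultimately show ?case using q by fastforce
qed

text \<open>Gaussian elimination modulo the maximal ideal: with more rows than columns there is a
  nontrivial relation. A column of non-units imposes no condition; otherwise a unit entry serves as
  pivot.\<close>

lemma local_kernel:
  assumes loc: "ideal.subspace (max_ideal :: 'a::comm_ring_1 set)"
    and "finite R" "s < card R"
  shows "\<exists>c. (\<exists>i\<in>R. c i \<notin> max_ideal) \<and> (\<forall>q<s. (\<Sum>i\<in>R. c i * A i q) \<in> (max_ideal :: 'a set))"
  using assms(2,3)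
proof (induction s arbitrary: R A)
  case 0
  then obtain i where "i \<in> R" by (metis card_gt_0_iff ex_in_conv)
  then show ?case using max_ideal_1[OF loc] by (intro exI[of _ "\<lambda>_. 1"]) auto
next
  case (Suc s)
  note ms = max_ideal_simps[OF loc]
  show ?case
  proof (cases "\<forall>i\<in>R. A i s \<in> max_ideal")
    case True
    obtain c where c: "\<exists>i\<in>R. c i \<notin> max_ideal" "\<forall>q<s. (\<Sum>i\<in>R. c i * A i q) \<in> max_ideal"
      using Suc.IH[OF Suc.prems(1) Suc_lessD[OF Suc.prems(2)], of A] by blast
    have "(\<Sum>i\<in>R. c i * A i s) \<in> max_ideal"
      by (rule ideal.subspace_sum[OF loc]) (use True ms in auto)
    then show ?thesis using c less_Suc_eq by auto
  next
    case False
    then obtain p v where p: "p \<in> R" and v: "v * A p s = 1"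
      by (metis max_ideal_iff dvd_def mult.commute)
    define B where "B i q = A i q - A i s * v * A p q" for i q
    have "s < card (R - {p})" using Suc.prems p by (simp add: card_Diff_singleton)
    then obtain c where c: "\<exists>i\<in>R-{p}. c i \<notin> max_ideal" "\<And>q. q < s \<Longrightarrow> (\<Sum>i\<in>R-{p}. c i * B i q) \<in> max_ideal"
      using Suc.IH[of "R - {p}" B] Suc.prems by auto
    \<comment> \<open>The coefficient of the pivot row is chosen so that the combination of the rows
      of \<open>A\<close> equals that of the reduced rows \<open>B\<close>, whose column
      \<open>s\<close> is zero.\<close>
    define c' where "c' = c(p := - (\<Sum>i\<in>R-{p}. c i * A i s * v))"
    have eq: "(\<Sum>i\<in>R. c' i * A i q) = (\<Sum>i\<in>R-{p}. c i * B i q)" for q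
    proof -
      have "(\<Sum>i\<in>R. c' i * A i q) = c' p * A p q + (\<Sum>i\<in>R-{p}. c' i * A i q)"
        using Suc.prems p by (simp add: sum.remove)
      also have "\<dots> = (\<Sum>i\<in>R-{p}. c i * A i q) - (\<Sum>i\<in>R-{p}. c i * A i s * v) * A p q"
        by (simp add: c'_def)
      also have "\<dots> = (\<Sum>i\<in>R-{p}. c i * B i q)"
        by (simp add: B_def sum_distrib_right right_diff_distrib sum_subtractf mult.assoc)
      finally show ?thesis .
    qed
    have "B i s = 0" for i using v by (simp add: B_def mult.assoc)
    then have "(\<Sum>i\<in>R. c' i * A i q) \<in> max_ideal" if "q < Suc s" for q
      using that c(2)[of q] ms(1) unfolding eq by (auto simp: less_Suc_eq)
    moreover have "\<exists>i\<in>R. c' i \<notin> max_ideal" using c(1) by (auto simp: c'_def)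
    ultimately show ?thesis by blast
  qed
qed

section \<open>Derivations and the partial derivatives of a system of parameters\<close>

lemma derivation_simps:
  assumes "derivation \<phi> D"
  shows "D (a + b) = D a + D b" "D (a * b) = a * D b + b * D a" "D (\<phi> c) = 0" "D 0 = 0"
    "D (sum f A) = (\<Sum>i\<in>A. D (f i))"
proof -
  show 1: "D (a + b) = D a + D b" for a b using assms by (simp add: derivation_def)
  show "D (a * b) = a * D b + b * D a" "D (\<phi> c) = 0" using assms by (simp_all add: derivation_def)
  show 0: "D 0 = 0" using 1[of 0 0] by simp
  show "D (sum f A) = (\<Sum>i\<in>A. D (f i))"
    by (induction A rule: infinite_finite_induct) (simp_all add: 0 1)
qed

lemma derivation_one: "derivation \<phi> D \<Longrightarrow> D 1 = 0"
  using derivation_simps(2)[of \<phi> D 1 1] by simp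

locale smooth_local_algebra = local_algebra \<phi> for \<phi> :: "'k::field_char_0 \<Rightarrow> 'a::comm_ring_1" +
  fixes n :: nat
  assumes noeth: "noetherian TYPE('a)"
    and kaehler_free: "kaehler_free_of_rank \<phi> n"
begin

lemma subspace_kaehler: "free_mod.subspace (kaehler_relations \<phi>)"
  by (simp add: kaehler_relations_def)

text \<open>All \<open>n\<close> members of a basis are exchanged for the \<open>n\<close>
  differentials, so independence in the fibre at the point becomes a basis over the ring
  itself.\<close>

lemma system_basis:
  assumes X: "system_of_parameters \<phi> n X"
  shows "basis_mod (kaehler_relations \<phi>) n (\<lambda>i. diff (X ! i))"
proof -
  obtain e where e: "basis_mod (kaehler_relations \<phi>) n e"
    using kaehler_free by (auto simp: kaehler_free_of_rank_def basis_mod_def)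
  have "\<exists>e'. basis_mod (kaehler_relations \<phi>) n e' \<and> (\<forall>i<n. e' i = diff (X ! i))"
    using X basis_mod_exchange[OF loc subspace_kaehler e, where k = n and u = "\<lambda>i. diff (X ! i)"]
    unfolding system_of_parameters_def parameters_def kaehler_fibre_relations_def by blast
  then show ?thesis using basis_mod_cong[where n = n and e' = "\<lambda>i. diff (X ! i)"] by blast
qed

lemma system_length: "system_of_parameters \<phi> n X \<Longrightarrow> length X = n"
  and system_max: "system_of_parameters \<phi> n X \<Longrightarrow> i < n \<Longrightarrow> X ! i \<in> max_ideal"
  by (auto simp: system_of_parameters_def parameters_def)

lemma derivation_expand:
  assumes D: "derivation \<phi> D" and c: "diff f - (\<Sum>i<n. free_scale (c i) (diff (X ! i))) \<in> kaehler_relations \<phi>"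
  shows "D f = (\<Sum>i<n. c i * D (X ! i))"
  using pairing_derivation[OF D c] by (simp add: pairing_simps)

lemma derivation_eqI:
  assumes X: "system_of_parameters \<phi> n X" and D: "derivation \<phi> D" "derivation \<phi> D'"
    and eq: "\<And>i. i < n \<Longrightarrow> D (X ! i) = D' (X ! i)"
  shows "D = D'"
proof
  fix f
  obtain c where c: "diff f - (\<Sum>i<n. free_scale (c i) (diff (X ! i))) \<in> kaehler_relations \<phi>"
    using basis_mod_span[OF system_basis[OF X]] by blast
  show "D f = D' f" using derivation_expand[OF D(1) c] derivation_expand[OF D(2) c] eq by simp
qed

text \<open>The partial derivative of \<open>r\<close> is the \<open>i\<close>-th coordinate of
  \<open>diff r\<close> in the basis of the differentials of the parameters. Uniqueness of
  coordinates gives additivity and the Leibniz rule.\<close>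

lemma exists_partial:
  assumes X: "system_of_parameters \<phi> n X" and i: "i < n"
  shows "\<exists>D. derivation \<phi> D \<and> (\<forall>j<length X. D (X ! j) = (if j = i then 1 else 0))"
proof -
  let ?N = "kaehler_relations \<phi>"
  note B = system_basis[OF X] and N = subspace_kaehler
  have "\<forall>r. \<exists>c. diff r - (\<Sum>i<n. free_scale (c i) (diff (X ! i))) \<in> ?N"
    using B unfolding basis_mod_def by blast
  from choice[OF this] have "\<exists>c. \<forall>r. diff r - (\<Sum>i<n. free_scale (c r i) (diff (X ! i))) \<in> ?N" .
  then obtain c where c: "\<And>r. diff r - (\<Sum>i<n. free_scale (c r i) (diff (X ! i))) \<in> ?N" by blast
  have uniq: "c r i = b i" if "diff r - (\<Sum>i<n. free_scale (b i) (diff (X ! i))) \<in> ?N" for r b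
    using basis_mod_unique[OF N B c that i] .
  have "derivation \<phi> (\<lambda>r. c r i)"
    unfolding derivation_def
  proof (intro conjI allI)
    fix a b
    have "diff (a + b) - (diff a + diff b) \<in> ?N"
      unfolding kaehler_relations_def by (rule free_mod.span_base) auto
    from free_mod.subspace_add[OF N this free_mod.subspace_add[OF N c[of a] c[of b]]]
    have "diff (a + b) - (\<Sum>i<n. free_scale (c a i + c b i) (diff (X ! i))) \<in> ?N"
      by (simp add: free_mod.scale_left_distrib sum.distrib algebra_simps)
    then show "c (a + b) i = c a i + c b i" by (rule uniq)
    have "diff (a * b) - (free_scale a (diff b) + free_scale b (diff a)) \<in> ?N"
      unfolding kaehler_relations_def by (rule free_mod.span_base) auto
    from free_mod.subspace_add[OF N this free_mod.subspace_add[OF N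
        free_mod.subspace_scale[OF N c[of a], of b] free_mod.subspace_scale[OF N c[of b], of a]]]
    have "diff (a * b) - (\<Sum>i<n. free_scale (a * c b i + b * c a i) (diff (X ! i))) \<in> ?N"
      by (simp add: free_mod.scale_left_distrib sum.distrib free_mod.scale_right_diff_distrib
          free_mod.scale_sum_right algebra_simps)
    then show "c (a * b) i = a * c b i + b * c a i" by (rule uniq)
  next
    fix k
    have "diff (\<phi> k) \<in> ?N"
      unfolding kaehler_relations_def by (rule free_mod.span_base) auto
    then show "c (\<phi> k) i = 0" by (intro uniq) simp
  qed
  moreover have "c (X ! j) i = (if j = i then 1 else 0)" if "j < length X" for j
  proof -
    have "(\<Sum>l<n. free_scale (if j = l then 1 else 0) (diff (X ! l))) = (\<Sum>l<n. if j = l then diff (X ! l) else 0)"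
      by (rule sum.cong) auto
    also have "\<dots> = diff (X ! j)" using that system_length[OF X] by simp
    finally show ?thesis
      using free_mod.subspace_0[OF N] by (intro uniq) simp
  qed
  ultimately show ?thesis by blast
qed

lemma partial_deriv_props:
  assumes X: "system_of_parameters \<phi> n X" and i: "i < n"
  shows partial_derivation: "derivation \<phi> (partial_deriv \<phi> X i)"
    and partial_param: "j < n \<Longrightarrow> partial_deriv \<phi> X i (X ! j) = (if j = i then 1 else 0)"
proof -
  let ?P = "\<lambda>D. derivation \<phi> D \<and> (\<forall>j<length X. D (X ! j) = (if j = i then 1 else 0))"
  have "\<exists>!D. ?P D"
  proof (rule ex_ex1I[OF exists_partial[OF assms]])
    fix D D' assume D: "?P D" "?P D'"
    then show "D = D'" using system_length[OF X] by (intro derivation_eqI[OF X]) auto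
  qed
  then have "?P (partial_deriv \<phi> X i)" unfolding partial_deriv_def by (rule theI')
  then show "derivation \<phi> (partial_deriv \<phi> X i)"
    and "j < n \<Longrightarrow> partial_deriv \<phi> X i (X ! j) = (if j = i then 1 else 0)"
    using system_length[OF X] by auto
qed

lemma partial_expand:
  assumes X: "system_of_parameters \<phi> n X"
  shows "diff f - (\<Sum>i<n. free_scale (partial_deriv \<phi> X i f) (diff (X ! i))) \<in> kaehler_relations \<phi>"
proof -
  obtain c where c: "diff f - (\<Sum>i<n. free_scale (c i) (diff (X ! i))) \<in> kaehler_relations \<phi>"
    using basis_mod_span[OF system_basis[OF X]] by blast
  have "partial_deriv \<phi> X i f = c i" if i: "i < n" for i
  proof -
    have "partial_deriv \<phi> X i f = (\<Sum>l<n. c l * partial_deriv \<phi> X i (X ! l))"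
      by (rule derivation_expand[OF partial_derivation[OF X i] c])
    also have "\<dots> = (\<Sum>l<n. if l = i then c l else 0)"
      by (rule sum.cong) (use partial_param[OF X i] in auto)
    finally show ?thesis using i by simp
  qed
  then show ?thesis using c by simp
qed

lemma chain_rule:
  assumes "system_of_parameters \<phi> n X" "derivation \<phi> D"
  shows "D f = (\<Sum>i<n. partial_deriv \<phi> X i f * D (X ! i))"
  by (rule derivation_expand[OF assms(2) partial_expand[OF assms(1)]])

text \<open>The commutator of two partial derivatives is again a derivation and kills every
  parameter.\<close>

lemma partial_commute:
  assumes X: "system_of_parameters \<phi> n X" and i: "i < n" and j: "j < n"
  shows "partial_deriv \<phi> X i (partial_deriv \<phi> X j f) = partial_deriv \<phi> X j (partial_deriv \<phi> X i f)"
proof -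
  let ?D = "partial_deriv \<phi> X i" and ?E = "partial_deriv \<phi> X j"
  note D = partial_derivation[OF X i] and E = partial_derivation[OF X j]
  note ds = derivation_simps[OF D] derivation_simps[OF E]
  have "derivation \<phi> (\<lambda>f. ?D (?E f) - ?E (?D f))"
    unfolding derivation_def by (simp add: ds algebra_simps)
  moreover have "derivation \<phi> (\<lambda>f. 0)" by (simp add: derivation_def)
  ultimately have "(\<lambda>f. ?D (?E f) - ?E (?D f)) = (\<lambda>f. 0)"
    by (rule derivation_eqI[OF X]) (simp add: partial_param[OF X] i j ds derivation_one[OF D] derivation_one[OF E])
  from fun_cong[OF this, of f] show ?thesis by simp
qed

text \<open>Reduces independence of differentials in the fibre to a condition on the Jacobian matrix
  with respect to one fixed system.\<close>

lemma fibre_relations_iff: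
  assumes X: "system_of_parameters \<phi> n X"
  shows "w \<in> kaehler_fibre_relations \<phi> \<longleftrightarrow> (\<forall>i<n. pairing (partial_deriv \<phi> X i) w \<in> max_ideal)"
proof (intro iffI allI impI)
  fix i assume w: "w \<in> kaehler_fibre_relations \<phi>" and i: "i < n"
  have "kaehler_fibre_relations \<phi> \<subseteq> {w. pairing (partial_deriv \<phi> X i) w \<in> max_ideal}"
    unfolding kaehler_fibre_relations_def
    by (rule free_mod.span_minimal[OF _ pairing_subspace[OF loc]])
      (use pairing_derivation[OF partial_derivation[OF X i]] max_simps in \<open>auto simp: pairing_simps\<close>)
  then show "pairing (partial_deriv \<phi> X i) w \<in> max_ideal" using w by auto
next
  assume w: "\<forall>i<n. pairing (partial_deriv \<phi> X i) w \<in> max_ideal"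
  obtain c where c: "w - (\<Sum>i<n. free_scale (c i) (diff (X ! i))) \<in> kaehler_relations \<phi>"
    using basis_mod_span[OF system_basis[OF X]] by blast
  have "c i \<in> max_ideal" if i: "i < n" for i
  proof -
    have "pairing (partial_deriv \<phi> X i) w = (\<Sum>l<n. c l * partial_deriv \<phi> X i (X ! l))"
      using pairing_derivation[OF partial_derivation[OF X i] c] by (simp add: pairing_simps)
    also have "\<dots> = (\<Sum>l<n. if l = i then c l else 0)"
      by (rule sum.cong) (use partial_param[OF X i] in auto)
    finally show ?thesis using i w[rule_format, OF i] by simp
  qed
  then have 1: "(\<Sum>i<n. free_scale (c i) (diff (X ! i))) \<in> kaehler_fibre_relations \<phi>"
    unfolding kaehler_fibre_relations_def
    by (intro free_mod.span_sum free_mod.span_base) auto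
  have 2: "w - (\<Sum>i<n. free_scale (c i) (diff (X ! i))) \<in> kaehler_fibre_relations \<phi>"
    unfolding kaehler_fibre_relations_def by (rule free_mod.span_base) (use c in auto)
  have "free_mod.subspace (kaehler_fibre_relations \<phi>)" by (simp add: kaehler_fibre_relations_def)
  from free_mod.subspace_add[OF this 2 1] show "w \<in> kaehler_fibre_relations \<phi>" by simp
qed

lemma parameters_iff:
  assumes X: "system_of_parameters \<phi> n X"
  shows "parameters \<phi> ys \<longleftrightarrow> set ys \<subseteq> max_ideal \<and>
     (\<forall>c. (\<forall>i<n. (\<Sum>l<length ys. c l * partial_deriv \<phi> X i (ys ! l)) \<in> max_ideal)
        \<longrightarrow> (\<forall>l<length ys. c l \<in> max_ideal))"
  unfolding parameters_def fibre_relations_iff[OF X] by (simp add: pairing_simps)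

text \<open>If \<sigma> chooses representatives in a coefficient ring, then
  \<open>\<delta> r = r - \<sigma> r\<close> is a derivation modulo the square of the maximal ideal,
  and on the maximal ideal it is the identity modulo the square. Applied to the expansion of
  \<open>diff f\<close> it yields the linear Taylor expansion of \<open>f\<close> in the parameters
  modulo the square; Nakayama's lemma finishes.\<close>

lemma max_ideal_eq_span:
  assumes X: "system_of_parameters \<phi> n X"
  shows "max_ideal = ideal.span (set X)"
proof
  show "ideal.span (set X) \<subseteq> max_ideal"
    using X by (intro ideal.span_minimal[OF _ loc]) (auto simp: system_of_parameters_def parameters_def)
  obtain C where C: "coefficient_ring \<phi> C" and "\<forall>r. \<exists>s\<in>C. r - s \<in> max_ideal"
    using exists_coefficient_ring by blast
  then obtain \<sigma> where \<sigma>: "\<And>r. \<sigma> r \<in> C" "\<And>r. r - \<sigma> r \<in> max_ideal" by metis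
  note Cs = coefficient_ring_simps[OF C] and S = subspace_max_ideal_sq[where 'a='a]
  define \<delta> where "\<delta> r = r - \<sigma> r" for r
  have dm: "\<delta> r \<in> max_ideal" for r using \<sigma>(2) by (simp add: \<delta>_def)
  \<comment> \<open>The map \<sigma> need not be additive, but its defect lies both in the
    coefficient ring and in the maximal ideal, hence in the square.\<close>
  have S1: "\<delta> (a + b) - (\<delta> a + \<delta> b) \<in> max_ideal_sq" for a b
  proof (rule Cs(8))
    have eq: "\<delta> (a + b) - (\<delta> a + \<delta> b) = \<sigma> a + \<sigma> b - \<sigma> (a + b)" by (simp add: \<delta>_def)
    show "\<delta> (a + b) - (\<delta> a + \<delta> b) \<in> C" unfolding eq using \<sigma>(1) Cs(3,6) by blast
    show "\<delta> (a + b) - (\<delta> a + \<delta> b) \<in> max_ideal" by (intro max_simps(3,4) dm)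
  qed
  \<comment> \<open>The defect of the Leibniz rule is the defect of multiplicativity of \<sigma>
    minus \<open>\<delta> a * \<delta> b\<close>, and both lie in the square.\<close>
  have S2: "\<delta> (a * b) - (a * \<delta> b + b * \<delta> a) \<in> max_ideal_sq" for a b
  proof -
    have eq: "\<sigma> a * \<sigma> b - \<sigma> (a * b) = \<delta> (a * b) - (a * \<delta> b + b * \<delta> a) + \<delta> a * \<delta> b"
      by (simp add: \<delta>_def algebra_simps)
    have "\<sigma> a * \<sigma> b - \<sigma> (a * b) \<in> max_ideal"
      unfolding eq
      by (intro max_simps(3)[OF max_simps(4)[OF dm max_simps(3)[OF max_simps(6) max_simps(6)]] max_simps(5)] dm)
    moreover have "\<sigma> a * \<sigma> b - \<sigma> (a * b) \<in> C" using \<sigma>(1) Cs(4,6) by blast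
    ultimately have "\<sigma> a * \<sigma> b - \<sigma> (a * b) \<in> max_ideal_sq" by (intro Cs(8))
    then show ?thesis using ideal.subspace_diff[OF S _ max_ideal_sq_mult[OF dm dm]] eq
      by (metis add_diff_cancel_right')
  qed
  have S3: "\<delta> (\<phi> c) \<in> max_ideal_sq" for c
    using Cs(8)[OF Cs(6)[OF Cs(9) \<sigma>(1)] \<sigma>(2)] by (simp add: \<delta>_def)
  have S4: "f - \<delta> f \<in> max_ideal_sq" if "f \<in> max_ideal" for f
  proof -
    have "f - \<delta> f = \<sigma> f" by (simp add: \<delta>_def)
    then show ?thesis using Cs(8) \<sigma>(1) max_simps(4)[OF that dm] by metis
  qed
  have sq: "max_ideal_sq \<subseteq> ideal.span (ideal.span (set X) \<union> {x * b | x b. x \<in> max_ideal \<and> b \<in> max_ideal})"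
    unfolding max_ideal_sq_def by (rule ideal.span_mono) auto
  have "max_ideal \<subseteq> ideal.span (ideal.span (set X) \<union> {x * b | x b. x \<in> max_ideal \<and> b \<in> max_ideal})" (is "_ \<subseteq> ?T")
  proof
    fix f :: 'a assume f: "f \<in> max_ideal"
    let ?c = "\<lambda>i. partial_deriv \<phi> X i f"
    have 2: "\<delta> f - (\<Sum>i<n. ?c i * \<delta> (X ! i)) \<in> max_ideal_sq"
      using pairing_kaehler_relations[OF S S1 S2 S3 partial_expand[OF X, of f]] by (simp add: pairing_simps)
    have 3: "(\<Sum>i<n. ?c i * (X ! i - \<delta> (X ! i))) \<in> max_ideal_sq"
      using S4 system_max[OF X] by (intro ideal.subspace_sum[OF S] ideal.subspace_scale[OF S]) auto
    have "(f - \<delta> f) + ((\<delta> f - (\<Sum>i<n. ?c i * \<delta> (X ! i))) - (\<Sum>i<n. ?c i * (X ! i - \<delta> (X ! i)))) \<in> max_ideal_sq"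
      by (rule ideal.subspace_add[OF S S4[OF f] ideal.subspace_diff[OF S 2 3]])
    then have "f - (\<Sum>i<n. ?c i * X ! i) \<in> max_ideal_sq"
      by (simp add: right_diff_distrib sum_subtractf)
    then have 1: "f - (\<Sum>i<n. ?c i * X ! i) \<in> ?T" using sq by auto
    have "X ! i \<in> ?T" if "i < n" for i
      using that system_length[OF X] by (intro ideal.span_base UnI1) (simp add: ideal.span_base)
    then have "(\<Sum>i<n. ?c i * X ! i) \<in> ?T" by (intro ideal.span_sum ideal.span_scale) auto
    from ideal.span_add[OF 1 this] show "f \<in> ?T" by simp
  qed
  from nakayama[OF loc noeth ideal.subspace_span loc this]
  show "max_ideal \<subseteq> ideal.span (set X)" .
qed

end

section \<open>Weighted ideals\<close>

definition monomial_at :: "'a::comm_ring_1 list \<Rightarrow> (nat \<Rightarrow> nat) \<Rightarrow> 'a" where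
  "monomial_at xs \<gamma> = (\<Prod>l<length xs. (xs ! l) ^ \<gamma> l)"

definition multi_weight :: "nat \<Rightarrow> (nat \<Rightarrow> rat) \<Rightarrow> (nat \<Rightarrow> nat) \<Rightarrow> rat" where
  "multi_weight n w \<gamma> = (\<Sum>l<n. of_nat (\<gamma> l) * w l)"

text \<open>One family serves several purposes: the filtrations of centres (weight zero for the
  remaining variables), the powers of the maximal ideal (all weights one, for a full system) and the
  order in a single variable.\<close>

definition weighted_ideal :: "'a::comm_ring_1 list \<Rightarrow> (nat \<Rightarrow> rat) \<Rightarrow> rat \<Rightarrow> 'a set" where
  "weighted_ideal xs w t = ideal.span {monomial_at xs \<gamma> | \<gamma>. t \<le> multi_weight (length xs) w \<gamma>}"

lemma subspace_weighted_ideal [simp]: "ideal.subspace (weighted_ideal xs w t)"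
  by (simp add: weighted_ideal_def)

lemma ideal_mult1: "ideal.subspace A \<Longrightarrow> a \<in> A \<Longrightarrow> a * c \<in> A"
  using ideal.subspace_scale[of A a c] by (simp add: mult.commute)

lemma monomial_at_in: "t \<le> multi_weight (length xs) w \<gamma> \<Longrightarrow> monomial_at xs \<gamma> \<in> weighted_ideal xs w t"
  unfolding weighted_ideal_def by (rule ideal.span_base) auto

lemma weighted_ideal_nonpos: "t \<le> 0 \<Longrightarrow> a \<in> weighted_ideal xs w t"
  using ideal.subspace_scale[OF subspace_weighted_ideal monomial_at_in[of t xs w "\<lambda>_. 0"], of a]
  by (simp add: monomial_at_def multi_weight_def)

lemma weighted_ideal_antimono: "s \<le> t \<Longrightarrow> weighted_ideal xs w t \<subseteq> weighted_ideal xs w s"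
  unfolding weighted_ideal_def by (rule ideal.span_mono) auto

lemma weighted_ideal_mono_weight:
  assumes "\<And>l. l < length xs \<Longrightarrow> w l \<le> w' l"
  shows "weighted_ideal xs w t \<subseteq> weighted_ideal xs w' t"
proof -
  have "multi_weight (length xs) w \<gamma> \<le> multi_weight (length xs) w' \<gamma>" for \<gamma>
    unfolding multi_weight_def by (rule sum_mono) (simp add: assms mult_left_mono)
  then show ?thesis unfolding weighted_ideal_def by (intro ideal.span_mono) (auto intro: order.trans)
qed

lemma span_mult_in:
  fixes A B S :: "'a::comm_ring_1 set"
  assumes S: "ideal.subspace S" and AB: "\<And>a b. a \<in> A \<Longrightarrow> b \<in> B \<Longrightarrow> a * b \<in> S"
    and x: "x \<in> ideal.span A" and y: "y \<in> ideal.span B"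
  shows "x * y \<in> S"
proof -
  have 1: "a * y \<in> S" if "a \<in> A" for a
  proof -
    have "ideal.span B \<subseteq> {b. a * b \<in> S}"
      by (rule ideal.span_minimal)
        (use AB that S in \<open>auto simp: ideal.subspace_def distrib_left mult.left_commute[of a]\<close>)
    then show ?thesis using y by auto
  qed
  have "ideal.span A \<subseteq> {a. a * y \<in> S}"
    by (rule ideal.span_minimal) (use 1 S in \<open>auto simp: ideal.subspace_def distrib_right mult.assoc\<close>)
  then show ?thesis using x by auto
qed

lemma weighted_ideal_mult:
  assumes "a \<in> weighted_ideal xs w s" "b \<in> weighted_ideal xs w t"
  shows "a * b \<in> weighted_ideal xs w (s + t)"
proof (rule span_mult_in[OF subspace_weighted_ideal])
  show "a \<in> ideal.span {monomial_at xs \<gamma> | \<gamma>. s \<le> multi_weight (length xs) w \<gamma>}"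
    "b \<in> ideal.span {monomial_at xs \<gamma> | \<gamma>. t \<le> multi_weight (length xs) w \<gamma>}"
    using assms by (simp_all add: weighted_ideal_def)
  fix a b assume "a \<in> {monomial_at xs \<gamma> | \<gamma>. s \<le> multi_weight (length xs) w \<gamma>}"
    "b \<in> {monomial_at xs \<gamma> | \<gamma>. t \<le> multi_weight (length xs) w \<gamma>}"
  then obtain \<gamma> \<delta> where g: "a = monomial_at xs \<gamma>" "b = monomial_at xs \<delta>"
    "s \<le> multi_weight (length xs) w \<gamma>" "t \<le> multi_weight (length xs) w \<delta>" by auto
  have "a * b = monomial_at xs (\<lambda>l. \<gamma> l + \<delta> l)"
    by (simp add: g monomial_at_def power_add prod.distrib)
  moreover have "multi_weight (length xs) w (\<lambda>l. \<gamma> l + \<delta> l)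
      = multi_weight (length xs) w \<gamma> + multi_weight (length xs) w \<delta>"
    by (simp add: multi_weight_def distrib_right sum.distrib)
  ultimately show "a * b \<in> weighted_ideal xs w (s + t)"
    using g monomial_at_in[of "s + t" xs w] by simp
qed

lemma weighted_ideal_nth: "l < length xs \<Longrightarrow> xs ! l \<in> weighted_ideal xs w (w l)"
proof -
  assume l: "l < length xs"
  let ?e = "\<lambda>i. if i = l then 1 else 0 :: nat"
  have "monomial_at xs ?e = (\<Prod>i<length xs. if i = l then xs ! i else 1)"
    unfolding monomial_at_def by (rule prod.cong) auto
  then have "monomial_at xs ?e = xs ! l" using l by simp
  moreover have "multi_weight (length xs) w ?e = (\<Sum>i<length xs. if i = l then w i else 0)"
    unfolding multi_weight_def by (rule sum.cong) auto
  ultimately show ?thesis using l monomial_at_in[of "w l" xs w ?e] by simp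
qed

lemma weighted_ideal_power: "a \<in> weighted_ideal xs w s \<Longrightarrow> a ^ k \<in> weighted_ideal xs w (of_nat k * s)"
proof (induction k)
  case (Suc k)
  have "a * a ^ k \<in> weighted_ideal xs w (s + of_nat k * s)"
    by (rule weighted_ideal_mult) (use Suc in auto)
  then show ?case by (simp add: distrib_right)
qed (simp add: weighted_ideal_nonpos)

lemma weighted_ideal_prod:
  "finite L \<Longrightarrow> (\<And>l. l \<in> L \<Longrightarrow> f l \<in> weighted_ideal xs w (s l)) \<Longrightarrow>
    (\<Prod>l\<in>L. f l) \<in> weighted_ideal xs w (\<Sum>l\<in>L. s l)"
  by (induction L rule: finite_induct) (auto simp: weighted_ideal_nonpos intro: weighted_ideal_mult)

text \<open>The pieces multiply, so only the parameters themselves need to be placed. Used in both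
  directions, this shows that two systems define the same filtration.\<close>

lemma weighted_ideal_leI:
  assumes "length ys = length zs" "\<And>l. l < length ys \<Longrightarrow> ys ! l \<in> weighted_ideal zs w (w l)"
  shows "weighted_ideal ys w t \<subseteq> weighted_ideal zs w t"
  unfolding weighted_ideal_def[of ys]
proof (rule ideal.span_minimal[OF _ subspace_weighted_ideal], safe)
  fix \<gamma> assume t: "t \<le> multi_weight (length ys) w \<gamma>"
  have "monomial_at ys \<gamma> \<in> weighted_ideal zs w (multi_weight (length ys) w \<gamma>)"
    unfolding monomial_at_def multi_weight_def
    by (rule weighted_ideal_prod) (use assms in \<open>auto intro: weighted_ideal_power\<close>)
  then show "monomial_at ys \<gamma> \<in> weighted_ideal zs w t"
    using weighted_ideal_antimono[OF t] by blast
qed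

lemma monomial_at_split:
  assumes "i < length xs"
  shows "monomial_at xs \<gamma> = (xs ! i) ^ \<gamma> i * (\<Prod>l\<in>{..<length xs}-{i}. (xs ! l) ^ \<gamma> l)"
  unfolding monomial_at_def using assms by (simp add: prod.remove)

text \<open>A monomial of nonzero weight contains some variable. This turns estimates of weights
  into vanishing at the point.\<close>

lemma weighted_ideal_pos_max:
  assumes loc: "ideal.subspace (max_ideal :: 'a::comm_ring_1 set)"
    and X: "set (xs :: 'a list) \<subseteq> max_ideal" and t: "0 < t"
  shows "weighted_ideal xs w t \<subseteq> max_ideal"
  unfolding weighted_ideal_def
proof (rule ideal.span_minimal[OF _ loc], safe)
  fix \<gamma> assume "t \<le> multi_weight (length xs) w \<gamma>"
  then have "multi_weight (length xs) w \<gamma> \<noteq> 0" using t by simp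
  then have "\<exists>i\<in>{..<length xs}. of_nat (\<gamma> i) * w i \<noteq> 0"
    unfolding multi_weight_def by (rule contrapos_np) (simp add: sum.neutral)
  then obtain i where i: "i < length xs" "of_nat (\<gamma> i) * w i \<noteq> 0" by auto
  then obtain k where "\<gamma> i = Suc k" by (cases "\<gamma> i") auto
  then have "monomial_at xs \<gamma> = xs ! i * ((xs ! i) ^ k * (\<Prod>l\<in>{..<length xs}-{i}. (xs ! l) ^ \<gamma> l))"
    using monomial_at_split[OF i(1)] by (simp add: mult.assoc)
  moreover have "xs ! i \<in> max_ideal" using X i by auto
  ultimately show "monomial_at xs \<gamma> \<in> max_ideal" using max_ideal_mult1[OF loc] by metis
qed

lemma derivation_power: "derivation \<phi> D \<Longrightarrow> D (x ^ k) = of_nat k * x ^ (k - 1) * D x"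
proof (induction k)
  case (Suc k)
  then show ?case
    by (cases k) (simp_all add: derivation_simps(2)[OF Suc.prems] algebra_simps)
qed (simp add: derivation_one)

lemma derivation_prod_zero:
  assumes D: "derivation \<phi> D" shows "(\<And>l. l \<in> L \<Longrightarrow> D (f l) = 0) \<Longrightarrow> D (prod f L) = 0"
  by (induction L rule: infinite_finite_induct)
    (simp_all add: derivation_one[OF D] derivation_simps(2)[OF D])

lemma derivation_weighted_ideal:
  assumes D: "derivation \<phi> D" and c: "0 \<le> c"
    and Dx: "\<And>l. l < length xs \<Longrightarrow> D (xs ! l) \<in> weighted_ideal xs w (w l - c)"
    and a: "a \<in> weighted_ideal xs w t"
  shows "D a \<in> weighted_ideal xs w (t - c)"
proof -
  \<comment> \<open>The Leibniz rule needs the weights of an element and of its derivative at the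
    same time, so both are carried through products and powers.\<close>
  define P where "P s a \<longleftrightarrow> a \<in> weighted_ideal xs w s \<and> D a \<in> weighted_ideal xs w (s - c)" for s a
  have P_mult: "P (s + t) (a * b)" if "P s a" "P t b" for s t a b
  proof -
    have "a * D b \<in> weighted_ideal xs w (s + (t - c))" "b * D a \<in> weighted_ideal xs w (t + (s - c))"
      using that by (auto simp: P_def intro: weighted_ideal_mult)
    then have "D (a * b) \<in> weighted_ideal xs w (s + t - c)"
      unfolding derivation_simps(2)[OF D]
      by (intro ideal.subspace_add[OF subspace_weighted_ideal]) (simp_all add: algebra_simps)
    then show ?thesis using that by (auto simp: P_def intro: weighted_ideal_mult)
  qed
  have P_one: "P 0 1"
    by (simp add: P_def weighted_ideal_nonpos derivation_one[OF D] ideal.subspace_0)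
  have P_pow: "P (of_nat k * s) (b ^ k)" if "P s b" for k s b
  proof (induction k)
    case (Suc k)
    then show ?case using P_mult[OF that Suc] by (simp add: distrib_right)
  qed (simp add: P_one)
  have P_prod: "P (\<Sum>l\<in>L. s l) (\<Prod>l\<in>L. b l)" if "finite L" "\<And>l. l \<in> L \<Longrightarrow> P (s l) (b l)" for L :: "nat set" and s b
    using that by (induction L rule: finite_induct) (auto simp: P_one intro: P_mult)
  have Px: "P (w l) (xs ! l)" if "l < length xs" for l
    using that Dx weighted_ideal_nth by (auto simp: P_def)
  have mono: "D (monomial_at xs \<gamma>) \<in> weighted_ideal xs w (multi_weight (length xs) w \<gamma> - c)" for \<gamma>
    using P_prod[of "{..<length xs}" "\<lambda>l. of_nat (\<gamma> l) * w l" "\<lambda>l. (xs ! l) ^ \<gamma> l"] P_pow Px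
    by (auto simp: P_def monomial_at_def multi_weight_def)
  have le: "weighted_ideal xs w t \<subseteq> weighted_ideal xs w (t - c)"
    using c by (intro weighted_ideal_antimono) simp
  have "a \<in> weighted_ideal xs w t \<inter> {a. D a \<in> weighted_ideal xs w (t - c)}"
  proof (rule set_mp[OF _ a])
    have gen: "monomial_at xs \<gamma> \<in> weighted_ideal xs w t \<inter> {a. D a \<in> weighted_ideal xs w (t - c)}"
      if "t \<le> multi_weight (length xs) w \<gamma>" for \<gamma>
      using monomial_at_in[OF that] mono[of \<gamma>]
        weighted_ideal_antimono[of "t - c" "multi_weight (length xs) w \<gamma> - c" xs w] that by auto
    have "ideal.subspace (weighted_ideal xs w t \<inter> {a. D a \<in> weighted_ideal xs w (t - c)})"
    proof (rule ideal.subspaceI)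
      fix k x assume x: "x \<in> weighted_ideal xs w t \<inter> {a. D a \<in> weighted_ideal xs w (t - c)}"
      \<comment> \<open>The coefficient \<open>k\<close> is arbitrary, and nothing is known about
        \<open>D k\<close>; but \<open>x\<close> has weight \<open>t\<close>, which is at least
        \<open>t - c\<close> because \<open>c\<close> is not negative.\<close>
      then have "k * D x \<in> weighted_ideal xs w (t - c)" "x * D k \<in> weighted_ideal xs w (t - c)"
        using ideal.subspace_scale[OF subspace_weighted_ideal] ideal_mult1[OF subspace_weighted_ideal] le
        by blast+
      then show "k * x \<in> weighted_ideal xs w t \<inter> {a. D a \<in> weighted_ideal xs w (t - c)}"
        using x by (simp add: derivation_simps(2)[OF D] ideal.subspace_add[OF subspace_weighted_ideal]
            ideal.subspace_scale[OF subspace_weighted_ideal])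
    qed (simp_all add: derivation_simps[OF D] ideal.subspace_add[OF subspace_weighted_ideal]
        ideal.subspace_0[OF subspace_weighted_ideal])
    then show "weighted_ideal xs w t \<subseteq> weighted_ideal xs w t \<inter> {a. D a \<in> weighted_ideal xs w (t - c)}"
      unfolding weighted_ideal_def[of xs w t]
      by (intro ideal.span_minimal) (use gen in \<open>auto simp: weighted_ideal_def[of xs w t]\<close>)
  qed
  then show ?thesis by simp
qed

section \<open>Iterated derivatives and the weight they consume\<close>

definition apply_ops :: "(nat \<Rightarrow> 'a \<Rightarrow> 'a) \<Rightarrow> (nat \<Rightarrow> nat) \<Rightarrow> nat list \<Rightarrow> 'a \<Rightarrow> 'a" where
  "apply_ops D \<beta> is = foldr (\<lambda>i g. (D i ^^ \<beta> i) \<circ> g) is id"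

lemma apply_ops_simps [simp]:
  "apply_ops D \<beta> [] a = a"
  "apply_ops D \<beta> (i # is) a = (D i ^^ \<beta> i) (apply_ops D \<beta> is a)"
  by (simp_all add: apply_ops_def)

lemma multi_deriv_eq: "multi_deriv \<phi> xs \<beta> f = apply_ops (partial_deriv \<phi> xs) \<beta> [0..<length xs] f"
  by (simp add: multi_deriv_def apply_ops_def)

lemma apply_ops_drop:
  fixes W :: "rat \<Rightarrow> 'a set"
  assumes "\<And>i t a. i \<in> set is \<Longrightarrow> a \<in> W t \<Longrightarrow> D i a \<in> W (t - c i)" and "a \<in> W t"
  shows "apply_ops D \<beta> is a \<in> W (t - (\<Sum>i\<leftarrow>is. of_nat (\<beta> i) * c i))"
  using assms
proof (induction "is")
  case (Cons i "is")
  have pow: "b \<in> W s \<Longrightarrow> (D i ^^ k) b \<in> W (s - of_nat k * c i)" for b s k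
  proof (induction k)
    case (Suc k)
    then show ?case using Cons.prems(1)[of i "(D i ^^ k) b" "s - of_nat k * c i"]
      by (simp add: algebra_simps)
  qed simp
  have "apply_ops D \<beta> is a \<in> W (t - (\<Sum>i\<leftarrow>is. of_nat (\<beta> i) * c i))"
    by (rule Cons.IH) (use Cons.prems in auto)
  from pow[OF this, of "\<beta> i"] show ?case by (simp add: algebra_simps)
qed simp

lemma funpow_commute: "(\<And>a. f (g a) = g (f a)) \<Longrightarrow> f ((g ^^ k) a) = (g ^^ k) (f a)"
  by (induction k) simp_all

lemma apply_ops_commute:
  assumes "\<And>i a. i \<in> set is \<Longrightarrow> E (D i a) = D i (E a)"
  shows "E (apply_ops D \<beta> is a) = apply_ops D \<beta> is (E a)"
  using assms
proof (induction "is")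
  case (Cons i "is")
  then show ?case using funpow_commute[of E "D i"] by simp
qed simp

lemma apply_ops_Suc:
  assumes "distinct is" "l \<in> set is" "\<And>i a. i \<in> set is \<Longrightarrow> D l (D i a) = D i (D l a)"
  shows "apply_ops D (\<beta>(l := Suc (\<beta> l))) is a
       = D l (apply_ops D \<beta> is a)"
  using assms
proof (induction "is")
  case (Cons i "is")
  show ?case
  proof (cases "l = i")
    case True
    then have "l \<notin> set is" using Cons.prems(1) by simp
    then have "apply_ops D (\<beta>(l := Suc (\<beta> l))) is a
        = apply_ops D \<beta> is a"
      by (induction "is") auto
    then show ?thesis using True by (simp add: fun_upd_same del: fun_upd_apply)
  next
    case False
    then show ?thesis using Cons funpow_commute[of "D l" "D i"] by simp
  qed
qed simp

text \<open>Coefficients are indexed by the elements of \<open>S\<close> and not by their images,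
  since distinct multi-indices are kept apart even if their monomials coincide in the ring.\<close>

lemma span_image_explicit:
  fixes f :: "'b \<Rightarrow> 'a::comm_ring_1"
  assumes "h \<in> ideal.span (f ` S)"
  obtains \<Gamma> c where "finite \<Gamma>" "\<Gamma> \<subseteq> S" "h = (\<Sum>\<gamma>\<in>\<Gamma>. c \<gamma> * f \<gamma>)"
proof -
  have "\<exists>\<Gamma> c. finite \<Gamma> \<and> \<Gamma> \<subseteq> S \<and> h = (\<Sum>\<gamma>\<in>\<Gamma>. c \<gamma> * f \<gamma>)"
    using assms
  proof (induction rule: ideal.span_induct_alt)
    case base
    show ?case by (intro exI[of _ "{}"]) simp
  next
    case (step k x y)
    then obtain \<gamma>0 \<Gamma> c where g: "\<gamma>0 \<in> S" "x = f \<gamma>0" "finite \<Gamma>" "\<Gamma> \<subseteq> S" "y = (\<Sum>\<gamma>\<in>\<Gamma>. c \<gamma> * f \<gamma>)" by auto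
    define c' where "c' \<gamma> = (if \<gamma> \<in> \<Gamma> then c \<gamma> else 0) + (if \<gamma> = \<gamma>0 then k else 0)" for \<gamma>
    have "(\<Sum>\<gamma>\<in>insert \<gamma>0 \<Gamma>. c' \<gamma> * f \<gamma>)
        = (\<Sum>\<gamma>\<in>insert \<gamma>0 \<Gamma>. (if \<gamma> \<in> \<Gamma> then c \<gamma> * f \<gamma> else 0)) + (\<Sum>\<gamma>\<in>insert \<gamma>0 \<Gamma>. if \<gamma> = \<gamma>0 then k * f \<gamma> else 0)"
      unfolding sum.distrib[symmetric] by (rule sum.cong) (auto simp: c'_def distrib_right)
    also have "(\<Sum>\<gamma>\<in>insert \<gamma>0 \<Gamma>. (if \<gamma> \<in> \<Gamma> then c \<gamma> * f \<gamma> else 0)) = y"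
      unfolding g(5) by (rule sum.mono_neutral_cong_right) (use g in auto)
    also have "(\<Sum>\<gamma>\<in>insert \<gamma>0 \<Gamma>. if \<gamma> = \<gamma>0 then k * f \<gamma> else 0) = k * x" using g by simp
    finally have "k * x + y = (\<Sum>\<gamma>\<in>insert \<gamma>0 \<Gamma>. c' \<gamma> * f \<gamma>)" by simp
    then show ?case using g by (intro exI[of _ "insert \<gamma>0 \<Gamma>"] exI[of _ c']) auto
  qed
  then show ?thesis using that by blast
qed

context smooth_local_algebra
begin

lemma multi_deriv_add:
  assumes X: "system_of_parameters \<phi> n X"
  shows "multi_deriv \<phi> X \<beta> (f + g) = multi_deriv \<phi> X \<beta> f + multi_deriv \<phi> X \<beta> g"
proof -
  let ?D = "partial_deriv \<phi> X"
  have pow: "(?D i ^^ k) (f + g) = (?D i ^^ k) f + (?D i ^^ k) g" if "i < n" for i k f g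
    by (induction k) (simp_all add: derivation_simps(1)[OF partial_derivation[OF X that]])
  have "apply_ops ?D \<beta> is (f + g)
      = apply_ops ?D \<beta> is f + apply_ops ?D \<beta> is g"
    if "set is \<subseteq> {..<n}" for "is"
    using that by (induction "is") (simp_all add: pow)
  from this[of "[0..<length X]"] show ?thesis 
    using system_length[OF X] by (simp add: multi_deriv_eq lessThan_atLeast0)
qed

lemma multi_deriv_zero: "system_of_parameters \<phi> n X \<Longrightarrow> multi_deriv \<phi> X \<beta> 0 = 0"
  using multi_deriv_add[of X \<beta> 0 0] by simp

lemma multi_deriv_sum:
  assumes X: "system_of_parameters \<phi> n X"
  shows "multi_deriv \<phi> X \<beta> (\<Sum>i\<in>A. f i) = (\<Sum>i\<in>A. multi_deriv \<phi> X \<beta> (f i))"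
  by (induction A rule: infinite_finite_induct) (simp_all add: multi_deriv_zero[OF X] multi_deriv_add[OF X])

lemma multi_deriv_Suc:
  assumes X: "system_of_parameters \<phi> n X" and l: "l < n"
  shows "multi_deriv \<phi> X (\<beta>(l := Suc (\<beta> l))) f = partial_deriv \<phi> X l (multi_deriv \<phi> X \<beta> f)"
  unfolding multi_deriv_eq
  by (rule apply_ops_Suc) (use l system_length[OF X] partial_commute[OF X] in auto)

lemma multi_deriv_Suc':
  assumes X: "system_of_parameters \<phi> n X" and l: "l < n"
  shows "multi_deriv \<phi> X (\<beta>(l := Suc (\<beta> l))) f = multi_deriv \<phi> X \<beta> (partial_deriv \<phi> X l f)"
  unfolding multi_deriv_Suc[OF assms] unfolding multi_deriv_eq
  by (rule apply_ops_commute) (use l system_length[OF X] partial_commute[OF X] in auto)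

lemma multi_deriv_id: "(\<And>i. i < length X \<Longrightarrow> \<beta> i = 0) \<Longrightarrow> multi_deriv \<phi> X \<beta> f = f"
proof -
  assume b: "\<And>i. i < length X \<Longrightarrow> \<beta> i = 0"
  have "apply_ops (partial_deriv \<phi> X) \<beta> is f = f" if "set is \<subseteq> {..<length X}" for "is"
    using that by (induction "is") (simp_all add: b)
  from this[of "[0..<length X]"] show ?thesis by (simp add: multi_deriv_eq lessThan_atLeast0)
qed

text \<open>The family \<open>W\<close> need not come from \<open>X\<close>: it will also be the
  filtration of another system, on which the derivatives along \<open>X\<close> act.\<close>

lemma multi_deriv_drop:
  fixes W :: "rat \<Rightarrow> 'a set"
  assumes X: "system_of_parameters \<phi> n X"
    and "\<And>i t a. i < n \<Longrightarrow> a \<in> W t \<Longrightarrow> partial_deriv \<phi> X i a \<in> W (t - c i)" and "a \<in> W t"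
  shows "multi_deriv \<phi> X \<beta> a \<in> W (t - multi_weight n c \<beta>)"
proof -
  have "apply_ops (partial_deriv \<phi> X) \<beta> [0..<n] a
      \<in> W (t - (\<Sum>i\<leftarrow>[0..<n]. of_nat (\<beta> i) * c i))"
    by (rule apply_ops_drop) (use assms in auto)
  then show ?thesis
    by (simp add: multi_deriv_eq multi_weight_def system_length[OF X] sum_list_distinct_conv_sum_set
        lessThan_atLeast0)
qed

lemma partial_weighted_ideal:
  assumes X: "system_of_parameters \<phi> n X" and w: "\<And>l. l < n \<Longrightarrow> 0 \<le> w l" and i: "i < n"
    and a: "a \<in> weighted_ideal X w t"
  shows "partial_deriv \<phi> X i a \<in> weighted_ideal X w (t - w i)"
proof (rule derivation_weighted_ideal[OF partial_derivation[OF X i] w[OF i] _ a])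
  fix l assume "l < length X"
  then show "partial_deriv \<phi> X i (X ! l) \<in> weighted_ideal X w (w l - w i)"
    using partial_param[OF X i, of l] system_length[OF X]
    by (auto simp: weighted_ideal_nonpos ideal.subspace_0)
qed

lemma system_set: "system_of_parameters \<phi> n X \<Longrightarrow> set X \<subseteq> max_ideal"
  by (simp add: system_of_parameters_def parameters_def)

text \<open>Only the order in the \<open>i\<close>-th variable is counted. The \<open>i\<close>-th
  partial derivative lowers it by at most one and the others do not lower it, so a positive order
  survives for any coefficient \<open>c\<close>.\<close>

lemma multi_deriv_monomial_max:
  assumes X: "system_of_parameters \<phi> n X" and i: "i < n" "\<beta> i < \<gamma> i"
  shows "multi_deriv \<phi> X \<beta> (c * monomial_at X \<gamma>) \<in> max_ideal"
proof -
  let ?w = "\<lambda>l. if l = i then 1 else 0 :: rat"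
  have eq: "multi_weight n ?w \<delta> = of_nat (\<delta> i)" for \<delta>
  proof -
    have "multi_weight n ?w \<delta> = (\<Sum>l<n. if l = i then of_nat (\<delta> l) else 0)"
      unfolding multi_weight_def by (rule sum.cong) auto
    then show ?thesis using i by simp
  qed
  have "c * monomial_at X \<gamma> \<in> weighted_ideal X ?w (of_nat (\<gamma> i))"
    by (rule ideal.subspace_scale[OF subspace_weighted_ideal monomial_at_in]) (simp add: eq system_length[OF X])
  then have "multi_deriv \<phi> X \<beta> (c * monomial_at X \<gamma>) \<in> weighted_ideal X ?w (of_nat (\<gamma> i) - multi_weight n ?w \<beta>)"
    by (rule multi_deriv_drop[OF X, where c = ?w, rotated]) (intro partial_weighted_ideal[OF X]; simp)
  moreover have "0 < (of_nat (\<gamma> i) - multi_weight n ?w \<beta> :: rat)" using i by (simp add: eq)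
  ultimately show ?thesis using weighted_ideal_pos_max[OF loc system_set[OF X]] by blast
qed

text \<open>Modulo the maximal ideal the derivative is \<open>c\<close> times the product of the
  factorials of the entries of \<gamma>. The induction removes one derivative at a time; the term in
  which it falls on \<open>c\<close> is negligible by
  \<open>multi_deriv_monomial_max\<close>.\<close>

lemma multi_deriv_monomial_self:
  assumes X: "system_of_parameters \<phi> n X"
    and "multi_deriv \<phi> X \<gamma> (c * monomial_at X \<gamma>) \<in> max_ideal"
  shows "c \<in> max_ideal"
  using assms(2)
proof (induction "\<Sum>l<n. \<gamma> l" arbitrary: \<gamma> c)
  case 0
  then have z: "\<And>l. l < length X \<Longrightarrow> \<gamma> l = 0" by (simp add: system_length[OF X])
  then have "multi_deriv \<phi> X \<gamma> (c * monomial_at X \<gamma>) = c"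
    using multi_deriv_id[of X \<gamma>, OF z] by (simp add: monomial_at_def)
  then show ?case using 0 by simp
next
  case (Suc m)
  have "\<not> (\<forall>l<n. \<gamma> l = 0)"
  proof
    assume "\<forall>l<n. \<gamma> l = 0"
    then have "(\<Sum>l<n. \<gamma> l) = 0" by simp
    then show False using Suc.hyps(2) by linarith
  qed
  then obtain i where i: "i < n" "\<gamma> i \<noteq> 0" by auto
  define \<gamma>' where "\<gamma>' = \<gamma>(i := \<gamma> i - 1)"
  have g: "\<gamma> = \<gamma>'(i := Suc (\<gamma>' i))" using i by (simp add: \<gamma>'_def)
  have "(\<Sum>l<n. \<gamma> l) = \<gamma> i + (\<Sum>l\<in>{..<n}-{i}. \<gamma> l)" "(\<Sum>l<n. \<gamma>' l) = \<gamma>' i + (\<Sum>l\<in>{..<n}-{i}. \<gamma>' l)"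
    using i by (simp_all add: sum.remove)
  moreover have "(\<Sum>l\<in>{..<n}-{i}. \<gamma>' l) = (\<Sum>l\<in>{..<n}-{i}. \<gamma> l)" by (rule sum.cong) (auto simp: \<gamma>'_def)
  ultimately have m: "m = (\<Sum>l<n. \<gamma>' l)" using Suc.hyps(2) i by (simp add: \<gamma>'_def)
  let ?D = "partial_deriv \<phi> X i"
  note D = partial_derivation[OF X i(1)]
  let ?r = "\<Prod>l\<in>{..<length X}-{i}. (X ! l) ^ \<gamma> l"
  have r': "(\<Prod>l\<in>{..<length X}-{i}. (X ! l) ^ \<gamma>' l) = ?r" by (rule prod.cong) (auto simp: \<gamma>'_def)
  have il: "i < length X" using i system_length[OF X] by simp
  have "?D ?r = 0"
    by (rule derivation_prod_zero[OF D])
      (use partial_param[OF X i(1)] system_length[OF X] in \<open>auto simp: derivation_power[OF D]\<close>)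
  then have "?D (monomial_at X \<gamma>) = of_nat (\<gamma> i) * monomial_at X \<gamma>'"
    unfolding monomial_at_split[OF il] r'
    using partial_param[OF X i(1) i(1)]
    by (simp add: derivation_simps(2)[OF D] derivation_power[OF D] \<gamma>'_def ac_simps)
  then have "?D (c * monomial_at X \<gamma>) = (of_nat (\<gamma> i) * c) * monomial_at X \<gamma>' + ?D c * monomial_at X \<gamma>"
    by (simp add: derivation_simps(2)[OF D] ac_simps)
  then have "multi_deriv \<phi> X \<gamma> (c * monomial_at X \<gamma>)
      = multi_deriv \<phi> X \<gamma>' ((of_nat (\<gamma> i) * c) * monomial_at X \<gamma>') + multi_deriv \<phi> X \<gamma>' (?D c * monomial_at X \<gamma>)"
    using multi_deriv_Suc'[OF X i(1), of \<gamma>' "c * monomial_at X \<gamma>"] g multi_deriv_add[OF X] by metis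
  moreover have "multi_deriv \<phi> X \<gamma>' (?D c * monomial_at X \<gamma>) \<in> max_ideal"
    by (rule multi_deriv_monomial_max[OF X i(1)]) (use i in \<open>simp add: \<gamma>'_def\<close>)
  ultimately have "multi_deriv \<phi> X \<gamma>' ((of_nat (\<gamma> i) * c) * monomial_at X \<gamma>') \<in> max_ideal"
    using Suc.prems max_simps(4) by (metis add_diff_cancel_right')
  then have "of_nat (\<gamma> i) * c \<in> max_ideal" by (rule Suc.hyps(1)[OF m])
  then show ?case using of_nat_unit[of "\<gamma> i"] i max_ideal_prime[OF loc] by blast
qed

lemma weighted_ideal_image:
  "weighted_ideal xs w t = ideal.span (monomial_at xs `
     {\<gamma>. (\<forall>i\<ge>length xs. \<gamma> i = 0) \<and> t \<le> multi_weight (length xs) w \<gamma>})"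
proof -
  have "monomial_at xs \<gamma> \<in> monomial_at xs ` {\<gamma>. (\<forall>i\<ge>length xs. \<gamma> i = 0) \<and> t \<le> multi_weight (length xs) w \<gamma>}"
    if "t \<le> multi_weight (length xs) w \<gamma>" for \<gamma>
  proof (rule image_eqI)
    let ?g = "\<lambda>i. if i < length xs then \<gamma> i else 0"
    show "monomial_at xs \<gamma> = monomial_at xs ?g" by (simp add: monomial_at_def)
    show "?g \<in> {\<gamma>. (\<forall>i\<ge>length xs. \<gamma> i = 0) \<and> t \<le> multi_weight (length xs) w \<gamma>}"
      using that by (simp add: multi_weight_def)
  qed
  then show ?thesis unfolding weighted_ideal_def by (intro arg_cong[where f = ideal.span]) auto
qed

text \<open>
  The coefficients of the initial form of degree \<open>N\<close> are read off by the derivatives of order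
  \<open>N\<close>, so \<open>f\<close> lies in the weighted ideal up to \<open>\<mm>\<^sup>N\<close> for every \<open>N\<close>.
\<close>

lemma weighted_ideal_criterion:
  assumes X: "system_of_parameters \<phi> n X" and w: "\<And>l. l < n \<Longrightarrow> 0 \<le> w l"
    and H: "\<And>\<beta>. (\<And>i. n \<le> i \<Longrightarrow> \<beta> i = 0) \<Longrightarrow> multi_weight n w \<beta> < t \<Longrightarrow> multi_deriv \<phi> X \<beta> f \<in> max_ideal"
  shows "f \<in> weighted_ideal X w t"
proof -
  define W where "W = weighted_ideal X w t"
  define M where "M N = weighted_ideal X (\<lambda>_. 1) (of_nat N)" for N
  note len = system_length[OF X]
  have sW: "ideal.subspace W" and sM: "\<And>N. ideal.subspace (M N)" by (simp_all add: W_def M_def)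
  have total: "multi_weight n (\<lambda>_. 1) \<gamma> = of_nat (\<Sum>l<n. \<gamma> l)" for \<gamma> by (simp add: multi_weight_def)
  have M_eq: "M N = ideal.span {\<Prod>l\<in>{..<n}. (X ! l) ^ \<gamma> l | \<gamma>. N \<le> (\<Sum>l\<in>{..<n}. \<gamma> l)}" for N
    unfolding M_def weighted_ideal_def monomial_at_def len total of_nat_le_iff ..
  have step: "f \<in> ideal.span (W \<union> M N)" for N
  proof (induction N)
    case 0
    have "f \<in> M 0" by (simp add: M_def weighted_ideal_nonpos)
    then show ?case by (intro ideal.span_base) auto
  next
    case (Suc N)
    let ?T = "ideal.span (W \<union> M (Suc N))"
    obtain g h where gh: "f = g + h" "g \<in> W" "h \<in> M N"
      using Suc ideal.span_Un[of W "M N"] ideal.span_eq_iff[THEN iffD2, OF sW] ideal.span_eq_iff[THEN iffD2, OF sM]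
      by auto
    obtain \<Gamma> c where \<Gamma>: "finite \<Gamma>" "\<And>\<gamma>. \<gamma> \<in> \<Gamma> \<Longrightarrow> (\<forall>i\<ge>n. \<gamma> i = 0) \<and> N \<le> (\<Sum>l<n. \<gamma> l)"
      "h = (\<Sum>\<gamma>\<in>\<Gamma>. c \<gamma> * monomial_at X \<gamma>)"
      using gh(3) unfolding M_def weighted_ideal_image len total of_nat_le_iff
      by (elim span_image_explicit) blast
    have "c \<gamma> * monomial_at X \<gamma> \<in> ?T" if g: "\<gamma> \<in> \<Gamma>" for \<gamma>
    proof -
      \<comment> \<open>Terms of weight at least \<open>t\<close> or of degree above
        \<open>N\<close> are already where they should be. For a term of degree exactly
        \<open>N\<close> and weight below \<open>t\<close>, the coefficient turns out to be a
        non-unit.\<close>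
      consider "t \<le> multi_weight n w \<gamma>" | "N < (\<Sum>l<n. \<gamma> l)"
        | "multi_weight n w \<gamma> < t" "(\<Sum>l<n. \<gamma> l) = N"
        using \<Gamma>(2)[OF g] by linarith
      then have "c \<gamma> * monomial_at X \<gamma> \<in> W \<union> M (Suc N)"
      proof cases
        case 1
        then have "monomial_at X \<gamma> \<in> W" unfolding W_def by (intro monomial_at_in) (simp add: len)
        then show ?thesis using ideal.subspace_scale[OF sW] by blast
      next
        case 2
        then have "monomial_at X \<gamma> \<in> M (Suc N)"
          unfolding M_def by (intro monomial_at_in) (simp only: len total of_nat_le_iff Suc_le_eq)
        then show ?thesis using ideal.subspace_scale[OF sM] by blast
      next
        case 3
        \<comment> \<open>The part \<open>g\<close> has weight at least \<open>t\<close> and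
          \<gamma> consumes less, so \<open>g\<close> does not contribute at the point.\<close>
        have "multi_deriv \<phi> X \<gamma> g \<in> weighted_ideal X w (t - multi_weight n w \<gamma>)"
          by (rule multi_deriv_drop[OF X, where c = w])
            (use partial_weighted_ideal[OF X, of w] w gh(2) in \<open>auto simp: W_def\<close>)
        then have "multi_deriv \<phi> X \<gamma> g \<in> max_ideal"
          using weighted_ideal_pos_max[OF loc system_set[OF X], of "t - multi_weight n w \<gamma>" w] 3 by auto
        moreover have "multi_deriv \<phi> X \<gamma> f \<in> max_ideal" using H 3 \<Gamma>(2)[OF g] by blast
        ultimately have 1: "multi_deriv \<phi> X \<gamma> h \<in> max_ideal"
          using max_simps(4) multi_deriv_add[OF X] gh(1) by (metis add_diff_cancel_left')
        have 2: "(\<Sum>\<delta>\<in>\<Gamma>-{\<gamma>}. multi_deriv \<phi> X \<gamma> (c \<delta> * monomial_at X \<delta>)) \<in> max_ideal"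
        proof (rule ideal.subspace_sum[OF loc])
          fix \<delta> assume d: "\<delta> \<in> \<Gamma> - {\<gamma>}"
          \<comment> \<open>All terms of \<open>h\<close> have degree at least \<open>N\<close>. A
            multi-index dominated by \<gamma> and different from it would have smaller degree, so
            the derivative \<gamma> sees no other term.\<close>
          have "\<exists>i<n. \<gamma> i < \<delta> i"
          proof (rule ccontr)
            assume "\<not> ?thesis"
            then have le: "\<And>i. i < n \<Longrightarrow> \<delta> i \<le> \<gamma> i" by (meson not_less)
            have "\<delta> \<noteq> \<gamma>" using d by auto
            then obtain i where i: "\<delta> i \<noteq> \<gamma> i" by auto
            then have "i < n" using \<Gamma>(2)[OF g] \<Gamma>(2)[of \<delta>] d by (metis DiffE not_less)
            moreover have "\<delta> i < \<gamma> i" using le[OF \<open>i < n\<close>] i by simp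
            ultimately have "(\<Sum>l<n. \<delta> l) < (\<Sum>l<n. \<gamma> l)"
              using le by (intro sum_strict_mono_ex1) auto
            then show False using 3(2) \<Gamma>(2)[of \<delta>] d by auto
          qed
          then show "multi_deriv \<phi> X \<gamma> (c \<delta> * monomial_at X \<delta>) \<in> max_ideal"
            using multi_deriv_monomial_max[OF X] by blast
        qed
        have "multi_deriv \<phi> X \<gamma> h = multi_deriv \<phi> X \<gamma> (c \<gamma> * monomial_at X \<gamma>)
            + (\<Sum>\<delta>\<in>\<Gamma>-{\<gamma>}. multi_deriv \<phi> X \<gamma> (c \<delta> * monomial_at X \<delta>))"
          unfolding \<Gamma>(3) multi_deriv_sum[OF X] using \<Gamma>(1) g by (simp add: sum.remove)
        then have "multi_deriv \<phi> X \<gamma> (c \<gamma> * monomial_at X \<gamma>) \<in> max_ideal"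
          using max_simps(4)[OF 1 2] by simp
        then have "c \<gamma> \<in> max_ideal" by (rule multi_deriv_monomial_self[OF X])
        \<comment> \<open>Since the parameters generate the maximal ideal, a non-unit coefficient
          raises the degree of the term by one.\<close>
        moreover have "max_ideal \<subseteq> weighted_ideal X (\<lambda>_. 1) 1"
          unfolding max_ideal_eq_span[OF X]
        proof (rule ideal.span_minimal[OF _ subspace_weighted_ideal], rule subsetI)
          fix x assume "x \<in> set X"
          then obtain l where "l < length X" "x = X ! l" by (metis in_set_conv_nth)
          then show "x \<in> weighted_ideal X (\<lambda>_. 1) 1" using weighted_ideal_nth[of l X "\<lambda>_. 1"] by simp
        qed
        ultimately have "c \<gamma> \<in> weighted_ideal X (\<lambda>_. 1) 1" by blast
        moreover have "monomial_at X \<gamma> \<in> weighted_ideal X (\<lambda>_. 1) (of_nat N)"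
          by (rule monomial_at_in) (simp only: len total of_nat_le_iff 3)
        ultimately have "c \<gamma> * monomial_at X \<gamma> \<in> M (Suc N)"
          unfolding M_def using weighted_ideal_mult[of "c \<gamma>" X "\<lambda>_. 1" 1 "monomial_at X \<gamma>" "of_nat N"] by simp
        then show ?thesis by simp
      qed
      then show ?thesis by (rule ideal.span_base)
    qed
    then have "h \<in> ?T" unfolding \<Gamma>(3) by (rule ideal.span_sum)
    moreover have "g \<in> ?T" using gh(2) by (intro ideal.span_base) auto
    ultimately show ?case unfolding gh(1) by (intro ideal.span_add)
  qed
  have "f \<in> W"
    by (rule krull_intersection[OF loc noeth sW, where L = "{..<n}" and y = "\<lambda>l. X ! l" and M = M])
      (use system_max[OF X] M_eq step in auto)
  then show ?thesis by (simp add: W_def)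
qed

section \<open>Changing parameters without changing the filtration\<close>

lemma system_iff:
  assumes X: "system_of_parameters \<phi> n X"
  shows "system_of_parameters \<phi> n ys \<longleftrightarrow> length ys = n \<and> set ys \<subseteq> max_ideal \<and>
     (\<forall>c. (\<forall>i<n. (\<Sum>l<n. c l * partial_deriv \<phi> X i (ys ! l)) \<in> max_ideal) \<longrightarrow> (\<forall>l<n. c l \<in> max_ideal))"
  unfolding system_of_parameters_def parameters_iff[OF X] by auto

text \<open>The new parameters have their weights in the old filtration, which is one inclusion. For
  the other, the partial derivatives of the new system also lower the old weights by at most
  \<open>w i\<close>, so \<open>weighted_ideal_criterion\<close> applies to the new system.\<close>

lemma weighted_ideal_exchange:
  assumes U: "system_of_parameters \<phi> n us" and w: "\<And>l. l < n \<Longrightarrow> 0 \<le> w l"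
    and q: "q < n" and v: "v \<in> weighted_ideal us w (w q)" "v \<in> max_ideal"
    and unit: "partial_deriv \<phi> us q v \<notin> max_ideal"
  shows "system_of_parameters \<phi> n (us[q := v])"
    and "weighted_ideal (us[q := v]) w t = weighted_ideal us w t"
proof -
  let ?Z = "us[q := v]"
  note len = system_length[OF U]
  show Z: "system_of_parameters \<phi> n ?Z"
    unfolding system_iff[OF U]
  proof (intro conjI allI impI)
    show "length ?Z = n" using len by simp
    show "set ?Z \<subseteq> max_ideal" using v(2) system_set[OF U] set_update_subset_insert[of us q v] by blast
  next
    fix c l assume c: "\<forall>i<n. (\<Sum>l<n. c l * partial_deriv \<phi> us i (?Z ! l)) \<in> max_ideal" and l: "l < n"
    have eq: "(\<Sum>l<n. c l * partial_deriv \<phi> us i (?Z ! l))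
        = c q * partial_deriv \<phi> us i v + (if i = q then 0 else c i)" if i: "i < n" for i
    proof -
      have "(\<Sum>l<n. c l * partial_deriv \<phi> us i (?Z ! l))
          = c q * partial_deriv \<phi> us i v + (\<Sum>l\<in>{..<n}-{q}. c l * partial_deriv \<phi> us i (?Z ! l))"
        using q len by (simp add: sum.remove)
      also have "(\<Sum>l\<in>{..<n}-{q}. c l * partial_deriv \<phi> us i (?Z ! l)) = (\<Sum>l\<in>{..<n}-{q}. if l = i then c l else 0)"
        by (rule sum.cong) (use partial_param[OF U i] len in auto)
      also have "\<dots> = (if i = q then 0 else c i)" using i by simp
      finally show ?thesis .
    qed
    have "c q * partial_deriv \<phi> us q v \<in> max_ideal" using c eq[OF q] q by auto
    then have cq: "c q \<in> max_ideal" using max_ideal_prime[OF loc] unit by blast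
    show "c l \<in> max_ideal"
    proof (cases "l = q")
      case False
      then have "c q * partial_deriv \<phi> us l v + c l \<in> max_ideal" using c eq[OF l] l by auto
      from max_simps(4)[OF this max_simps(5)[OF cq, of "partial_deriv \<phi> us l v"]] show ?thesis by simp
    qed (use cq in simp)
  qed
  have nth: "?Z ! l = (if l = q then v else us ! l)" if "l < n" for l using that q len by simp
  show "weighted_ideal ?Z w t = weighted_ideal us w t"
  proof
    show "weighted_ideal ?Z w t \<subseteq> weighted_ideal us w t"
      by (rule weighted_ideal_leI) (use v(1) weighted_ideal_nth[of _ us w] len in \<open>auto simp: nth\<close>)
    show "weighted_ideal us w t \<subseteq> weighted_ideal ?Z w t"
    proof
      fix f assume f: "f \<in> weighted_ideal us w t"
      obtain u where u: "partial_deriv \<phi> us q v * u = 1" using unit by (metis max_ideal_iff dvd_def)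
      have drop: "partial_deriv \<phi> ?Z i a \<in> weighted_ideal us w (s - w i)"
        if i: "i < n" and a: "a \<in> weighted_ideal us w s" for i s a
      proof (rule derivation_weighted_ideal[OF partial_derivation[OF Z i] w[OF i] _ a])
        let ?D = "partial_deriv \<phi> ?Z i"
        fix l assume "l < length us"
        then have l: "l < n" using len by simp
        have Du: "?D (us ! l) = (if l = i then 1 else 0)" if "l < n" "l \<noteq> q" for l
          using partial_param[OF Z i that(1)] nth[OF that(1)] that(2) by simp
        show "?D (us ! l) \<in> weighted_ideal us w (w l - w i)"
        proof (cases "l = q")
          case False
          then show ?thesis using Du[OF l] by (auto simp: weighted_ideal_nonpos ideal.subspace_0)
        next
          case True
          show ?thesis
          proof (cases "i = q")
            case True
            then show ?thesis using \<open>l = q\<close> by (simp add: weighted_ideal_nonpos)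
          next
            case False
            \<comment> \<open>Only \<open>us ! q\<close> is not among the new parameters. Since
              \<open>v\<close> is a new parameter other than the \<open>i\<close>-th, its derivative
              is zero, and the chain rule can be solved for \<open>?D (us ! q)\<close>.\<close>
            have "0 = ?D v" using partial_param[OF Z i q] nth[OF q] False by simp
            also have "\<dots> = (\<Sum>l<n. partial_deriv \<phi> us l v * ?D (us ! l))"
              by (rule chain_rule[OF U partial_derivation[OF Z i]])
            also have "\<dots> = partial_deriv \<phi> us q v * ?D (us ! q) + (\<Sum>l\<in>{..<n}-{q}. partial_deriv \<phi> us l v * ?D (us ! l))"
              using q by (simp add: sum.remove)
            also have "(\<Sum>l\<in>{..<n}-{q}. partial_deriv \<phi> us l v * ?D (us ! l))
                = (\<Sum>l\<in>{..<n}-{q}. if l = i then partial_deriv \<phi> us l v else 0)"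
              by (rule sum.cong) (use Du in auto)
            also have "\<dots> = partial_deriv \<phi> us i v" using i False by simp
            finally have "partial_deriv \<phi> us q v * ?D (us ! q) = - partial_deriv \<phi> us i v"
              by (simp add: eq_neg_iff_add_eq_0)
            then have "(partial_deriv \<phi> us q v * u) * ?D (us ! q) = - u * partial_deriv \<phi> us i v"
              by (simp add: ac_simps)
            then have eq: "?D (us ! q) = - u * partial_deriv \<phi> us i v" using u by simp
            show ?thesis unfolding \<open>l = q\<close> eq
              by (rule ideal.subspace_scale[OF subspace_weighted_ideal partial_weighted_ideal[OF U w i v(1)]])
          qed
        qed
      qed
      show "f \<in> weighted_ideal ?Z w t"
      proof (rule weighted_ideal_criterion[OF Z w])
        fix \<beta> assume b: "multi_weight n w \<beta> < t"
        have "multi_deriv \<phi> ?Z \<beta> f \<in> weighted_ideal us w (t - multi_weight n w \<beta>)"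
          by (rule multi_deriv_drop[OF Z, where c = w]) (use drop f in auto)
        then show "multi_deriv \<phi> ?Z \<beta> f \<in> max_ideal"
          using weighted_ideal_pos_max[OF loc system_set[OF U], of "t - multi_weight n w \<beta>" w] b by auto
      qed
    qed
  qed
qed

lemma weighted_ideal_swap:
  assumes U: "system_of_parameters \<phi> n us" and kq: "k < n" "q < n" and wkq: "w k = w q"
  shows "system_of_parameters \<phi> n (us[k := us ! q, q := us ! k])"
    and "weighted_ideal (us[k := us ! q, q := us ! k]) w t = weighted_ideal us w t"
proof -
  let ?Z = "us[k := us ! q, q := us ! k]" and ?p = "Transposition.transpose k q"
  note len = system_length[OF U]
  have nth: "?Z ! l = us ! ?p l" if "l < n" for l
    using that kq len by (auto simp: Transposition.transpose_def nth_list_update)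
  have p: "?p l < n" if "l < n" for l using that kq by (auto simp: Transposition.transpose_def)
  show "system_of_parameters \<phi> n ?Z"
    unfolding system_iff[OF U]
  proof (intro conjI allI impI)
    show "length ?Z = n" using len by simp
    show "set ?Z \<subseteq> max_ideal" using system_set[OF U] kq len by simp
  next
    fix c l assume c: "\<forall>i<n. (\<Sum>l<n. c l * partial_deriv \<phi> us i (?Z ! l)) \<in> max_ideal" and l: "l < n"
    have "(\<Sum>l<n. c l * partial_deriv \<phi> us i (?Z ! l)) = c (?p i)" if i: "i < n" for i
    proof -
      have "(\<Sum>l<n. c l * partial_deriv \<phi> us i (?Z ! l)) = (\<Sum>l<n. if l = ?p i then c l else 0)"
      proof (rule sum.cong)
        fix l assume "l \<in> {..<n}"
        then have "partial_deriv \<phi> us i (?Z ! l) = (if ?p l = i then 1 else 0)"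
          using partial_param[OF U i p[of l]] nth[of l] by simp
        moreover have "?p l = i \<longleftrightarrow> l = ?p i" by (metis Transposition.transpose_involutory)
        ultimately show "c l * partial_deriv \<phi> us i (?Z ! l) = (if l = ?p i then c l else 0)"
          by simp
      qed simp
      then show ?thesis using p[OF i] by simp
    qed
    then have "\<And>i. i < n \<Longrightarrow> c (?p i) \<in> max_ideal" using c by auto
    from this[OF p[OF l]] show "c l \<in> max_ideal" by simp
  qed
  have wp: "w (?p l) = w l" for l using wkq by (auto simp: Transposition.transpose_def)
  have sub: "weighted_ideal xs w t \<subseteq> weighted_ideal ys w t"
    if "length xs = n" "length ys = n" "\<And>l. l < n \<Longrightarrow> xs ! l = ys ! ?p l" for xs ys
  proof (rule weighted_ideal_leI)
    fix l assume "l < length xs"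
    then have l: "l < n" using that by simp
    have "ys ! ?p l \<in> weighted_ideal ys w (w (?p l))"
      by (rule weighted_ideal_nth) (simp add: that(2) p l)
    then show "xs ! l \<in> weighted_ideal ys w (w l)" by (simp add: that(3)[OF l] wp)
  qed (simp add: that)
  show "weighted_ideal ?Z w t = weighted_ideal us w t"
    by (intro equalityI sub) (use len nth p in auto)
qed

end

section \<open>Weights of filtrations\<close>

text \<open>Weight zero beyond the list corresponds to the exponent infinity with which
  pre-invariants are padded.\<close>

definition exponent_weight :: "rat list \<Rightarrow> nat \<Rightarrow> rat" where
  "exponent_weight as l = (if l < length as then 1 / as ! l else 0)"

lemma exponent_weight_nonneg: "(\<And>a. a \<in> set as \<Longrightarrow> 0 < a) \<Longrightarrow> 0 \<le> exponent_weight as l"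
  by (simp add: exponent_weight_def less_imp_le)

lemma exponent_weight_prefix:
  assumes "prefix as bs" "l < length as"
  shows "exponent_weight as l = exponent_weight bs l"
  using assms by (auto simp: exponent_weight_def prefix_def nth_append)

lemma exponent_weight_prefix_le:
  assumes "prefix as bs" "\<And>a. a \<in> set bs \<Longrightarrow> 0 < a"
  shows "exponent_weight as l \<le> exponent_weight bs l"
  using exponent_weight_prefix[OF assms(1), of l] exponent_weight_nonneg[of bs l, OF assms(2)]
  by (cases "l < length as") (auto simp: exponent_weight_def)

lemma exponent_weight_sorted_le:
  assumes "sorted bs" "\<And>a. a \<in> set bs \<Longrightarrow> 0 < a" "j < length bs" "j \<le> l"
  shows "exponent_weight bs l \<le> 1 / bs ! j"
proof -
  have p: "0 < bs ! j" using assms(2,3) by simp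
  show ?thesis
  proof (cases "l < length bs")
    case True
    then have "bs ! j \<le> bs ! l" using assms by (simp add: sorted_iff_nth_mono)
    then show ?thesis using True p by (simp add: exponent_weight_def frac_le)
  qed (use p in \<open>simp add: exponent_weight_def\<close>)
qed

text \<open>Multiplication by the degree \<open>m\<close> makes the weights integral, and an integer
  is at least \<open>t * of_nat m\<close> iff it is at least the ceiling. For negative
  \<open>t\<close>, \<open>nat\<close> gives index zero, where both sides are the whole
  ring.\<close>

lemma weighted_ideal_filtration:
  fixes X :: "'a::comm_ring_1 list"
  assumes len: "length as \<le> length X" and m: "0 < m"
    and ws: "map of_nat ws = map (\<lambda>a. of_nat m / a) as"
  shows "weighted_ideal X (exponent_weight as) t
    = weight_filtration (take (length as) X) ws (nat \<lceil>t * of_nat m\<rceil>)"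
proof -
  define k where "k = length as"
  have lw: "length ws = k" using ws k_def by (metis length_map)
  have kX: "k \<le> length X" using len k_def by simp
  have nth: "exponent_weight as l = of_nat (ws ! l) / of_nat m" if "l < k" for l
  proof -
    have "of_nat (ws ! l) = of_nat m / as ! l"
      using arg_cong[OF ws, of "\<lambda>xs. xs ! l"] that lw k_def by simp
    then show ?thesis using that m by (simp add: exponent_weight_def k_def)
  qed
  have mw: "multi_weight (length X) (exponent_weight as) \<gamma> = of_nat (\<Sum>l<k. \<gamma> l * ws ! l) / of_nat m" for \<gamma>
  proof -
    have "multi_weight (length X) (exponent_weight as) \<gamma> = (\<Sum>l<k. of_nat (\<gamma> l) * exponent_weight as l)"
      unfolding multi_weight_def
      by (rule sum.mono_neutral_right) (use kX in \<open>auto simp: exponent_weight_def k_def\<close>)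
    also have "\<dots> = (\<Sum>l<k. of_nat (\<gamma> l * ws ! l) / of_nat m)"
      by (rule sum.cong) (use nth in auto)
    finally show ?thesis by (simp add: sum_divide_distrib)
  qed
  have iff: "t \<le> of_nat N / of_nat m \<longleftrightarrow> nat \<lceil>t * of_nat m\<rceil> \<le> N" for N
    using m by (simp add: pos_le_divide_eq ceiling_le_iff nat_le_iff)
  let ?F = "weight_filtration (take k X) ws (nat \<lceil>t * of_nat m\<rceil>)"
  have F: "?F = ideal.span {\<Prod>l<k. (X ! l) ^ \<beta> l | \<beta>. t \<le> of_nat (\<Sum>l<k. \<beta> l * ws ! l) / of_nat m}"
    unfolding weight_filtration_def using kX by (simp add: iff min_absorb2 del: of_nat_sum)
  have "weighted_ideal X (exponent_weight as) t = ?F"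
  proof
    show "weighted_ideal X (exponent_weight as) t \<subseteq> ?F"
      unfolding weighted_ideal_def mw
    proof (rule ideal.span_minimal, safe)
      fix \<gamma> assume t: "t \<le> of_nat (\<Sum>l<k. \<gamma> l * ws ! l) / of_nat m"
      have "{..<length X} = {..<k} \<union> {k..<length X}" using kX by auto
      then have "monomial_at X \<gamma> = (\<Prod>l<k. (X ! l) ^ \<gamma> l) * (\<Prod>l=k..<length X. (X ! l) ^ \<gamma> l)"
        unfolding monomial_at_def by (simp add: prod.union_disjoint ivl_disj_int)
      moreover have "(\<Prod>l<k. (X ! l) ^ \<gamma> l) \<in> ?F"
        unfolding F by (rule ideal.span_base) (use t in auto)
      moreover have "ideal.subspace ?F" by (simp add: weight_filtration_def)
      ultimately show "monomial_at X \<gamma> \<in> ?F" using ideal_mult1 by metis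
    qed (simp add: weight_filtration_def)
    show "?F \<subseteq> weighted_ideal X (exponent_weight as) t"
      unfolding F
    proof (rule ideal.span_minimal[OF _ subspace_weighted_ideal], safe)
      fix \<beta> assume t: "t \<le> of_nat (\<Sum>l<k. \<beta> l * ws ! l) / of_nat m"
      let ?g = "\<lambda>l. if l < k then \<beta> l else 0"
      have "monomial_at X ?g = (\<Prod>l<k. (X ! l) ^ ?g l)"
        unfolding monomial_at_def by (rule prod.mono_neutral_right) (use kX in auto)
      also have "\<dots> = (\<Prod>l<k. (X ! l) ^ \<beta> l)" by (rule prod.cong) auto
      moreover have "(\<Sum>l<k. ?g l * ws ! l) = (\<Sum>l<k. \<beta> l * ws ! l)" by (rule sum.cong) auto
      then have "monomial_at X ?g \<in> weighted_ideal X (exponent_weight as) t"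
        by (intro monomial_at_in) (use t in \<open>simp only: mw\<close>)
      ultimately show "(\<Prod>l<k. (X ! l) ^ \<beta> l) \<in> weighted_ideal X (exponent_weight as) t" by simp
    qed
  qed
  then show ?thesis by (simp add: k_def)
qed

lemma monomial_at_remove:
  assumes "q < length ys" "\<beta> q \<noteq> 0"
  shows "monomial_at ys \<beta> = ys ! q * monomial_at ys (\<beta>(q := \<beta> q - 1))"
proof -
  have "(\<Prod>l\<in>{..<length ys}-{q}. (ys ! l) ^ (\<beta>(q := \<beta> q - 1)) l) = (\<Prod>l\<in>{..<length ys}-{q}. (ys ! l) ^ \<beta> l)"
    by (rule prod.cong) auto
  moreover have "(ys ! q) ^ \<beta> q = ys ! q * (ys ! q) ^ (\<beta> q - 1)"
    using assms(2) by (cases "\<beta> q") auto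
  ultimately show ?thesis
    unfolding monomial_at_split[OF assms(1)] by (simp add: mult.assoc)
qed

lemma monomial_at_max:
  assumes loc: "ideal.subspace (max_ideal :: 'a::comm_ring_1 set)"
    and "set (ys :: 'a list) \<subseteq> max_ideal" "0 < (\<Sum>l<length ys. \<beta> l * v l)"
  shows "monomial_at ys \<beta> \<in> max_ideal"
proof -
  have "\<not> (\<forall>l<length ys. \<beta> l = 0)"
  proof
    assume "\<forall>l<length ys. \<beta> l = 0"
    then have "(\<Sum>l<length ys. \<beta> l * v l) = 0" by simp
    then show False using assms(3) by linarith
  qed
  then obtain q where q: "q < length ys" "\<beta> q \<noteq> 0" by auto
  have "ys ! q \<in> max_ideal" using assms(2) q by auto
  then show ?thesis unfolding monomial_at_remove[of q ys \<beta>, OF q] by (rule max_ideal_mult1[OF loc])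
qed

section \<open>Padded lists and the arithmetic of exponents\<close>

lemma list_le_append:
  fixes xs ys :: "'a::order list"
  assumes "length xs = length ys" "xs \<noteq> ys" "xs @ zs \<le> ys @ zs'"
  shows "xs @ us \<le> ys @ us'"
  using assms by (induction xs ys rule: list_induct2) auto

lemma list_append_le_append: "us \<le> us' \<Longrightarrow> (xs :: 'a::order list) @ us \<le> xs @ us'"
  by (induction xs) auto

lemma pos_rat_nat_fraction:
  assumes "0 < (a :: rat)" shows "\<exists>p q. 0 < p \<and> 0 < q \<and> a = of_nat p / of_nat q"
proof -
  obtain p q where pq: "quotient_of a = (p, q)" by fastforce
  have q: "0 < q" using quotient_of_denom_pos[OF pq] .
  have a: "a = of_int p / of_int q" using quotient_of_div[OF pq] .
  have "0 < p" using assms q unfolding a by (simp add: zero_less_divide_iff)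
  then show ?thesis using q a by (intro exI[of _ "nat p"] exI[of _ "nat q"]) (simp add: of_nat_nat)
qed

lemma common_multiple:
  assumes "\<And>a. a \<in> set as \<Longrightarrow> 0 < (a :: rat)"
  shows "\<exists>M ws. 0 < M \<and> map of_nat ws = map (\<lambda>a. of_nat M / a) as"
  using assms
proof (induction as)
  case Nil
  show ?case by (intro exI[of _ 1] exI[of _ "[]"]) simp
next
  case (Cons a as)
  then obtain M ws where M: "0 < M" "map of_nat ws = map (\<lambda>a. of_nat M / a) as" by auto
  obtain p q where pq: "0 < p" "0 < q" "a = of_nat p / of_nat q"
    using pos_rat_nat_fraction[of a] Cons.prems by auto
  have "map of_nat (map (\<lambda>w. w * p) ws) = map (\<lambda>x. x * of_nat p) (map of_nat ws :: rat list)" by simp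
  also have "\<dots> = map (\<lambda>a. of_nat (M * p) / a) as" unfolding M(2) by simp
  moreover have "of_nat (M * q) = of_nat (M * p) / a" using pq by simp
  ultimately have "map of_nat ((M * q) # map (\<lambda>w. w * p) ws) = map (\<lambda>a. of_nat (M * p) / a) (a # as)"
    by (simp only: list.map)
  then show ?case using M pq by (metis nat_0_less_mult_iff)
qed

text \<open>Some degree \<open>M\<close> makes all weights integral. A monomial of weight exactly
  one, with exponents \<open>z\<close>, writes \<open>M\<close> as an integral combination of these
  weights, so their gcd divides \<open>M\<close> and can be divided out.\<close>

lemma coprime_weights_exist:
  assumes pos: "\<And>a. a \<in> set as \<Longrightarrow> 0 < (a :: rat)" and ne: "as \<noteq> []"
    and one: "(\<Sum>i<length as. of_nat (z i) / as ! i) = 1"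
  shows "\<exists>m ws. 0 < m \<and> coprime_weights ws \<and> map of_nat ws = map (\<lambda>a. of_nat m / a) as"
proof -
  obtain M vs where M: "0 < M" and vs: "map of_nat vs = map (\<lambda>a. of_nat M / a) as"
    using common_multiple[of as] pos by blast
  have len: "length vs = length as" using vs by (metis length_map)
  have nth: "(of_nat (vs ! i) :: rat) = of_nat M / as ! i" if "i < length as" for i
    using arg_cong[OF vs, of "\<lambda>xs. xs ! i"] that len by simp
  define g where "g = Gcd (set vs)"
  have dv: "g dvd v" if "v \<in> set vs" for v using that by (simp add: g_def)
  have "(of_nat M :: rat) = of_nat M * (\<Sum>i<length as. of_nat (z i) / as ! i)" using one by simp
  also have "\<dots> = (\<Sum>i<length as. of_nat (z i) * of_nat (vs ! i))"
    by (simp add: sum_distrib_left nth ac_simps)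
  finally have "of_nat M = (of_nat (\<Sum>i<length as. z i * vs ! i) :: rat)" by simp
  then have Msum: "M = (\<Sum>i<length as. z i * vs ! i)" by (simp only: of_nat_eq_iff)
  have gM: "g dvd M" unfolding Msum by (rule dvd_sum) (simp add: dv len)
  then have g: "0 < g" using M by (auto intro: Nat.gr0I)
  define m where "m = M div g"
  define ws where "ws = map (\<lambda>v. v div g) vs"
  have m: "M = g * m" "0 < m" using gM M by (auto simp: m_def elim: dvdE)
  have ws_vs: "vs = map ((*) g) ws" unfolding ws_def by (rule nth_equalityI) (use dv in auto)
  have "g = Gcd ((*) g ` set ws)" using ws_vs g_def by (metis list.set_map)
  then have "g = g * Gcd (set ws)" by (simp add: Gcd_mult)
  then have "coprime_weights ws" using g by (simp add: coprime_weights_def)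
  moreover have "map of_nat ws = map (\<lambda>a. of_nat m / a) as"
  proof (rule nth_equalityI)
    fix i assume "i < length (map of_nat ws :: rat list)"
    then have i: "i < length ws" "i < length as" using len by (simp_all add: ws_def)
    have "(of_nat g :: rat) * of_nat (ws ! i) = of_nat g * (of_nat m / as ! i)"
      using nth[OF i(2)] i ws_vs m(1) by simp
    moreover have "(of_nat g :: rat) \<noteq> 0" using g by simp
    ultimately have "(of_nat (ws ! i) :: rat) = of_nat m / as ! i" by (metis mult_left_cancel)
    then show "map of_nat ws ! i = map (\<lambda>a. of_nat m / a) as ! i" using i by simp
  qed (simp add: ws_def len)
  ultimately show ?thesis using m(2) by blast
qed

lemma multi_weight_replicate:
  assumes "length as \<le> n"
  shows "multi_weight n (exponent_weight (as @ replicate (n - length as) b)) \<beta>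
    = weighted_degree as \<beta> + of_nat (\<Sum>i=length as..<n. \<beta> i) / b"
proof -
  let ?w = "exponent_weight (as @ replicate (n - length as) b)"
  have "{..<n} = {..<length as} \<union> {length as..<n}" using assms by auto
  then have "multi_weight n ?w \<beta>
      = (\<Sum>i<length as. of_nat (\<beta> i) * ?w i) + (\<Sum>i=length as..<n. of_nat (\<beta> i) * ?w i)"
    unfolding multi_weight_def by (simp add: sum.union_disjoint ivl_disj_int)
  also have "(\<Sum>i<length as. of_nat (\<beta> i) * ?w i) = weighted_degree as \<beta>"
    unfolding weighted_degree_def by (rule sum.cong) (auto simp: exponent_weight_def nth_append)
  also have "(\<Sum>i=length as..<n. of_nat (\<beta> i) * ?w i) = (\<Sum>i=length as..<n. of_nat (\<beta> i) / b)"
    by (rule sum.cong) (auto simp: exponent_weight_def nth_append)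
  finally show ?thesis by (simp add: sum_divide_distrib)
qed

context smooth_local_algebra
begin

text \<open>
  If this failed, the \<open>l + 1\<close> parameters \<open>x\<^sub>0, \<dots>, x\<^sub>l\<close> would lie in the span of the at most \<open>l\<close>
  elements \<open>y\<^sub>0, \<dots>, y\<^sub>l\<^sub>-\<^sub>1\<close> modulo the square of the maximal ideal.
\<close>

lemma filtration_weights_le:
  assumes X: "system_of_parameters \<phi> n X"
    and xs: "parameters \<phi> xs" and ys: "parameters \<phi> ys"
    and len: "length xs = length ws" "length ys = length vs"
    and sorted: "sorted_wrt (\<ge>) ws" "sorted_wrt (\<ge>) vs" and pos: "\<And>w. w \<in> set ws \<Longrightarrow> 0 < w"
    and F: "weight_filtration xs ws = weight_filtration ys vs" and l: "l < length ws"
  shows "l < length vs \<and> ws ! l \<le> vs ! l"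
proof (rule ccontr)
  assume neg: "\<not> ?thesis"
  let ?D = "partial_deriv \<phi> X"
  define i where "i = ws ! l"
  \<comment> \<open>By \<open>neg\<close> the elements of \<open>ys\<close> from index
    \<open>l\<close> on, if there are any, have weight below \<open>i\<close>. So at most the first
    \<open>s\<close> can have weight \<open>i\<close> or more.\<close>
  define s where "s = min l (length vs)"
  have ip: "0 < i" using pos l by (simp add: i_def)
  have big: "vs ! q < i" if "s \<le> q" "q < length vs" for q
  proof -
    have sl: "l \<le> q" "l < length vs" using that by (auto simp: s_def min_def split: if_splits)
    then have "vs ! l < i" using neg by (simp add: i_def)
    moreover have "vs ! q \<le> vs ! l"
      using sorted_wrt_nth_less[OF sorted(2), of l q] sl that by (cases "l = q") auto
    ultimately show ?thesis by simp
  qed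
  have ysm: "set ys \<subseteq> max_ideal" using ys by (simp add: parameters_def)
  \<comment> \<open>The elements whose differential at the point is a combination of those of the
    first \<open>s\<close> elements of \<open>ys\<close>.\<close>
  define T where "T = {f \<in> max_ideal. \<exists>A. \<forall>p<n. ?D p f - (\<Sum>q<s. A q * ?D p (ys ! q)) \<in> max_ideal}"
  have TI: "f \<in> T" if "f \<in> max_ideal" "\<And>p. p < n \<Longrightarrow> ?D p f - (\<Sum>q<s. A q * ?D p (ys ! q)) \<in> max_ideal" for f A
    unfolding T_def using that by blast
  have sT: "ideal.subspace T"
  proof (rule ideal.subspaceI)
    show "0 \<in> T"
      by (rule TI[of _ "\<lambda>_. 0"]) (simp_all add: max_simps(1) derivation_simps(4)[OF partial_derivation[OF X]])
  next
    fix f g assume "f \<in> T" "g \<in> T"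
    then obtain A B where f: "f \<in> max_ideal" "\<And>p. p < n \<Longrightarrow> ?D p f - (\<Sum>q<s. A q * ?D p (ys ! q)) \<in> max_ideal"
      and g: "g \<in> max_ideal" "\<And>p. p < n \<Longrightarrow> ?D p g - (\<Sum>q<s. B q * ?D p (ys ! q)) \<in> max_ideal"
      unfolding T_def by blast
    show "f + g \<in> T"
    proof (rule TI[of _ "\<lambda>q. A q + B q"])
      show "f + g \<in> max_ideal" using f g max_simps(3) by blast
      fix p assume p: "p < n"
      have "?D p (f + g) - (\<Sum>q<s. (A q + B q) * ?D p (ys ! q))
          = (?D p f - (\<Sum>q<s. A q * ?D p (ys ! q))) + (?D p g - (\<Sum>q<s. B q * ?D p (ys ! q)))"
        by (simp add: derivation_simps(1)[OF partial_derivation[OF X p]] distrib_right sum.distrib)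
      then show "?D p (f + g) - (\<Sum>q<s. (A q + B q) * ?D p (ys ! q)) \<in> max_ideal"
        using max_simps(3)[OF f(2)[OF p] g(2)[OF p]] by simp
    qed
  next
    fix k f assume "f \<in> T"
    then obtain A where f: "f \<in> max_ideal" "\<And>p. p < n \<Longrightarrow> ?D p f - (\<Sum>q<s. A q * ?D p (ys ! q)) \<in> max_ideal"
      unfolding T_def by blast
    show "k * f \<in> T"
    proof (rule TI[of _ "\<lambda>q. k * A q"])
      show "k * f \<in> max_ideal" using f max_simps(6) by blast
      fix p assume p: "p < n"
      have "?D p (k * f) - (\<Sum>q<s. k * A q * ?D p (ys ! q))
          = k * (?D p f - (\<Sum>q<s. A q * ?D p (ys ! q))) + f * ?D p k"
        by (simp add: derivation_simps(2)[OF partial_derivation[OF X p]] right_diff_distrib sum_distrib_left mult.assoc)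
      then show "?D p (k * f) - (\<Sum>q<s. k * A q * ?D p (ys ! q)) \<in> max_ideal"
        using max_simps(3)[OF max_simps(6)[OF f(2)[OF p]] max_simps(5)[OF f(1)]] by simp
    qed
  qed
  have "weight_filtration ys vs i \<subseteq> T"
    unfolding weight_filtration_def
  proof (rule ideal.span_minimal[OF _ sT], safe)
    fix \<beta> assume b: "i \<le> (\<Sum>l<length ys. \<beta> l * vs ! l)"
    have "monomial_at ys \<beta> \<in> T"
    proof (cases "\<exists>q<s. \<beta> q \<noteq> 0")
      case True
      then obtain q where q: "q < s" "\<beta> q \<noteq> 0" by blast
      have ql: "q < length ys" using q(1) len by (simp add: s_def)
      have "ys ! q \<in> T"
      proof (rule TI[of _ "\<lambda>r. if r = q then 1 else 0"])
        show "ys ! q \<in> max_ideal" using ysm ql by auto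
        fix p
        have "(\<Sum>r<s. (if r = q then 1 else 0) * ?D p (ys ! r)) = (\<Sum>r<s. if r = q then ?D p (ys ! r) else 0)"
          by (rule sum.cong) auto
        then show "?D p (ys ! q) - (\<Sum>r<s. (if r = q then 1 else 0) * ?D p (ys ! r)) \<in> max_ideal"
          using q(1) max_simps(1) by simp
      qed
      then show ?thesis unfolding monomial_at_remove[of q ys \<beta>, OF ql q(2)] by (rule ideal_mult1[OF sT])
    next
      case False
      have "\<not> (\<forall>l<length ys. \<beta> l = 0)"
      proof
        assume "\<forall>l<length ys. \<beta> l = 0"
        then have "(\<Sum>l<length ys. \<beta> l * vs ! l) = 0" by simp
        then show False using b ip by linarith
      qed
      then obtain q where q: "q < length ys" "\<beta> q \<noteq> 0" by auto
      let ?b = "\<beta>(q := \<beta> q - 1)"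
      have "s \<le> q" using False q(2) by (metis not_less)
      then have "vs ! q < i" using big q(1) len by simp
      moreover have "(\<Sum>l<length ys. \<beta> l * vs ! l) = vs ! q + (\<Sum>l<length ys. ?b l * vs ! l)"
      proof -
        have "(\<Sum>l\<in>{..<length ys}-{q}. ?b l * vs ! l) = (\<Sum>l\<in>{..<length ys}-{q}. \<beta> l * vs ! l)"
          by (rule sum.cong) auto
        moreover have "\<beta> q * vs ! q = vs ! q + (\<beta> q - 1) * vs ! q" using q(2) by (cases "\<beta> q") auto
        ultimately show ?thesis using q(1) by (simp add: sum.remove[of _ q])
      qed
      \<comment> \<open>The variable removed has weight below \<open>i\<close>, so another factor
        must remain. A product of two elements of the maximal ideal has zero differential at the
        point.\<close>
      ultimately have "0 < (\<Sum>l<length ys. ?b l * vs ! l)" using b by linarith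
      then have m: "monomial_at ys ?b \<in> max_ideal" by (rule monomial_at_max[OF loc ysm])
      have yq: "ys ! q \<in> max_ideal" using ysm q by auto
      show ?thesis
      proof (rule TI[of _ "\<lambda>_. 0"])
        show "monomial_at ys \<beta> \<in> max_ideal"
          unfolding monomial_at_remove[of q ys \<beta>, OF q] by (rule max_simps(5)[OF yq])
        fix p assume p: "p < n"
        have "?D p (monomial_at ys \<beta>) = ys ! q * ?D p (monomial_at ys ?b) + monomial_at ys ?b * ?D p (ys ! q)"
          unfolding monomial_at_remove[of q ys \<beta>, OF q] by (rule derivation_simps(2)[OF partial_derivation[OF X p]])
        then show "?D p (monomial_at ys \<beta>) - (\<Sum>q<s. 0 * ?D p (ys ! q)) \<in> max_ideal"
          using max_simps(3)[OF max_simps(5)[OF yq] max_simps(5)[OF m]] by simp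
      qed
    qed
    then show "(\<Prod>l<length ys. (ys ! l) ^ \<beta> l) \<in> T" by (simp add: monomial_at_def)
  qed
  moreover have "xs ! r \<in> weight_filtration xs ws i" if r: "r \<le> l" for r
  proof -
    let ?e = "\<lambda>q. if q = r then 1 else 0 :: nat"
    have rl: "r < length xs" using r l len by simp
    have "(\<Prod>q<length xs. (xs ! q) ^ ?e q) = (\<Prod>q<length xs. if q = r then xs ! q else 1)"
      by (rule prod.cong) auto
    then have 1: "xs ! r = (\<Prod>q<length xs. (xs ! q) ^ ?e q)" using rl by simp
    have "(\<Sum>q<length xs. ?e q * ws ! q) = (\<Sum>q<length xs. if q = r then ws ! q else 0)"
      by (rule sum.cong) auto
    moreover have "ws ! l \<le> ws ! r"
      using sorted_wrt_nth_less[OF sorted(1), of r l] r l by (cases "r = l") auto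
    ultimately have 2: "i \<le> (\<Sum>q<length xs. ?e q * ws ! q)" using rl by (simp add: i_def)
    show ?thesis unfolding weight_filtration_def
      by (rule ideal.span_base, rule CollectI, rule exI[of _ ?e], rule conjI[OF 1 2])
  qed
  ultimately have xT: "\<And>r. r \<le> l \<Longrightarrow> xs ! r \<in> T" using F by auto
  then have "\<forall>r\<in>{..l}. \<exists>A. \<forall>p<n. ?D p (xs ! r) - (\<Sum>q<s. A q * ?D p (ys ! q)) \<in> max_ideal"
    by (auto simp: T_def)
  from bchoice[OF this] obtain A where
    A: "\<And>r p. r \<le> l \<Longrightarrow> p < n \<Longrightarrow> ?D p (xs ! r) - (\<Sum>q<s. A r q * ?D p (ys ! q)) \<in> max_ideal" by blast
  \<comment> \<open>There are \<open>l + 1\<close> differentials in the span of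
    \<open>s \<le> l\<close>, so a combination with a unit coefficient vanishes at the point,
    against the independence of \<open>xs\<close>.\<close>
  have "s < card {..l}" by (simp add: s_def)
  then obtain c where c: "\<exists>r\<in>{..l}. c r \<notin> max_ideal" "\<And>q. q < s \<Longrightarrow> (\<Sum>r\<le>l. c r * A r q) \<in> max_ideal"
    using local_kernel[OF loc, of "{..l}" s A] by auto
  define c' where "c' r = (if r \<le> l then c r else 0)" for r
  have "(\<Sum>r<length xs. c' r * ?D p (xs ! r)) \<in> max_ideal" if p: "p < n" for p
  proof -
    have "(\<Sum>r<length xs. c' r * ?D p (xs ! r)) = (\<Sum>r\<le>l. c r * ?D p (xs ! r))"
      by (rule sum.mono_neutral_cong_right) (use l len in \<open>auto simp: c'_def\<close>)
    also have "\<dots> = (\<Sum>r\<le>l. c r * (?D p (xs ! r) - (\<Sum>q<s. A r q * ?D p (ys ! q))))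
        + (\<Sum>r\<le>l. \<Sum>q<s. c r * A r q * ?D p (ys ! q))"
      by (simp add: right_diff_distrib sum_subtractf sum_distrib_left mult.assoc)
    also have "(\<Sum>r\<le>l. \<Sum>q<s. c r * A r q * ?D p (ys ! q)) = (\<Sum>q<s. (\<Sum>r\<le>l. c r * A r q) * ?D p (ys ! q))"
      by (subst sum.swap) (simp add: sum_distrib_right)
    finally have eq: "(\<Sum>r<length xs. c' r * ?D p (xs ! r))
      = (\<Sum>r\<le>l. c r * (?D p (xs ! r) - (\<Sum>q<s. A r q * ?D p (ys ! q))))
        + (\<Sum>q<s. (\<Sum>r\<le>l. c r * A r q) * ?D p (ys ! q))" .
    show ?thesis unfolding eq
    proof (rule max_simps(3); rule ideal.subspace_sum[OF loc])
      fix r assume "r \<in> {..l}"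
      then show "c r * (?D p (xs ! r) - (\<Sum>q<s. A r q * ?D p (ys ! q))) \<in> max_ideal"
        by (intro max_simps(6) A) (use p in auto)
    next
      fix q assume "q \<in> {..<s}"
      then show "(\<Sum>r\<le>l. c r * A r q) * ?D p (ys ! q) \<in> max_ideal"
        by (intro max_simps(5) c(2)) auto
    qed
  qed
  then have "\<forall>r<length xs. c' r \<in> max_ideal" using xs unfolding parameters_iff[OF X] by blast
  then show False using c(1) l len by (auto simp: c'_def split: if_splits)
qed

lemma weights_eq:
  assumes X: "system_of_parameters \<phi> n X" and ws: "weighting \<phi> n F ws"
  shows "weights \<phi> n F = ws"
  unfolding weights_def
proof (rule the_equality, rule ws)
  fix vs assume vs: "weighting \<phi> n F vs"
  obtain xs where xs: "parameters \<phi> xs" "length xs = length ws" "F = weight_filtration xs ws"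
    "sorted_wrt (\<ge>) ws" "\<And>w. w \<in> set ws \<Longrightarrow> 0 < w" using ws by (auto simp: weighting_def)
  obtain ys where ys: "parameters \<phi> ys" "length ys = length vs" "F = weight_filtration ys vs"
    "sorted_wrt (\<ge>) vs" "\<And>w. w \<in> set vs \<Longrightarrow> 0 < w" using vs by (auto simp: weighting_def)
  have 1: "l < length vs \<and> ws ! l \<le> vs ! l" if "l < length ws" for l
    by (rule filtration_weights_le[OF X xs(1) ys(1) xs(2) ys(2) xs(4) ys(4) xs(5) _ that]) (use xs ys in auto)
  have 2: "l < length ws \<and> vs ! l \<le> ws ! l" if "l < length vs" for l
    by (rule filtration_weights_le[OF X ys(1) xs(1) ys(2) xs(2) ys(4) xs(4) ys(5) _ that]) (use xs ys in auto)
  show "vs = ws"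
  proof (rule nth_equalityI)
    show "length vs = length ws" using 1 2 by (metis linorder_neqE_nat less_irrefl)
    show "vs ! l = ws ! l" if "l < length vs" for l using 1[of l] 2[OF that] by auto
  qed
qed

end

section \<open>Marked centres\<close>

context smooth_local_algebra
begin

lemma marked_centre_data:
  assumes X: "system_of_parameters \<phi> n X" and J: "marked_centre \<phi> n J"
  obtains ws where "map of_nat ws = map (\<lambda>a. of_nat (snd J) / a) (invariant \<phi> n J)" "0 < snd J"
    "pre_invariant n (invariant \<phi> n J)"
    "\<And>ys. compatible_system \<phi> n J ys \<longleftrightarrow> system_of_parameters \<phi> n ys \<and>
       fst J = weight_filtration (take (length (invariant \<phi> n J)) ys) ws"
proof -
  obtain ws where ws: "weighting \<phi> n (fst J) ws" and d: "0 < snd J" using J by (auto simp: marked_centre_def)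
  have W: "weights \<phi> n (fst J) = ws" by (rule weights_eq[OF X ws])
  have inv: "invariant \<phi> n J = map (\<lambda>w. of_nat (snd J) / of_nat w) ws"
    by (simp add: invariant_def W)
  have pos: "\<And>w. w \<in> set ws \<Longrightarrow> 0 < w" and len: "length ws \<le> n" and sorted: "sorted_wrt (\<ge>) ws"
    using ws by (auto simp: weighting_def)
  show ?thesis
  proof (rule that[of ws])
    show "map of_nat ws = map (\<lambda>a. of_nat (snd J) / a) (invariant \<phi> n J)"
      unfolding inv by (rule nth_equalityI) (use pos d in auto)
    have "sorted_wrt (\<le>) (map (\<lambda>w. of_nat (snd J) / of_nat w :: rat) ws)"
      unfolding sorted_wrt_map
      by (rule sorted_wrt_mono_rel[OF _ sorted]) (use pos in \<open>auto intro!: divide_left_mono\<close>)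
    then show "pre_invariant n (invariant \<phi> n J)"
      using pos len d by (auto simp: pre_invariant_def inv)
    show "compatible_system \<phi> n J ys \<longleftrightarrow> system_of_parameters \<phi> n ys \<and>
       fst J = weight_filtration (take (length (invariant \<phi> n J)) ys) ws" for ys
      by (simp add: compatible_system_def W inv)
  qed (rule d)
qed

lemma compatible_system_system: "compatible_system \<phi> n J ys \<Longrightarrow> system_of_parameters \<phi> n ys"
  by (simp add: compatible_system_def)

lemma compatible_weighted_ideal:
  assumes J: "marked_centre \<phi> n J" and X: "compatible_system \<phi> n J X" and Y: "compatible_system \<phi> n J Y"
  shows "weighted_ideal X (exponent_weight (invariant \<phi> n J)) t = weighted_ideal Y (exponent_weight (invariant \<phi> n J)) t"
proof -
  note sX = compatible_system_system[OF X] and sY = compatible_system_system[OF Y]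
  obtain ws where ws: "map of_nat ws = map (\<lambda>a. of_nat (snd J) / a) (invariant \<phi> n J)" "0 < snd J"
    "pre_invariant n (invariant \<phi> n J)"
    "\<And>ys. compatible_system \<phi> n J ys \<longleftrightarrow> system_of_parameters \<phi> n ys \<and>
       fst J = weight_filtration (take (length (invariant \<phi> n J)) ys) ws"
    using marked_centre_data[OF sX J] by blast
  have "length (invariant \<phi> n J) \<le> n" using ws(3) by (simp add: pre_invariant_def)
  then show ?thesis
    using weighted_ideal_filtration[OF _ ws(2,1), of X t] weighted_ideal_filtration[OF _ ws(2,1), of Y t]
      system_length[OF sX] system_length[OF sY] ws(4)[of X] ws(4)[of Y] X Y by simp
qed

lemma admissible_iff:
  assumes J: "marked_centre \<phi> n J" and X: "compatible_system \<phi> n J X"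
  shows "admissible I J \<longleftrightarrow> I \<subseteq> weighted_ideal X (exponent_weight (invariant \<phi> n J)) 1"
proof -
  note sX = compatible_system_system[OF X]
  obtain ws where ws: "map of_nat ws = map (\<lambda>a. of_nat (snd J) / a) (invariant \<phi> n J)" "0 < snd J"
    "pre_invariant n (invariant \<phi> n J)"
    "\<And>ys. compatible_system \<phi> n J ys \<longleftrightarrow> system_of_parameters \<phi> n ys \<and>
       fst J = weight_filtration (take (length (invariant \<phi> n J)) ys) ws"
    using marked_centre_data[OF sX J] by blast
  have "length (invariant \<phi> n J) \<le> length X" using ws(3) system_length[OF sX] by (simp add: pre_invariant_def)
  from weighted_ideal_filtration[OF this ws(2,1), of 1] show ?thesis
    using ws(4)[of X] X by (simp add: admissible_def)
qed

lemma compatible_systemI: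
  assumes J: "marked_centre \<phi> n J" and X: "compatible_system \<phi> n J X" and Y: "system_of_parameters \<phi> n Y"
    and eq: "\<And>t. weighted_ideal Y (exponent_weight (invariant \<phi> n J)) t = weighted_ideal X (exponent_weight (invariant \<phi> n J)) t"
  shows "compatible_system \<phi> n J Y"
proof -
  note sX = compatible_system_system[OF X]
  obtain ws where ws: "map of_nat ws = map (\<lambda>a. of_nat (snd J) / a) (invariant \<phi> n J)" "0 < snd J"
    "pre_invariant n (invariant \<phi> n J)"
    "\<And>ys. compatible_system \<phi> n J ys \<longleftrightarrow> system_of_parameters \<phi> n ys \<and>
       fst J = weight_filtration (take (length (invariant \<phi> n J)) ys) ws"
    using marked_centre_data[OF sX J] by blast
  have len: "length (invariant \<phi> n J) \<le> length X" "length (invariant \<phi> n J) \<le> length Y"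
    using ws(3) system_length[OF sX] system_length[OF Y] by (simp_all add: pre_invariant_def)
  have "weight_filtration (take (length (invariant \<phi> n J)) X) ws i
      = weight_filtration (take (length (invariant \<phi> n J)) Y) ws i" for i
    using weighted_ideal_filtration[OF len(1) ws(2,1), of "of_nat i / of_nat (snd J)"]
      weighted_ideal_filtration[OF len(2) ws(2,1), of "of_nat i / of_nat (snd J)"] eq ws(2) by simp
  then show ?thesis using ws(4)[of X] ws(4)[of Y] X Y by auto
qed

lemma centre_of_data:
  assumes X: "system_of_parameters \<phi> n X" and C: "centre_of \<phi> ps as J" and n: "length as \<le> n"
  shows "marked_centre \<phi> n J" "invariant \<phi> n J = as"
    and "\<And>Y. system_of_parameters \<phi> n Y \<Longrightarrow> take (length as) Y = ps \<Longrightarrow> compatible_system \<phi> n J Y"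
proof -
  obtain ws m where J: "J = (weight_filtration ps ws, m)" and m: "0 < m" and cw: "coprime_weights ws"
    and ws: "map of_nat ws = map (\<lambda>a. of_nat m / a) as"
    and ps: "parameters \<phi> ps" "length as = length ps" "sorted as" and pos: "\<And>a. a \<in> set as \<Longrightarrow> 0 < a"
    using C by (auto simp: centre_of_def)
  have len: "length ws = length as" using ws by (metis length_map)
  have nth: "(of_nat (ws ! i) :: rat) = of_nat m / as ! i" if "i < length as" for i
    using arg_cong[OF ws, of "\<lambda>xs. xs ! i"] that len by simp
  have wpos: "0 < ws ! i" if "i < length as" for i
  proof -
    have "0 < (of_nat (ws ! i) :: rat)" unfolding nth[OF that] using m pos that by simp
    then show ?thesis by simp
  qed
  have "weighting \<phi> n (fst J) ws"
    unfolding weighting_def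
  proof (intro conjI ballI)
    show "length ws \<le> n" using len n by simp
    show "sorted_wrt (\<ge>) ws"
      unfolding sorted_wrt_iff_nth_less
    proof (intro allI impI)
      fix i l assume il: "i < l" "l < length ws"
      then have "as ! i \<le> as ! l" "0 < as ! i" using ps(3) len pos by (auto simp: sorted_iff_nth_mono)
      then have "(of_nat (ws ! l) :: rat) \<le> of_nat (ws ! i)"
        using nth[of i] nth[of l] il len by (simp add: frac_le)
      then show "ws ! l \<le> ws ! i" by simp
    qed
    show "0 < w" if "w \<in> set ws" for w using that wpos len by (metis in_set_conv_nth)
    show "\<exists>xs. parameters \<phi> xs \<and> length xs = length ws \<and> fst J = weight_filtration xs ws"
      using ps len J by (intro exI[of _ ps]) simp
  qed
  note W = this weights_eq[OF X this]
  show "marked_centre \<phi> n J" using W(1) cw m J by (auto simp: marked_centre_def)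
  show "invariant \<phi> n J = as"
    unfolding invariant_def W(2) by (rule nth_equalityI) (use len nth m pos J in auto)
  show "compatible_system \<phi> n J Y" if "system_of_parameters \<phi> n Y" "take (length as) Y = ps" for Y
    using that W(2) J len by (simp add: compatible_system_def)
qed

lemma centre_of_exists:
  assumes "parameters \<phi> ps" "length as = length ps" "sorted as" "\<And>a. a \<in> set as \<Longrightarrow> 0 < a" "as \<noteq> []"
    and one: "(\<Sum>i<length as. of_nat (z i) / as ! i) = 1"
  shows "\<exists>J. centre_of \<phi> ps as J"
proof -
  obtain m ws where "0 < m" "coprime_weights ws" "map of_nat ws = map (\<lambda>a. of_nat m / a) as"
    using coprime_weights_exist[OF assms(4,5) one] by blast
  then show ?thesis using assms unfolding centre_of_def by blast
qed

text \<open>For \<open>l < length as\<close>, the parameter \<open>Y ! l\<close> has weight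
  \<open>1 / as ! l\<close> in the filtration common to \<open>X\<close> and \<open>Y\<close>, where
  the \<open>i\<close>-th derivative costs \<open>exponent_weight as i\<close>, so nothing for
  \<open>i \<ge> length as\<close>. The other parameters of \<open>Y\<close> have weight at most
  \<open>1 / bs ! length as\<close>, and every \<open>?c i\<close> is at least that large, so no
  condition remains for them.\<close>

lemma dominating_drop:
  assumes X: "system_of_parameters \<phi> n X" and Y: "system_of_parameters \<phi> n Y"
    and bs: "prefix as bs" "length as < length bs" "pre_invariant n bs"
    and eq: "\<And>t. weighted_ideal X (exponent_weight as) t = weighted_ideal Y (exponent_weight as) t"
    and a: "a \<in> weighted_ideal Y (exponent_weight bs) t"
  shows "multi_deriv \<phi> X \<beta> a \<in> weighted_ideal Y (exponent_weight bs)
    (t - (weighted_degree as \<beta> + of_nat (\<Sum>i=length as..<n. \<beta> i) / bs ! length as))"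
proof -
  let ?j = "length as" and ?b = "bs ! length as"
  let ?c = "exponent_weight (as @ replicate (n - ?j) ?b)"
  have jn: "?j < n" and sorted: "sorted bs" and pos: "\<And>a. a \<in> set bs \<Longrightarrow> 0 < a"
    using bs by (auto simp: pre_invariant_def)
  have apos: "\<And>a. a \<in> set as \<Longrightarrow> 0 < a" using bs(1) pos by (auto simp: prefix_def)
  have bpos: "0 < ?b" using bs(2) pos by simp
  have b: "1 / ?b \<le> ?c i" if "i < n" for i
  proof (cases "i < ?j")
    case True
    have "as ! i = bs ! i" using bs(1) True by (auto simp: prefix_def nth_append)
    moreover have "bs ! i \<le> ?b" using sorted True bs(2) by (simp add: sorted_iff_nth_mono)
    moreover have "0 < as ! i" using True apos by simp
    ultimately show ?thesis using True by (simp add: exponent_weight_def nth_append frac_le)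
  next
    case False
    then show ?thesis using that by (simp add: exponent_weight_def nth_append)
  qed
  have ac: "exponent_weight as i \<le> ?c i" if "i < n" for i
    using b[OF that] bpos by (cases "i < ?j") (auto simp: exponent_weight_def nth_append intro: order.trans[rotated])
  have drop: "partial_deriv \<phi> X i a \<in> weighted_ideal Y (exponent_weight bs) (t - ?c i)"
    if i: "i < n" and a: "a \<in> weighted_ideal Y (exponent_weight bs) t" for i t a
  proof (rule derivation_weighted_ideal[OF partial_derivation[OF X i] _ _ a])
    show "0 \<le> ?c i" using b[OF i] bpos by (meson order.trans zero_le_divide_1_iff less_imp_le)
    fix l assume "l < length Y"
    show "partial_deriv \<phi> X i (Y ! l) \<in> weighted_ideal Y (exponent_weight bs) (exponent_weight bs l - ?c i)"
    proof (cases "l < ?j")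
      case True
      have "Y ! l \<in> weighted_ideal X (exponent_weight as) (exponent_weight as l)"
        unfolding eq by (rule weighted_ideal_nth) fact
      then have "partial_deriv \<phi> X i (Y ! l) \<in> weighted_ideal X (exponent_weight as) (exponent_weight as l - exponent_weight as i)"
        using partial_weighted_ideal[where w = "exponent_weight as", OF X exponent_weight_nonneg[OF apos] i]
        by blast
      then have "partial_deriv \<phi> X i (Y ! l) \<in> weighted_ideal Y (exponent_weight bs) (exponent_weight as l - exponent_weight as i)"
        unfolding eq
        using weighted_ideal_mono_weight[of Y "exponent_weight as" "exponent_weight bs"]
          exponent_weight_prefix_le[OF bs(1) pos] by blast
      then show ?thesis
        using weighted_ideal_antimono[of "exponent_weight bs l - ?c i" "exponent_weight as l - exponent_weight as i"]
          exponent_weight_prefix[OF bs(1) True] ac[OF i] by auto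
    next
      case False
      then have "exponent_weight bs l \<le> 1 / ?b"
        by (intro exponent_weight_sorted_le[OF sorted pos bs(2)]) auto
      then show ?thesis using b[OF i] by (intro weighted_ideal_nonpos) simp
    qed
  qed
  have "multi_deriv \<phi> X \<beta> a \<in> weighted_ideal Y (exponent_weight bs) (t - multi_weight n ?c \<beta>)"
    by (rule multi_deriv_drop[OF X, where c = ?c]) (use drop a in auto)
  then show ?thesis using multi_weight_replicate[of as n ?b \<beta>] jn by simp
qed

text \<open>In a local ring a set generates the unit ideal only if one of its elements is a
  unit.\<close>

lemma deriv_ideal_UNIV_iff: "deriv_ideal \<phi> X \<beta> I = UNIV \<longleftrightarrow> (\<exists>f\<in>I. multi_deriv \<phi> X \<beta> f \<notin> max_ideal)"
proof
  assume U: "deriv_ideal \<phi> X \<beta> I = UNIV"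
  show "\<exists>f\<in>I. multi_deriv \<phi> X \<beta> f \<notin> max_ideal"
  proof (rule ccontr)
    assume "\<not> ?thesis"
    then have "ideal.span (multi_deriv \<phi> X \<beta> ` I) \<subseteq> max_ideal"
      by (intro ideal.span_minimal[OF _ loc]) auto
    then show False using U max_simps(2) by (auto simp: deriv_ideal_def)
  qed
next
  assume "\<exists>f\<in>I. multi_deriv \<phi> X \<beta> f \<notin> max_ideal"
  then obtain f where f: "f \<in> I" "multi_deriv \<phi> X \<beta> f \<notin> max_ideal" by blast
  have s: "ideal.subspace (deriv_ideal \<phi> X \<beta> I)" by (simp add: deriv_ideal_def)
  have "multi_deriv \<phi> X \<beta> f * 1 \<in> deriv_ideal \<phi> X \<beta> I"
    unfolding deriv_ideal_def by (intro ideal.span_base) (use f in auto)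
  then have "multi_deriv \<phi> X \<beta> f * r \<in> deriv_ideal \<phi> X \<beta> I" for r
    using ideal_mult1[OF s] by simp
  then have "r \<in> deriv_ideal \<phi> X \<beta> I" for r
    using subspace_unit_cancel[OF loc s f(2)] by blast
  then show "deriv_ideal \<phi> X \<beta> I = UNIV" by auto
qed

text \<open>For \<open>l < length as \<le> i\<close> the derivative of \<open>X ! l\<close> along
  \<open>Y ! i\<close> has weight \<open>1 / as ! l\<close>, hence vanishes at the point, and the
  Jacobian matrix is block triangular. So a centre whose exponents extend \<open>as\<close> can be
  described by parameters beginning with those of \<open>X\<close>.\<close>

lemma splice_system:
  assumes X: "system_of_parameters \<phi> n X" and Y: "system_of_parameters \<phi> n Y"
    and apos: "\<And>a. a \<in> set as \<Longrightarrow> 0 < a" and jn: "length as \<le> n"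
    and eq: "\<And>t. weighted_ideal X (exponent_weight as) t = weighted_ideal Y (exponent_weight as) t"
  shows "system_of_parameters \<phi> n (take (length as) X @ drop (length as) Y)"
    and "\<And>bs t. prefix as bs \<Longrightarrow> (\<And>a. a \<in> set bs \<Longrightarrow> 0 < a) \<Longrightarrow>
      weighted_ideal (take (length as) X @ drop (length as) Y) (exponent_weight bs) t
      = weighted_ideal Y (exponent_weight bs) t"
proof -
  let ?j = "length as" and ?U = "take (length as) X @ drop (length as) Y"
  note lX = system_length[OF X] and lY = system_length[OF Y]
  have lU: "length ?U = n" using lX lY jn by simp
  have nth: "?U ! l = (if l < ?j then X ! l else Y ! l)" if "l < n" for l
    using that lX lY jn by (auto simp: nth_append min_def)
  show "system_of_parameters \<phi> n ?U"
    unfolding system_iff[OF Y]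
  proof (intro conjI allI impI)
    show "length ?U = n" by (rule lU)
    show "set ?U \<subseteq> max_ideal"
      using system_set[OF X] system_set[OF Y] set_take_subset[of ?j X] set_drop_subset[of ?j Y] by auto
  next
    fix c l assume c: "\<forall>i<n. (\<Sum>l<n. c l * partial_deriv \<phi> Y i (?U ! l)) \<in> max_ideal" and l: "l < n"
    have "{..<n} = {..<?j} \<union> {?j..<n}" using jn by auto
    then have split: "(\<Sum>l<n. c l * partial_deriv \<phi> Y i (?U ! l))
        = (\<Sum>l<?j. c l * partial_deriv \<phi> Y i (X ! l)) + (if ?j \<le> i then c i else 0)" if i: "i < n" for i
    proof -
      have "(\<Sum>l<n. c l * partial_deriv \<phi> Y i (?U ! l)) = (\<Sum>l<?j. c l * partial_deriv \<phi> Y i (?U ! l))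
          + (\<Sum>l=?j..<n. c l * partial_deriv \<phi> Y i (?U ! l))"
        unfolding \<open>{..<n} = _\<close> by (simp add: sum.union_disjoint ivl_disj_int)
      also have "(\<Sum>l<?j. c l * partial_deriv \<phi> Y i (?U ! l)) = (\<Sum>l<?j. c l * partial_deriv \<phi> Y i (X ! l))"
        by (rule sum.cong) (use nth jn in auto)
      also have "(\<Sum>l=?j..<n. c l * partial_deriv \<phi> Y i (?U ! l)) = (\<Sum>l=?j..<n. if l = i then c l else 0)"
        by (rule sum.cong) (use nth partial_param[OF Y i] in auto)
      finally show ?thesis using i by simp
    qed
    \<comment> \<open>Because of the zero block, the rows from \<open>?j\<close> on isolate the
      coefficients of the parameters taken from \<open>Y\<close>. What remains is a relation among
      the parameters of \<open>X\<close>.\<close>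
    have high: "c i \<in> max_ideal" if i: "?j \<le> i" "i < n" for i
    proof -
      have 1: "(\<Sum>l<?j. c l * partial_deriv \<phi> Y i (X ! l)) \<in> max_ideal"
      proof (rule ideal.subspace_sum[OF loc], rule max_simps(6))
        fix l assume l: "l \<in> {..<?j}"
        have "X ! l \<in> weighted_ideal Y (exponent_weight as) (exponent_weight as l)"
          unfolding eq[symmetric] by (rule weighted_ideal_nth) (use l lX jn in auto)
        then have "partial_deriv \<phi> Y i (X ! l) \<in> weighted_ideal Y (exponent_weight as) (exponent_weight as l - exponent_weight as i)"
          using partial_weighted_ideal[where w = "exponent_weight as", OF Y exponent_weight_nonneg[OF apos] i(2)]
          by blast
        moreover have "0 < exponent_weight as l - exponent_weight as i"
          using l i apos by (simp add: exponent_weight_def)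
        ultimately show "partial_deriv \<phi> Y i (X ! l) \<in> max_ideal"
          using weighted_ideal_pos_max[OF loc system_set[OF Y]] by blast
      qed
      have "(\<Sum>l<?j. c l * partial_deriv \<phi> Y i (X ! l)) + c i \<in> max_ideal"
        using c split[OF i(2)] i by auto
      from max_simps(4)[OF this 1] show ?thesis by simp
    qed
    define c' where "c' l = (if l < ?j then c l else 0)" for l
    have "(\<Sum>l<n. c' l * partial_deriv \<phi> Y i (X ! l)) \<in> max_ideal" if i: "i < n" for i
    proof -
      have "(\<Sum>l<n. c' l * partial_deriv \<phi> Y i (X ! l)) = (\<Sum>l<?j. c l * partial_deriv \<phi> Y i (X ! l))"
        by (rule sum.mono_neutral_cong_right) (use jn in \<open>auto simp: c'_def\<close>)
      moreover have "(\<Sum>l<?j. c l * partial_deriv \<phi> Y i (X ! l)) \<in> max_ideal"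
        using c split[OF i] max_simps(4)[of "(\<Sum>l<?j. c l * partial_deriv \<phi> Y i (X ! l)) + c i" "c i"]
          high[of i] i by (cases "?j \<le> i") auto
      ultimately show ?thesis by simp
    qed
    then have "\<forall>l<n. c' l \<in> max_ideal" using X unfolding system_iff[OF Y] by blast
    then show "c l \<in> max_ideal" using high l by (cases "l < ?j") (auto simp: c'_def)
  qed
  fix bs t assume bs: "prefix as bs" and pos: "\<And>a. a \<in> set bs \<Longrightarrow> 0 < a"
  let ?a = "exponent_weight as" and ?b = "exponent_weight bs"
  have ab: "weighted_ideal Z ?a s \<subseteq> weighted_ideal Z ?b s" for Z :: "'a list" and s
    by (rule weighted_ideal_mono_weight) (rule exponent_weight_prefix_le[OF bs pos])
  show "weighted_ideal ?U ?b t = weighted_ideal Y ?b t"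
  proof (intro equalityI weighted_ideal_leI)
    fix l assume "l < length ?U"
    then have l: "l < n" using lU by simp
    show "?U ! l \<in> weighted_ideal Y ?b (?b l)"
    proof (cases "l < ?j")
      case True
      have "X ! l \<in> weighted_ideal Y ?a (?a l)"
        unfolding eq[symmetric] by (rule weighted_ideal_nth) (use l lX in simp)
      then show ?thesis using ab exponent_weight_prefix[OF bs True] nth[OF l] True by auto
    next
      case False
      then show ?thesis using nth[OF l] weighted_ideal_nth[of l Y ?b] l lY by simp
    qed
  next
    fix l assume "l < length Y"
    then have l: "l < n" using lY by simp
    show "Y ! l \<in> weighted_ideal ?U ?b (?b l)"
    proof (cases "l < ?j")
      case True
      \<comment> \<open>With the weights of \<open>as\<close> only the first \<open>?j\<close>
        parameters count, and these are shared by \<open>X\<close> and \<open>?U\<close>.\<close>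
      have "weighted_ideal X ?a s \<subseteq> weighted_ideal ?U ?a s" for s
      proof (rule weighted_ideal_leI)
        fix r assume "r < length X"
        then have r: "r < n" using lX by simp
        show "X ! r \<in> weighted_ideal ?U ?a (?a r)"
          using weighted_ideal_nth[of r ?U ?a] nth[OF r] lU r
          by (cases "r < ?j") (auto simp: weighted_ideal_nonpos exponent_weight_def)
      qed (simp only: lX lU)
      moreover have "Y ! l \<in> weighted_ideal X ?a (?a l)"
        unfolding eq by (rule weighted_ideal_nth) (use l lY in simp)
      ultimately have "Y ! l \<in> weighted_ideal ?U ?b (?a l)" using ab[of ?U "?a l"] by blast
      then show ?thesis using exponent_weight_prefix[OF bs True] by simp
    next
      case False
      then show ?thesis using nth[OF l] weighted_ideal_nth[of l ?U ?b] l lU by simp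
    qed
  qed (simp_all only: lU lY)
qed

end

section \<open>The next semi-associated centre\<close>

text \<open>The denominator \<open>1 - weighted_degree as \<beta>\<close> is a fraction
  \<open>(m - p) / m\<close> with \<open>0 < m - p \<le> m\<close>. Hence \<open>fact m\<close>
  clears the denominators of all values at once, and a least natural number exists.\<close>

lemma Xi_argmin_exists:
  assumes ne: "S \<noteq> {}" and deg: "\<And>\<beta>. \<beta> \<in> S \<Longrightarrow> weighted_degree as \<beta> < 1"
    and m: "0 < m" and ws: "map of_nat ws = map (\<lambda>a. of_nat m / a) as"
  shows "\<exists>\<beta>. is_arg_min (\<Xi> n as) (\<lambda>\<gamma>. \<gamma> \<in> S) \<beta>"
proof -
  have len: "length ws = length as" using ws by (metis length_map)
  have int: "\<exists>k::nat. of_nat (fact m) * \<Xi> n as \<beta> = of_nat k" if b: "\<beta> \<in> S" for \<beta>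
  proof -
    define p where "p = (\<Sum>i<length as. \<beta> i * ws ! i)"
    have "of_nat (\<beta> i) / as ! i = of_nat (\<beta> i * ws ! i) / of_nat m" if "i < length as" for i
    proof -
      have "(of_nat (ws ! i) :: rat) = of_nat m / as ! i"
        using arg_cong[OF ws, of "\<lambda>xs. xs ! i"] that len by simp
      then show ?thesis using m by simp
    qed
    then have wd: "weighted_degree as \<beta> = of_nat p / of_nat m"
      by (simp add: weighted_degree_def p_def sum_divide_distrib)
    then have pm: "p < m" using deg[OF b] m by simp
    then have "m - p dvd fact m" by (intro dvd_fact) auto
    then obtain e where e: "fact m = (m - p) * e" by (auto elim: dvdE)
    have "1 - weighted_degree as \<beta> = of_nat (m - p) / of_nat m"
      using wd pm m by (simp add: of_nat_diff field_simps)
    then have "\<Xi> n as \<beta> = of_nat ((\<Sum>i=length as..<n. \<beta> i) * m) / of_nat (m - p)"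
      by (simp add: \<Xi>_def)
    then have "of_nat (fact m) * \<Xi> n as \<beta> = of_nat ((\<Sum>i=length as..<n. \<beta> i) * m * e)"
      using pm unfolding e by simp
    then show ?thesis by blast
  qed
  then obtain k where k: "\<And>\<beta>. \<beta> \<in> S \<Longrightarrow> of_nat (fact m) * \<Xi> n as \<beta> = of_nat (k \<beta>)" by metis
  obtain \<beta>0 where "\<beta>0 \<in> S" using ne by auto
  then obtain \<beta> where b: "\<beta> \<in> S" "\<And>\<gamma>. \<gamma> \<in> S \<Longrightarrow> k \<beta> \<le> k \<gamma>"
    using ex_has_least_nat[of "\<lambda>\<gamma>. \<gamma> \<in> S" \<beta>0 k] by auto
  have "\<Xi> n as \<beta> \<le> \<Xi> n as \<gamma>" if "\<gamma> \<in> S" for \<gamma>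
  proof -
    have "of_nat (fact m) * \<Xi> n as \<beta> \<le> of_nat (fact m) * \<Xi> n as \<gamma>"
      unfolding k[OF b(1)] k[OF that] using b(2)[OF that] by simp
    then show ?thesis by (rule mult_left_le_imp_le) simp
  qed
  then show ?thesis using b(1) by (auto simp: is_arg_min_linorder)
qed

text \<open>Lists of equal length that differ are compared before the padding begins, so the
  appended entry matters only when they agree.\<close>

lemma pre_invariant_le_snoc:
  assumes len: "length us = length as" "length as < n"
    and le: "pre_invariant_le n us as" and eq: "us = as \<Longrightarrow> u \<le> a"
  shows "pre_invariant_le n (us @ [u]) (as @ [a])"
proof (cases "us = as")
  case True
  then have "Fin u \<le> Fin a" using eq by simp
  then have "Fin u # replicate (n - Suc (length as)) Pinf \<le> Fin a # replicate (n - Suc (length as)) Pinf"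
    by (auto simp: le_less)
  then show ?thesis
    using True list_append_le_append[of "Fin u # replicate (n - Suc (length as)) Pinf" _ "map Fin as"]
    by (simp add: pre_invariant_le_def pad_def)
next
  case False
  then have "map Fin us \<noteq> map Fin as" by (auto simp: inj_map_eq_map inj_def)
  with le show ?thesis
    using list_le_append[of "map Fin us" "map Fin as"] len
    by (simp add: pre_invariant_le_def pad_def)
qed

context smooth_local_algebra
begin

lemma next_semi_associated:
  assumes X: "system_of_parameters \<phi> n X" and jn: "length as \<le> n"
    and C: "centre_of \<phi> (take (length as) X) as J"
    and assoc: "semi_associated \<phi> n I (length as) J"
    and nadm: "\<not> admissible I J"
  shows "\<exists>\<beta>. is_arg_min (\<Xi> n as) (\<lambda>\<gamma>. \<gamma> \<in> S_set \<phi> X I as) \<beta>"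
    and "\<And>\<beta> l f. is_arg_min (\<Xi> n as) (\<lambda>\<gamma>. \<gamma> \<in> S_set \<phi> X I as) \<beta> \<Longrightarrow>
      length as \<le> l \<Longrightarrow> l < n \<Longrightarrow> 0 < \<beta> l \<Longrightarrow> f \<in> I \<Longrightarrow> multi_deriv \<phi> X \<beta> f \<notin> max_ideal \<Longrightarrow>
      \<exists>J'. centre_of \<phi> (take (length as) X @ [multi_deriv \<phi> X (\<beta>(l := \<beta> l - 1)) f])
             (as @ [\<Xi> n as \<beta>]) J' \<and> semi_associated \<phi> n I (Suc (length as)) J'"
proof -
  define j where "j = length as"
  note lX = system_length[OF X] and mX = system_set[OF X]
  note J = centre_of_data[OF X C jn]
  have JX: "compatible_system \<phi> n J X" by (rule J(3)[OF X refl])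
  have apos: "\<And>a. a \<in> set as \<Longrightarrow> 0 < a" and asort: "sorted as" and par: "parameters \<phi> (take j X)"
    using C by (auto simp: centre_of_def j_def)
  have nle: "\<not> I \<subseteq> weighted_ideal X (exponent_weight as) 1"
    using nadm admissible_iff[OF J(1) JX] J(2) by simp
  have S_iff: "\<beta> \<in> S_set \<phi> X I as \<longleftrightarrow> (\<forall>i\<ge>n. \<beta> i = 0) \<and> weighted_degree as \<beta> < 1
      \<and> (\<exists>f\<in>I. multi_deriv \<phi> X \<beta> f \<notin> max_ideal)" for \<beta>
    by (simp add: S_set_def lX deriv_ideal_UNIV_iff)

  \<comment> \<open>The invariant of \<open>J'\<close> is strictly longer than \<open>as\<close>: if
    they were equal, the common compatible system would make \<open>J\<close> admissible
    too.\<close>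
  have dom: "\<exists>Y. system_of_parameters \<phi> n Y \<and> compatible_system \<phi> n J' Y
      \<and> (\<forall>t. weighted_ideal X (exponent_weight as) t = weighted_ideal Y (exponent_weight as) t)
      \<and> I \<subseteq> weighted_ideal Y (exponent_weight (invariant \<phi> n J')) 1
      \<and> pre_invariant n (invariant \<phi> n J') \<and> j < length (invariant \<phi> n J')"
    if J': "marked_centre \<phi> n J'" "admissible I J'" "prefix as (invariant \<phi> n J')" for J'
  proof -
    have "centre_dominates \<phi> n J' J"
      using assoc J' unfolding semi_associated_def J(2) by blast
    then obtain Y where Y: "compatible_system \<phi> n J Y" "compatible_system \<phi> n J' Y"
      by (auto simp: centre_dominates_def)
    note sY = compatible_system_system[OF Y(1)]
    have eq: "weighted_ideal X (exponent_weight as) t = weighted_ideal Y (exponent_weight as) t" for t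
      using compatible_weighted_ideal[OF J(1) JX Y(1), of t] J(2) by simp
    have I: "I \<subseteq> weighted_ideal Y (exponent_weight (invariant \<phi> n J')) 1"
      using J'(2) admissible_iff[OF J'(1) Y(2)] by simp
    have "invariant \<phi> n J' \<noteq> as" using I nle eq by auto
    then have "j < length (invariant \<phi> n J')"
      using J'(3) by (auto simp: prefix_def j_def)
    moreover have "pre_invariant n (invariant \<phi> n J')" using marked_centre_data[OF X J'(1)] by blast
    ultimately show ?thesis using sY Y(2) eq I by blast
  qed

  have upper: "invariant \<phi> n J' ! j \<le> \<Xi> n as \<beta>"
    if J': "marked_centre \<phi> n J'" "admissible I J'" "prefix as (invariant \<phi> n J')"
      and \<beta>: "\<beta> \<in> S_set \<phi> X I as" for J' \<beta>
  proof -
    let ?bs = "invariant \<phi> n J'"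
    obtain Y where Y: "system_of_parameters \<phi> n Y"
      "\<And>t. weighted_ideal X (exponent_weight as) t = weighted_ideal Y (exponent_weight as) t"
      "I \<subseteq> weighted_ideal Y (exponent_weight ?bs) 1" "pre_invariant n ?bs" "j < length ?bs"
      using dom[OF J'] by blast
    obtain f where f: "f \<in> I" "multi_deriv \<phi> X \<beta> f \<notin> max_ideal" and wd: "weighted_degree as \<beta> < 1"
      using \<beta> S_iff by blast
    let ?N = "of_nat (\<Sum>i=length as..<n. \<beta> i) :: rat"
    have "multi_deriv \<phi> X \<beta> f \<in> weighted_ideal Y (exponent_weight ?bs)
        (1 - (weighted_degree as \<beta> + ?N / ?bs ! length as))"
      by (rule dominating_drop[OF X Y(1) J'(3) _ Y(4,2)]) (use Y f in \<open>auto simp: j_def\<close>)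
    then have "\<not> 0 < 1 - (weighted_degree as \<beta> + ?N / ?bs ! length as)"
      using f(2) weighted_ideal_pos_max[OF loc system_set[OF Y(1)]] by blast
    then have "1 - weighted_degree as \<beta> \<le> ?N / ?bs ! j" by (simp add: j_def)
    moreover have "0 < ?bs ! j" using Y(4,5) by (simp add: pre_invariant_def)
    ultimately show ?thesis using wd by (simp add: \<Xi>_def field_simps)
  qed

  \<comment> \<open>If every derivative of weight below one vanished at the point,
    \<open>weighted_ideal_criterion\<close> would make \<open>J\<close> admissible.\<close>
  have S_ne: "S_set \<phi> X I as \<noteq> {}"
  proof
    assume e: "S_set \<phi> X I as = {}"
    have "I \<subseteq> weighted_ideal X (exponent_weight as) 1"
    proof
      fix f assume f: "f \<in> I"
      show "f \<in> weighted_ideal X (exponent_weight as) 1"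
      proof (rule weighted_ideal_criterion[OF X exponent_weight_nonneg[OF apos]])
        fix \<beta> assume b: "\<And>i. n \<le> i \<Longrightarrow> \<beta> i = 0" "multi_weight n (exponent_weight as) \<beta> < 1"
        have "multi_weight n (exponent_weight as) \<beta> = (\<Sum>i<length as. of_nat (\<beta> i) * exponent_weight as i)"
          unfolding multi_weight_def
          by (rule sum.mono_neutral_right) (use jn in \<open>auto simp: exponent_weight_def\<close>)
        also have "\<dots> = weighted_degree as \<beta>"
          unfolding weighted_degree_def by (rule sum.cong) (auto simp: exponent_weight_def)
        finally have "weighted_degree as \<beta> < 1" using b(2) by simp
        then show "multi_deriv \<phi> X \<beta> f \<in> max_ideal" using b(1) f e S_iff[of \<beta>] by blast
      qed
    qed
    then show False using nle by simp
  qed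

  show "\<exists>\<beta>. is_arg_min (\<Xi> n as) (\<lambda>\<gamma>. \<gamma> \<in> S_set \<phi> X I as) \<beta>"
  proof -
    obtain m ws where m: "0 < (m::nat)" "map of_nat ws = map (\<lambda>a. of_nat m / a) as"
      using C by (auto simp: centre_of_def)
    show ?thesis by (rule Xi_argmin_exists[OF S_ne _ m]) (simp add: S_iff)
  qed

  fix \<beta> l f
  assume min: "is_arg_min (\<Xi> n as) (\<lambda>\<gamma>. \<gamma> \<in> S_set \<phi> X I as) \<beta>"
    and l: "length as \<le> l" "l < n" "0 < \<beta> l" and f: "f \<in> I" "multi_deriv \<phi> X \<beta> f \<notin> max_ideal"
  define a where "a = \<Xi> n as \<beta>"
  define g where "g = multi_deriv \<phi> X (\<beta>(l := \<beta> l - 1)) f"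
  let ?N = "\<Sum>i=length as..<n. \<beta> i"
  have \<beta>: "\<beta> \<in> S_set \<phi> X I as" and least: "\<And>\<gamma>. \<gamma> \<in> S_set \<phi> X I as \<Longrightarrow> a \<le> \<Xi> n as \<gamma>"
    using min by (auto simp: is_arg_min_linorder a_def)
  have wd: "weighted_degree as \<beta> < 1" using \<beta> S_iff by blast
  have "j < n" using l by (simp add: j_def)
  have N: "0 < ?N" using l by (intro sum_pos2[of _ l]) auto
  have Nr: "(0 :: rat) < of_nat ?N" using N by (simp only: of_nat_0_less_iff)
  \<comment> \<open>Taken with \<open>s = 1 - weighted_degree as \<beta>\<close>, this turns the
    definition of \<open>a\<close> into \<open>aN\<close>: with exponent \<open>a\<close> in all
    remaining variables, \<beta> has weight exactly one.\<close>
  have "r / (r / s) = s" if "0 < r" for r s :: rat using that by simp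
  from this[OF Nr] have aN: "weighted_degree as \<beta> + of_nat ?N / a = 1"
    unfolding a_def \<Xi>_def by (simp only: add_diff_cancel_left' diff_add_cancel add.commute)
  from Nr have ap: "0 < a" unfolding a_def \<Xi>_def by (rule divide_pos_pos) (use wd in simp)
  have dg: "partial_deriv \<phi> X l g \<notin> max_ideal"
  proof -
    have "multi_deriv \<phi> X ((\<beta>(l := \<beta> l - 1))(l := Suc ((\<beta>(l := \<beta> l - 1)) l))) f = partial_deriv \<phi> X l g"
      unfolding g_def by (rule multi_deriv_Suc[OF X l(2)])
    moreover have "(\<beta>(l := \<beta> l - 1))(l := Suc ((\<beta>(l := \<beta> l - 1)) l)) = \<beta>" using l(3) by auto
    ultimately show ?thesis using f(2) by simp
  qed
  \<comment> \<open>The next exponent of an admissible centre dominating \<open>J\<close> lies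
    between the last entry of \<open>as\<close> and \<open>a\<close>.\<close>
  have sort: "sorted (as @ [a])"
  proof -
    obtain bs where bs: "admissible_invariant \<phi> n I bs" "prefix as bs"
      using assoc J(2) by (auto simp: semi_associated_def semi_admissible_def)
    then obtain J' where J': "marked_centre \<phi> n J'" "admissible I J'" "invariant \<phi> n J' = bs"
      by (auto simp: admissible_invariant_def)
    then have len: "j < length bs" "sorted bs" using dom[of J'] bs by (auto simp: pre_invariant_def)
    have b: "bs ! j \<le> a" using upper[of J'] J' bs \<beta> by (simp add: a_def)
    have "x \<le> a" if x: "x \<in> set as" for x
    proof -
      obtain i where i: "i < j" "x = as ! i" using x by (auto simp: in_set_conv_nth j_def)
      have "x = bs ! i" using i bs(2) by (auto simp: prefix_def nth_append j_def)
      also have "\<dots> \<le> bs ! j" using len i by (simp add: sorted_iff_nth_mono)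
      finally show ?thesis using b by simp
    qed
    then show ?thesis using asort by (simp add: sorted_append)
  qed

  define cs where "cs = as @ replicate (n - j) a"
  have cs: "length cs = n" "sorted cs" "\<And>x. x \<in> set cs \<Longrightarrow> 0 < x" "cs \<noteq> []" "cs ! j = a" "prefix (as @ [a]) cs"
  proof -
    show "length cs = n" using \<open>j < n\<close> by (simp add: cs_def j_def)
    show "sorted cs" using sort by (auto simp: cs_def sorted_append)
    show "\<And>x. x \<in> set cs \<Longrightarrow> 0 < x" using ap apos by (auto simp: cs_def)
    show "cs ! j = a" using \<open>j < n\<close> by (simp add: cs_def j_def nth_append)
    have "n - j = Suc (n - Suc j)" using \<open>j < n\<close> by simp
    then have "cs = (as @ [a]) @ replicate (n - Suc j) a" by (simp add: cs_def)
    then show "prefix (as @ [a]) cs" "cs \<noteq> []" by (auto simp: prefix_def)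
  qed
  have mw: "multi_weight n (exponent_weight cs) \<gamma> = weighted_degree as \<gamma> + of_nat (\<Sum>i=length as..<n. \<gamma> i) / a" for \<gamma>
    unfolding cs_def j_def using jn by (rule multi_weight_replicate)
  \<comment> \<open>By \<open>aN\<close> the exponents \<beta> belong to a monomial of weight one,
    so a coprime degree exists.\<close>
  obtain K where K: "centre_of \<phi> X cs K"
  proof -
    have "(\<Sum>i<length cs. of_nat (\<beta> i) / cs ! i) = multi_weight n (exponent_weight cs) \<beta>"
      unfolding multi_weight_def cs(1) by (rule sum.cong) (auto simp: exponent_weight_def cs(1))
    then have "(\<Sum>i<length cs. of_nat (\<beta> i) / cs ! i) = 1" unfolding mw using aN by simp
    then have "\<exists>K. centre_of \<phi> X cs K"
      by (intro centre_of_exists[where z = \<beta>]) (use cs X lX in \<open>auto simp: system_of_parameters_def\<close>)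
    then show ?thesis using that by blast
  qed
  note K = centre_of_data[OF X K order.eq_iff[THEN iffD1, OF cs(1), THEN conjunct1]]
  have KX: "compatible_system \<phi> n K X" by (rule K(3)[OF X]) (simp add: cs(1) lX)
  have K_adm: "admissible I K"
    unfolding admissible_iff[OF K(1) KX] K(2)
  proof
    fix h assume h: "h \<in> I"
    show "h \<in> weighted_ideal X (exponent_weight cs) 1"
    proof (rule weighted_ideal_criterion[OF X exponent_weight_nonneg[OF cs(3)]])
      fix \<gamma> assume g: "\<And>i. n \<le> i \<Longrightarrow> \<gamma> i = 0" "multi_weight n (exponent_weight cs) \<gamma> < 1"
      let ?M = "of_nat (\<Sum>i=length as..<n. \<gamma> i) :: rat"
      have M: "0 \<le> ?M / a" by (rule divide_nonneg_pos[OF of_nat_0_le_iff ap])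
      then have wg: "weighted_degree as \<gamma> < 1" using g(2) unfolding mw by linarith
      have "?M / a < 1 - weighted_degree as \<gamma>" using g(2) unfolding mw by linarith
      \<comment> \<open>A derivative of weight below one would lie below the minimum, so it takes no
        unit value on \<open>I\<close>.\<close>
      then have "\<Xi> n as \<gamma> < a" using wg ap by (simp add: \<Xi>_def field_simps del: of_nat_sum)
      then have "\<gamma> \<notin> S_set \<phi> X I as" using least[of \<gamma>] by auto
      then show "multi_deriv \<phi> X \<gamma> h \<in> max_ideal" using S_iff g(1) wg h by blast
    qed
  qed

  have gW: "g \<in> weighted_ideal Y (exponent_weight bs) (1 / a)"
    if Y: "system_of_parameters \<phi> n Y" and bs: "prefix as bs" "pre_invariant n bs" "j < length bs" "bs ! j = a"
      and eq: "\<And>t. weighted_ideal X (exponent_weight as) t = weighted_ideal Y (exponent_weight as) t"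
      and I: "I \<subseteq> weighted_ideal Y (exponent_weight bs) 1" for Y bs
  proof -
    let ?b = "\<beta>(l := \<beta> l - 1)"
    have "g \<in> weighted_ideal Y (exponent_weight bs)
        (1 - (weighted_degree as ?b + of_nat (\<Sum>i=length as..<n. ?b i) / bs ! length as))"
      unfolding g_def
      by (rule dominating_drop[OF X Y bs(1) _ bs(2) eq]) (use bs f I in \<open>auto simp: j_def\<close>)
    moreover have "weighted_degree as ?b = weighted_degree as \<beta>"
      unfolding weighted_degree_def by (rule sum.cong) (use l in auto)
    \<comment> \<open>The whole of \<beta> uses up weight one; without the derivative along
      \<open>l\<close>, which costs \<open>1 / a\<close>, exactly that much is left.\<close>
    moreover have "?N = Suc (\<Sum>i=length as..<n. ?b i)"
    proof -
      have "(\<Sum>i\<in>{length as..<n}-{l}. ?b i) = (\<Sum>i\<in>{length as..<n}-{l}. \<beta> i)" by (rule sum.cong) auto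
      then show ?thesis using l by (simp add: sum.remove[of _ l])
    qed
    then have "(of_nat (\<Sum>i=length as..<n. ?b i) :: rat) = of_nat ?N - 1" by simp
    ultimately have "g \<in> weighted_ideal Y (exponent_weight bs)
        (1 - (weighted_degree as \<beta> + (of_nat ?N - 1) / a))"
      using bs(4) by (simp add: j_def)
    moreover have "1 - (weighted_degree as \<beta> + (of_nat ?N - 1) / a) = 1 / a"
      using aN by (simp add: diff_divide_distrib)
    ultimately show ?thesis by simp
  qed
  have pas: "prefix as bs" if "prefix (as @ [a]) bs" for bs
    using that by (metis append_prefixD)
  \<comment> \<open>The admissible centre \<open>K\<close> is compatible with \<open>X\<close>
    itself, so the estimate applies with \<open>Y = X\<close>, and positive weight means vanishing
    at the point.\<close>
  have gm: "g \<in> max_ideal"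
  proof -
    have "g \<in> weighted_ideal X (exponent_weight cs) (1 / a)"
    proof (rule gW[OF X])
      show "pre_invariant n cs" using cs by (simp add: pre_invariant_def)
      show "I \<subseteq> weighted_ideal X (exponent_weight cs) 1"
        using K_adm admissible_iff[OF K(1) KX] K(2) by simp
    qed (use cs pas \<open>j < n\<close> in auto)
    then show ?thesis using weighted_ideal_pos_max[OF loc mX, of "1 / a"] ap by auto
  qed

  define ps where "ps = take j X @ [g]"
  have lps: "length ps = Suc j" using \<open>j < n\<close> lX by (simp add: ps_def)
  have ps: "parameters \<phi> ps"
    unfolding parameters_iff[OF X]
  proof (intro conjI allI impI)
    show "set ps \<subseteq> max_ideal" using gm mX set_take_subset[of j X] by (auto simp: ps_def)
    fix c r assume c: "\<forall>i<n. (\<Sum>l<length ps. c l * partial_deriv \<phi> X i (ps ! l)) \<in> max_ideal"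
      and r: "r < length ps"
    have eq: "(\<Sum>l<length ps. c l * partial_deriv \<phi> X i (ps ! l))
        = (if i < j then c i else 0) + c j * partial_deriv \<phi> X i g" if i: "i < n" for i
    proof -
      have "(\<Sum>l<length ps. c l * partial_deriv \<phi> X i (ps ! l))
          = (\<Sum>l<j. c l * partial_deriv \<phi> X i (ps ! l)) + c j * partial_deriv \<phi> X i g"
        using \<open>j < n\<close> lX by (simp add: lps) (simp add: ps_def nth_append)
      also have "(\<Sum>l<j. c l * partial_deriv \<phi> X i (ps ! l)) = (\<Sum>l<j. if l = i then c l else 0)"
        by (rule sum.cong) (use partial_param[OF X i] \<open>j < n\<close> lX in \<open>auto simp: ps_def nth_append\<close>)
      finally show ?thesis by simp
    qed
    \<comment> \<open>In the row of the derivative along \<open>X ! l\<close> the first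
      \<open>j\<close> entries are zero, since \<open>j \<le> l\<close>; only the unit derivative of
      \<open>g\<close> remains.\<close>
    have "c j * partial_deriv \<phi> X l g \<in> max_ideal" using c eq[OF l(2)] l by (auto simp: j_def)
    then have cj: "c j \<in> max_ideal" using dg max_ideal_prime[OF loc] by blast
    show "c r \<in> max_ideal"
    proof (cases "r = j")
      case False
      then have "r < j" using r lps by simp
      then have "c r + c j * partial_deriv \<phi> X r g \<in> max_ideal" using c[rule_format, of r] eq[of r] \<open>j < n\<close> by simp
      from max_simps(4)[OF this max_simps(5)[OF cj, of "partial_deriv \<phi> X r g"]] show ?thesis by simp
    qed (use cj in simp)
  qed
  \<comment> \<open>Again a monomial of weight one: the whole order of \<beta> from index
    \<open>j\<close> on is placed on the single new variable.\<close>
  define z where "z i = (if i < j then \<beta> i else ?N)" for i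
  have "\<exists>L. centre_of \<phi> ps (as @ [a]) L"
  proof (rule centre_of_exists[OF ps])
    have "(\<Sum>i<length (as @ [a]). of_nat (z i) / (as @ [a]) ! i)
        = (\<Sum>i<length as. of_nat (z i) / (as @ [a]) ! i) + of_nat ?N / a"
      by (simp add: z_def j_def nth_append)
    also have "(\<Sum>i<length as. of_nat (z i) / (as @ [a]) ! i) = weighted_degree as \<beta>"
      unfolding weighted_degree_def by (rule sum.cong) (auto simp: z_def j_def nth_append)
    finally show "(\<Sum>i<length (as @ [a]). of_nat (z i) / (as @ [a]) ! i) = 1" using aN by simp
  qed (use lps sort apos ap in \<open>auto simp: j_def\<close>)
  then obtain L where L: "centre_of \<phi> ps (as @ [a]) L" by blast
  have jn': "length (as @ [a]) \<le> n" using \<open>j < n\<close> by (simp add: j_def)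
  note LD = centre_of_data[OF X L jn']

  have "semi_associated \<phi> n I (Suc j) L"
    unfolding semi_associated_def LD(2)
  proof (intro conjI allI impI)
    show "marked_centre \<phi> n L" by (rule LD(1))
    show "semi_admissible \<phi> n I (Suc j) (as @ [a])"
      unfolding semi_admissible_def
    proof (intro conjI exI)
      show "pre_invariant n (as @ [a])" using jn' sort apos ap by (auto simp: pre_invariant_def)
      show "admissible_invariant \<phi> n I cs"
        unfolding admissible_invariant_def using K(1,2) K_adm by blast
    qed (use cs in \<open>simp_all add: j_def\<close>)
  next
    fix bs assume bs: "semi_admissible \<phi> n I (Suc j) bs"
    then obtain us u where b: "bs = us @ [u]" "length us = j"
      by (auto simp: semi_admissible_def length_Suc_conv_rev)
    obtain J' where J': "marked_centre \<phi> n J'" "admissible I J'" "prefix (us @ [u]) (invariant \<phi> n J')"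
      using bs b by (auto simp: semi_admissible_def admissible_invariant_def)
    have pus: "prefix us (invariant \<phi> n J')" using J'(3) by (metis append_prefixD)
    \<comment> \<open>Semi-association of \<open>J\<close> compares the first \<open>j\<close>
      entries. The last one matters only if they equal \<open>as\<close>, and then
      \<open>upper\<close> bounds it.\<close>
    have "semi_admissible \<phi> n I j us"
      unfolding semi_admissible_def
    proof (intro conjI exI)
      show "pre_invariant n us"
        using bs b by (auto simp: semi_admissible_def pre_invariant_def sorted_append)
      show "admissible_invariant \<phi> n I (invariant \<phi> n J')"
        using J' unfolding admissible_invariant_def by blast
    qed (use b pus in simp_all)
    then have "pre_invariant_le n us as" using assoc J(2) by (simp add: semi_associated_def j_def)
    moreover have "u \<le> a" if "us = as"
    proof -
      have "invariant \<phi> n J' ! j = u" using J'(3) b(2) by (auto simp: prefix_def nth_append)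
      moreover have "invariant \<phi> n J' ! j \<le> \<Xi> n as \<beta>"
        by (rule upper[OF J'(1,2) _ \<beta>]) (use pus that in simp)
      ultimately show ?thesis by (simp add: a_def)
    qed
    ultimately show "pre_invariant_le n bs (as @ [a])"
      unfolding b(1) by (intro pre_invariant_le_snoc) (use b(2) \<open>j < n\<close> in \<open>simp_all add: j_def\<close>)
  next
    fix J' assume "marked_centre \<phi> n J' \<and> admissible I J' \<and> prefix (as @ [a]) (invariant \<phi> n J')"
    then have J': "marked_centre \<phi> n J'" "admissible I J'" "prefix (as @ [a]) (invariant \<phi> n J')" by auto
    define bs where "bs = invariant \<phi> n J'"
    note pbs = pas[OF J'(3)[folded bs_def]]
    obtain Y where Y: "system_of_parameters \<phi> n Y" "compatible_system \<phi> n J' Y"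
      "\<And>t. weighted_ideal X (exponent_weight as) t = weighted_ideal Y (exponent_weight as) t"
      "I \<subseteq> weighted_ideal Y (exponent_weight bs) 1" "pre_invariant n bs" "j < length bs"
      using dom[OF J'(1,2)] pbs unfolding bs_def by blast
    have bsa: "bs ! j = a" using J'(3) by (auto simp: bs_def prefix_def nth_append j_def)
    have bpos: "\<And>x. x \<in> set bs \<Longrightarrow> 0 < x" and bsort: "sorted bs" using Y(5) by (auto simp: pre_invariant_def)
    let ?w = "exponent_weight bs"
    have wj: "?w j = 1 / a" using Y(6) bsa by (simp add: exponent_weight_def)
    have w0: "0 \<le> ?w i" for i by (rule exponent_weight_nonneg[OF bpos])
    define U where "U = take j X @ drop j Y"
    have U: "system_of_parameters \<phi> n U" "\<And>t. weighted_ideal U ?w t = weighted_ideal Y ?w t"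
      using splice_system[OF X Y(1) apos jn Y(3)] pbs bpos by (auto simp: U_def j_def)
    have lU: "length U = n" by (rule system_length[OF U(1)])
    have Unth: "U ! r = X ! r" if "r < j" for r
      using that lX \<open>j < n\<close> by (simp add: U_def nth_append)
    have gU: "g \<in> weighted_ideal U ?w (1 / a)"
      unfolding U(2) by (rule gW[OF Y(1) pbs Y(5,6) bsa Y(3,4)])
    \<comment> \<open>By the chain rule the unit derivative of \<open>g\<close> along
      \<open>X ! l\<close> has a unit summand. Its index is at least \<open>j\<close>, because the
      first \<open>j\<close> parameters of \<open>U\<close> are those of \<open>X\<close>, whose
      derivatives along \<open>X ! l\<close> vanish.\<close>
    have "\<exists>q<n. partial_deriv \<phi> U q g * partial_deriv \<phi> X l (U ! q) \<notin> max_ideal"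
    proof (rule ccontr)
      assume "\<not> ?thesis"
      then have "(\<Sum>q<n. partial_deriv \<phi> U q g * partial_deriv \<phi> X l (U ! q)) \<in> max_ideal"
        by (intro ideal.subspace_sum[OF loc]) auto
      then show False using dg chain_rule[OF U(1) partial_derivation[OF X l(2)], of g] by simp
    qed
    then obtain q where q: "q < n" "partial_deriv \<phi> U q g * partial_deriv \<phi> X l (U ! q) \<notin> max_ideal" by blast
    have dq: "partial_deriv \<phi> U q g \<notin> max_ideal" using q(2) max_simps(5) by blast
    have jq: "j \<le> q"
    proof (rule ccontr)
      assume "\<not> j \<le> q"
      then have "partial_deriv \<phi> X l (U ! q) = 0"
        using Unth[of q] partial_param[OF X l(2) q(1)] l(1) by (simp add: j_def)
      then show False using q(2) max_simps(1) by simp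
    qed
    \<comment> \<open>A unit has no positive weight, so \<open>?w q\<close> is at least
      \<open>1 / a\<close>; the other inequality holds because \<open>bs\<close> is sorted.\<close>
    have "partial_deriv \<phi> U q g \<in> weighted_ideal U ?w (1 / a - ?w q)"
      by (rule partial_weighted_ideal[OF U(1) w0 q(1) gU])
    then have "\<not> 0 < 1 / a - ?w q"
      using dq weighted_ideal_pos_max[OF loc system_set[OF U(1)]] by blast
    moreover have "?w q \<le> 1 / a"
      using exponent_weight_sorted_le[OF bsort bpos Y(6) jq] bsa by simp
    ultimately have wq: "?w q = 1 / a" by simp
    define Z where "Z = U[q := g]"
    have Z: "system_of_parameters \<phi> n Z" "\<And>t. weighted_ideal Z ?w t = weighted_ideal U ?w t"
      unfolding Z_def using weighted_ideal_exchange[where w = ?w, OF U(1) w0 q(1) _ gm dq] gU wq by simp_all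
    \<comment> \<open>\<open>J'\<close> may have several parameters of weight \<open>1 / a\<close>.
      The one that was replaced by \<open>g\<close> is moved to position \<open>j\<close>, where
      \<open>ps\<close> has it.\<close>
    define V where "V = Z[j := Z ! q, q := Z ! j]"
    have V: "system_of_parameters \<phi> n V" "\<And>t. weighted_ideal V ?w t = weighted_ideal Z ?w t"
      unfolding V_def using weighted_ideal_swap[OF Z(1) \<open>j < n\<close> q(1), of ?w] wj wq by simp_all
    have "take (Suc j) V = ps"
    proof (rule nth_equalityI)
      show "length (take (Suc j) V) = length ps" using system_length[OF V(1)] \<open>j < n\<close> lps by simp
      fix r assume "r < length (take (Suc j) V)"
      then have r: "r < Suc j" by simp
      show "take (Suc j) V ! r = ps ! r"
      proof (cases "r = j")
        case True
        then show ?thesis using lU q(1) \<open>j < n\<close> lX jq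
          by (cases "q = j") (simp_all add: V_def Z_def ps_def nth_append)
      next
        case False
        then show ?thesis using r lU q(1) \<open>j < n\<close> lX jq Unth[of r]
          by (simp add: V_def Z_def ps_def nth_append)
      qed
    qed
    then have "compatible_system \<phi> n L V" by (intro LD(3)[OF V(1)]) (simp add: j_def)
    moreover have "compatible_system \<phi> n J' V"
      by (rule compatible_systemI[OF J'(1) Y(2) V(1)]) (use V(2) Z(2) U(2) in \<open>simp add: bs_def\<close>)
    ultimately show "centre_dominates \<phi> n J' L"
      unfolding centre_dominates_def LD(2) using J'(3) by blast
  qed
  then show "\<exists>J'. centre_of \<phi> (take (length as) X @ [multi_deriv \<phi> X (\<beta>(l := \<beta> l - 1)) f])
             (as @ [\<Xi> n as \<beta>]) J' \<and> semi_associated \<phi> n I (Suc (length as)) J'"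
    using L unfolding ps_def g_def a_def j_def by blast
qed

end

theorem proposition3p2p7:
  fixes \<phi> :: "'k::field_char_0 \<Rightarrow> 'a::comm_ring_1"
    and n j :: nat
    and I :: "'a set"
    and xs :: "'a list"
    and as :: "rat list"
    and J :: "'a centre"
  assumes "smooth_local_ring \<phi> n"
    and "ideal.subspace I" and "I \<subseteq> max_ideal" and "pure_positive_codim I"
    and "system_of_parameters \<phi> n xs"
    and "j \<le> n" and "length as = j"
    and "centre_of \<phi> (take j xs) as J"
    and "semi_associated \<phi> n I j J"
    and "\<not> admissible I J"
  shows "(\<exists>\<beta>. is_arg_min (\<Xi> n as) (\<lambda>\<gamma>. \<gamma> \<in> S_set \<phi> xs I as) \<beta>) \<and>
         (\<forall>\<beta> l f.
            is_arg_min (\<Xi> n as) (\<lambda>\<gamma>. \<gamma> \<in> S_set \<phi> xs I as) \<beta> \<and>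
            j \<le> l \<and> l < n \<and> 0 < \<beta> l \<and>
            f \<in> I \<and> multi_deriv \<phi> xs \<beta> f \<notin> max_ideal \<longrightarrow>
            (\<exists>J'. centre_of \<phi> (take j xs @ [multi_deriv \<phi> xs (\<beta>(l := \<beta> l - 1)) f])
                            (as @ [\<Xi> n as \<beta>]) J' \<and>
                  semi_associated \<phi> n I (Suc j) J'))"
proof -
  interpret smooth_local_algebra \<phi> n
    using assms(1) by unfold_locales (auto simp: smooth_local_ring_def)
  show ?thesis
    using next_semi_associated[of xs as J I] assms by blast
qed

end
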